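(* Let $N=pl$ with $l\neq 1,N$, let $\Lambda$ be the cyclic permutation matrix of order $N$ (normalized to lie in $SL(N,\mathbb C)$), and consider the automorphism of $\mathfrak{sl}(N,\mathbb C)$ given by conjugation by $\Lambda^{p}$. Let $\mathfrak g_0$ be its invariant subalgebra. Put $\tilde e_k=\sum_{m=0}^{l-1}e_{k+mp}$ for $1\le k\le p$. (1) The simple coroots $\tilde\alpha_k^\vee=\tilde e_k-\tilde e_{k+1}$ and the simple roots $\tilde\alpha_k=\frac1l(\tilde e_k-\tilde e_{k+1})$ generate the Cartan matrix $a_{jk}=\langle\tilde\alpha_j^\vee,\tilde\alpha_k\rangle$ of type $A_{p-1}$. The simple coroots together with $$\tilde E_{i,a}=\sum_{m=0}^{l-1}E_{i+mp,\,i+a+mp},\qquad 1\le i\le p,\quad a=\pm1,\pm2,\ldots,\pm(p-1),$$ form the Chevalley basis of an invariant subalgebra $\tilde{\mathfrak g}_0=\mathfrak{sl}(p,\mathbb C)$. (2) Let $V$ be the space with basis $$\mathfrak t^0_{s,a}=\frac1{\sqrt l}\sum_{m=0}^{l-1}E_{s+mp,\,s+a+mp},\qquad 1\le s\le p,\quad p\le a\le N.$$ Together with $\tilde{\mathfrak g}_0$, $V$ forms the invariant subalgebra $$\mathfrak g_0=\underbrace{\mathfrak{sl}(p,\mathbb C)\oplus\cdots\oplus\mathfrak{sl}(p,\mathbb C)}_{l}\oplus\underbrace{\mathbb C\oplus\cdots\oplus\mathbb C}_{l-1}.$$ (3) The structure of $\mathfrak g_0$ is obtained from the extended Dynkin diagram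 of $A_{N-1}$ by dropping the $l$ roots $\alpha_p,\alpha_{2p},\ldots,\alpha_{(l-1)p},\alpha_0$; this procedure defines an automorphism of $\mathfrak{sl}(N,\mathbb C)$ of order $l=N/p$.
   Context: $E_{jk}$ are the matrix units of order $N$, with indices understood modulo $N$. $(e_1,\ldots,e_N)$ is the canonical basis of $\mathbb C^N$, identified with the diagonal matrices ($e_j=E_{jj}$), and $\langle\cdot,\cdot\rangle$ is the standard pairing. The matrix is $\Lambda=c\bigl(\sum_{j=1}^{N-1}E_{j,j+1}+E_{N,1}\bigr)$ with $c=1$ for $N$ odd and $c=\exp(\pi i/N)$ for $N$ even; up to a scalar $\Lambda^p$ has order $l$. The simple roots of $A_{N-1}$ are $\alpha_k=e_k-e_{k+1}$ $(1\le k\le N-1)$, and $\alpha_0=e_N-e_1$ is the minimal root, which is added to form the extended Dynkin diagram.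
   Formalization: In (1) the Chevalley basis uses only the Ẽ_{i,a} with 1≤i+a≤p. In (2) the printed V is not traceless: its traceless part with g̃_0 generates g_0, both printed ranges span g_0 up to trace, and the t^0_{s,a} with p<s+a≤N give a direct complement. *)

theory Defs
  imports
    Complex_Main
    "Jordan_Normal_Form.VS_Connect"
    "Jordan_Normal_Form.Gauss_Jordan_Elimination"
begin

section \<open>Complex Lie algebras\<close>

text \<open>
  A Lie algebra is carried by a \<^typ>\<open>(complex, 'a) module\<close> record whose multiplication field
  is the bracket; the unit field has no meaning. Subalgebras \<open>W\<close> of \<open>L\<close> are written
  \<open>L\<lparr>carrier := W\<rparr>\<close>, so that span, linear independence and bases are those of the
  underlying vector space over \<^term>\<open>class_ring :: complex ring\<close>.
\<close>

locale lie_algebra = vectorspace class_ring L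
  for L :: "(complex, 'a) module" (structure) +
  assumes bracket_closed: "\<lbrakk>x \<in> carrier L; y \<in> carrier L\<rbrakk> \<Longrightarrow> x \<otimes> y \<in> carrier L"
    and bracket_add_left:
      "\<lbrakk>x \<in> carrier L; y \<in> carrier L; z \<in> carrier L\<rbrakk> \<Longrightarrow> (x \<oplus> y) \<otimes> z = x \<otimes> z \<oplus> y \<otimes> z"
    and bracket_add_right:
      "\<lbrakk>x \<in> carrier L; y \<in> carrier L; z \<in> carrier L\<rbrakk> \<Longrightarrow> z \<otimes> (x \<oplus> y) = z \<otimes> x \<oplus> z \<otimes> y"
    and bracket_smult_left:
      "\<lbrakk>x \<in> carrier L; y \<in> carrier L\<rbrakk> \<Longrightarrow> (c \<odot>\<^bsub>L\<^esub> x) \<otimes> y = c \<odot>\<^bsub>L\<^esub> (x \<otimes> y)"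
    and bracket_smult_right:
      "\<lbrakk>x \<in> carrier L; y \<in> carrier L\<rbrakk> \<Longrightarrow> x \<otimes> (c \<odot>\<^bsub>L\<^esub> y) = c \<odot>\<^bsub>L\<^esub> (x \<otimes> y)"
    and bracket_self: "x \<in> carrier L \<Longrightarrow> x \<otimes> x = \<zero>"
    and jacobi:
      "\<lbrakk>x \<in> carrier L; y \<in> carrier L; z \<in> carrier L\<rbrakk>
        \<Longrightarrow> x \<otimes> (y \<otimes> z) \<oplus> y \<otimes> (z \<otimes> x) \<oplus> z \<otimes> (x \<otimes> y) = \<zero>"

abbreviation lspan :: "(complex, 'a) module \<Rightarrow> 'a set \<Rightarrow> 'a set" where
  "lspan L \<equiv> LinearCombinations.module.span class_ring L"

abbreviation lindep :: "(complex, 'a) module \<Rightarrow> 'a set \<Rightarrow> bool" where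
  "lindep L \<equiv> LinearCombinations.module.lin_dep class_ring L"

abbreviation lbasis :: "(complex, 'a) module \<Rightarrow> 'a set \<Rightarrow> bool" where
  "lbasis L \<equiv> VectorSpace.vectorspace.basis class_ring L"

definition lie_subalgebra :: "'a set \<Rightarrow> (complex, 'a) module \<Rightarrow> bool" where
  "lie_subalgebra W L \<longleftrightarrow>
     VectorSpace.subspace class_ring W L \<and> (\<forall>x\<in>W. \<forall>y\<in>W. x \<otimes>\<^bsub>L\<^esub> y \<in> W)"

definition lie_hull :: "(complex, 'a) module \<Rightarrow> 'a set \<Rightarrow> 'a set" where
  "lie_hull L S = \<Inter>{W. lie_subalgebra W L \<and> S \<subseteq> W}"

definition lie_iso :: "(complex, 'a) module \<Rightarrow> (complex, 'b) module \<Rightarrow> ('a \<Rightarrow> 'b) set" where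
  "lie_iso L M = {f \<in> LinearCombinations.module_hom class_ring L M.
     bij_betw f (carrier L) (carrier M) \<and>
     (\<forall>x\<in>carrier L. \<forall>y\<in>carrier L. f (x \<otimes>\<^bsub>L\<^esub> y) = f x \<otimes>\<^bsub>M\<^esub> f y)}"

definition lie_isomorphic :: "(complex, 'a) module \<Rightarrow> (complex, 'b) module \<Rightarrow> bool" where
  "lie_isomorphic L M \<longleftrightarrow> lie_iso L M \<noteq> {}"

definition lie_power :: "(complex, 'a) module \<Rightarrow> nat \<Rightarrow> (complex, nat \<Rightarrow> 'a) module" where
  "lie_power L n = \<lparr>
     carrier = {..<n} \<rightarrow>\<^sub>E carrier L,
     mult = (\<lambda>f g. \<lambda>i\<in>{..<n}. f i \<otimes>\<^bsub>L\<^esub> g i),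
     one = (\<lambda>i\<in>{..<n}. \<one>\<^bsub>L\<^esub>),
     zero = (\<lambda>i\<in>{..<n}. \<zero>\<^bsub>L\<^esub>),
     add = (\<lambda>f g. \<lambda>i\<in>{..<n}. f i \<oplus>\<^bsub>L\<^esub> g i),
     smult = (\<lambda>c f. \<lambda>i\<in>{..<n}. c \<odot>\<^bsub>L\<^esub> f i)\<rparr>"

definition lie_sum ::
    "(complex, 'a) module \<Rightarrow> (complex, 'b) module \<Rightarrow> (complex, 'a \<times> 'b) module" where
  "lie_sum L M = \<lparr>
     carrier = carrier L \<times> carrier M,
     mult = (\<lambda>(x, y) (x', y'). (x \<otimes>\<^bsub>L\<^esub> x', y \<otimes>\<^bsub>M\<^esub> y')),
     one = (\<one>\<^bsub>L\<^esub>, \<one>\<^bsub>M\<^esub>),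
     zero = (\<zero>\<^bsub>L\<^esub>, \<zero>\<^bsub>M\<^esub>),
     add = (\<lambda>(x, y) (x', y'). (x \<oplus>\<^bsub>L\<^esub> x', y \<oplus>\<^bsub>M\<^esub> y')),
     smult = (\<lambda>c (x, y). (c \<odot>\<^bsub>L\<^esub> x, c \<odot>\<^bsub>M\<^esub> y))\<rparr>"

definition abelian_line :: "(complex, complex) module" where
  "abelian_line = \<lparr>carrier = UNIV, mult = (\<lambda>_ _. 0), one = 0, zero = 0, add = (+), smult = (*)\<rparr>"

definition has_order :: "'a set \<Rightarrow> ('a \<Rightarrow> 'a) \<Rightarrow> nat \<Rightarrow> bool" where
  "has_order A f n \<longleftrightarrow> 0 < n \<and> (\<forall>x\<in>A. (f ^^ n) x = x) \<and>
     (\<forall>k. 0 < k \<and> k < n \<longrightarrow> (\<exists>x\<in>A. (f ^^ k) x \<noteq> x))"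

subsection \<open>Cartan subalgebras, roots and Chevalley bases\<close>

primrec lower_central :: "(complex, 'a) module \<Rightarrow> 'a set \<Rightarrow> nat \<Rightarrow> 'a set" where
  "lower_central L W 0 = W"
| "lower_central L W (Suc n) = lspan L {x \<otimes>\<^bsub>L\<^esub> y | x y. x \<in> W \<and> y \<in> lower_central L W n}"

definition cartan_subalgebra :: "'a set \<Rightarrow> (complex, 'a) module \<Rightarrow> bool" where
  "cartan_subalgebra H L \<longleftrightarrow> lie_subalgebra H L \<and>
     (\<exists>n. lower_central L H n = {\<zero>\<^bsub>L\<^esub>}) \<and>
     {x \<in> carrier L. \<forall>h\<in>H. x \<otimes>\<^bsub>L\<^esub> h \<in> H} = H"

definition weight_space :: "(complex, 'a) module \<Rightarrow> 'a set \<Rightarrow> ('a \<Rightarrow> complex) \<Rightarrow> 'a set" where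
  "weight_space L H \<beta> = {x \<in> carrier L. \<forall>h\<in>H. h \<otimes>\<^bsub>L\<^esub> x = \<beta> h \<odot>\<^bsub>L\<^esub> x}"

text \<open>Functionals on \<open>H\<close> are extensional, so that distinct functions are distinct roots.\<close>

definition roots :: "(complex, 'a) module \<Rightarrow> 'a set \<Rightarrow> ('a \<Rightarrow> complex) set" where
  "roots L H = {\<beta> \<in> extensional H. (\<exists>h\<in>H. \<beta> h \<noteq> 0) \<and> weight_space L H \<beta> \<noteq> {\<zero>\<^bsub>L\<^esub>}}"

definition root_plus :: "'a set \<Rightarrow> ('a \<Rightarrow> complex) \<Rightarrow> ('a \<Rightarrow> complex) \<Rightarrow> 'a \<Rightarrow> complex" where
  "root_plus H \<beta> \<gamma> = (\<lambda>h\<in>H. \<beta> h + \<gamma> h)"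

definition root_neg :: "'a set \<Rightarrow> ('a \<Rightarrow> complex) \<Rightarrow> 'a \<Rightarrow> complex" where
  "root_neg H \<beta> = (\<lambda>h\<in>H. - \<beta> h)"

definition root_base ::
    "(complex, 'a) module \<Rightarrow> 'a set \<Rightarrow> 'i set \<Rightarrow> ('i \<Rightarrow> 'a \<Rightarrow> complex) \<Rightarrow> bool" where
  "root_base L H I \<alpha> \<longleftrightarrow> finite I \<and> \<alpha> ` I \<subseteq> roots L H \<and>
     (\<forall>c. (\<forall>h\<in>H. (\<Sum>i\<in>I. c i * \<alpha> i h) = 0) \<longrightarrow> (\<forall>i\<in>I. c i = 0)) \<and>
     (\<forall>\<beta>\<in>roots L H. \<exists>n :: 'i \<Rightarrow> nat.
        (\<forall>h\<in>H. \<beta> h = (\<Sum>i\<in>I. of_nat (n i) * \<alpha> i h)) \<or>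
        (\<forall>h\<in>H. \<beta> h = - (\<Sum>i\<in>I. of_nat (n i) * \<alpha> i h)))"

text \<open>
  Simple coroots \<open>h i\<close> and root vectors \<open>x \<beta>\<close>, normalised by
  \<open>[x \<beta>, x (-\<beta>)] = \<beta>\<^sup>\<or>\<close> (the element of \<open>[L\<^sub>\<beta>, L\<^sub>-\<^sub>\<beta>]\<close> on which \<open>\<beta>\<close> takes the value 2)
  and by \<open>c(\<beta>, \<gamma>) = - c(-\<beta>, -\<gamma>)\<close> for the structure constants.
\<close>

definition chevalley_basis ::
    "(complex, 'a) module \<Rightarrow> 'a set \<Rightarrow> 'i set \<Rightarrow> ('i \<Rightarrow> 'a \<Rightarrow> complex) \<Rightarrow> ('i \<Rightarrow> 'a)
      \<Rightarrow> (('a \<Rightarrow> complex) \<Rightarrow> 'a) \<Rightarrow> bool" where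
  "chevalley_basis L H I \<alpha> h x \<longleftrightarrow>
     cartan_subalgebra H L \<and> root_base L H I \<alpha> \<and>
     (\<forall>\<beta>\<in>roots L H. x \<beta> \<in> weight_space L H \<beta>) \<and>
     (\<forall>\<beta>\<in>roots L H. root_neg H \<beta> \<in> roots L H \<and>
        x \<beta> \<otimes>\<^bsub>L\<^esub> x (root_neg H \<beta>) \<in> H \<and> \<beta> (x \<beta> \<otimes>\<^bsub>L\<^esub> x (root_neg H \<beta>)) = 2) \<and>
     (\<forall>i\<in>I. h i = x (\<alpha> i) \<otimes>\<^bsub>L\<^esub> x (root_neg H (\<alpha> i))) \<and>
     (\<forall>\<beta>\<in>roots L H. \<forall>\<gamma>\<in>roots L H. root_plus H \<beta> \<gamma> \<in> roots L H \<longrightarrow>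
        (\<exists>c. x \<beta> \<otimes>\<^bsub>L\<^esub> x \<gamma> = c \<odot>\<^bsub>L\<^esub> x (root_plus H \<beta> \<gamma>) \<and>
             x (root_neg H \<beta>) \<otimes>\<^bsub>L\<^esub> x (root_neg H \<gamma>)
               = (- c) \<odot>\<^bsub>L\<^esub> x (root_neg H (root_plus H \<beta> \<gamma>)))) \<and>
     inj_on h I \<and> inj_on x (roots L H) \<and> lbasis L (h ` I \<union> x ` roots L H)"

text \<open>The Cartan matrix of type \<open>A\<^sub>n\<close>; the indices run through \<open>1, \<dots>, n\<close>.\<close>

definition cartan_A :: "int \<Rightarrow> int \<Rightarrow> complex" where
  "cartan_A j k = (if j = k then 2 else if \<bar>j - k\<bar> = 1 then -1 else 0)"

section \<open>The algebras gl(n) and sl(n)\<close>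

definition mtrace :: "complex mat \<Rightarrow> complex" where
  "mtrace A = (\<Sum>i<dim_row A. A $$ (i, i))"

definition gl_lie :: "nat \<Rightarrow> (complex, complex mat) module" where
  "gl_lie n = (module_mat TYPE(complex) n n)\<lparr>mult := (\<lambda>A B. A * B - B * A)\<rparr>"

definition sl_lie :: "nat \<Rightarrow> (complex, complex mat) module" where
  "sl_lie n = (gl_lie n)\<lparr>carrier := {A \<in> carrier_mat n n. mtrace A = 0}\<rparr>"

lemma gl_lie_simps [simp]:
  "carrier (gl_lie n) = carrier_mat n n" "zero (gl_lie n) = 0\<^sub>m n n"
  "add (gl_lie n) = (+)" "module.smult (gl_lie n) = (\<cdot>\<^sub>m)"
  "monoid.mult (gl_lie n) = (\<lambda>A B. A * B - B * A)"
  by (simp_all add: gl_lie_def module_mat_def)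

lemma sl_lie_simps [simp]:
  "carrier (sl_lie n) = {A \<in> carrier_mat n n. mtrace A = 0}" "zero (sl_lie n) = 0\<^sub>m n n"
  "add (sl_lie n) = (+)" "module.smult (sl_lie n) = (\<cdot>\<^sub>m)"
  "monoid.mult (sl_lie n) = (\<lambda>A B. A * B - B * A)"
  by (simp_all add: sl_lie_def)

lemma lie_algebra_gl: "lie_algebra (gl_lie n)"
proof -
  have ag: "abelian_group (gl_lie n)"
    by (unfold_locales, insert add_inv_exists_mat, auto simp: Units_def)
  have mo: "module class_ring (module_mat TYPE(complex) n n)"
    using matrix_vs[where 'a = complex] unfolding vectorspace_def by blast
  then have "module class_ring (gl_lie n)"
    using ag unfolding Module.module_def Module.module_axioms_def by (simp add: module_mat_simps)
  then have vs: "vectorspace class_ring (gl_lie n)"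
    unfolding vectorspace_def using class_field by blast
  show ?thesis
  proof (intro lie_algebra.intro lie_algebra_axioms.intro vs)
    fix x y z :: "complex mat" and c :: complex
    assume "x \<in> carrier (gl_lie n)" "y \<in> carrier (gl_lie n)"
    then have xy: "x \<in> carrier_mat n n" "y \<in> carrier_mat n n" by simp_all
    show "x \<otimes>\<^bsub>gl_lie n\<^esub> y \<in> carrier (gl_lie n)"
      using xy by (simp add: minus_carrier_mat mult_carrier_mat[of _ n n])
    show "(c \<odot>\<^bsub>gl_lie n\<^esub> x) \<otimes>\<^bsub>gl_lie n\<^esub> y = c \<odot>\<^bsub>gl_lie n\<^esub> (x \<otimes>\<^bsub>gl_lie n\<^esub> y)"
      "x \<otimes>\<^bsub>gl_lie n\<^esub> (c \<odot>\<^bsub>gl_lie n\<^esub> y) = c \<odot>\<^bsub>gl_lie n\<^esub> (x \<otimes>\<^bsub>gl_lie n\<^esub> y)"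
      using xy by (auto intro!: eq_matI simp: mult_smult_distrib[OF xy]
          mult_smult_distrib[OF xy(2,1)] mult_smult_assoc_mat[OF xy]
          mult_smult_assoc_mat[OF xy(2,1)] algebra_simps)
    assume "z \<in> carrier (gl_lie n)"
    then have z: "z \<in> carrier_mat n n" by simp
    show "(x \<oplus>\<^bsub>gl_lie n\<^esub> y) \<otimes>\<^bsub>gl_lie n\<^esub> z = x \<otimes>\<^bsub>gl_lie n\<^esub> z \<oplus>\<^bsub>gl_lie n\<^esub> y \<otimes>\<^bsub>gl_lie n\<^esub> z"
      "z \<otimes>\<^bsub>gl_lie n\<^esub> (x \<oplus>\<^bsub>gl_lie n\<^esub> y) = z \<otimes>\<^bsub>gl_lie n\<^esub> x \<oplus>\<^bsub>gl_lie n\<^esub> z \<otimes>\<^bsub>gl_lie n\<^esub> y"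
      using xy z by (auto intro!: eq_matI simp: add_mult_distrib_mat[OF xy z]
          mult_add_distrib_mat[OF z xy])
    have p: "a * b \<in> carrier_mat n n" if "a \<in> carrier_mat n n" "b \<in> carrier_mat n n"
      for a b :: "complex mat" using that by simp
    have d: "a * (b * c - c * b) - (b * c - c * b) * a = (a * b * c - a * c * b) - (b * c * a - c * b * a)"
      if "a \<in> carrier_mat n n" "b \<in> carrier_mat n n" "c \<in> carrier_mat n n"
      for a b c :: "complex mat"
      using that by (simp add: mult_minus_distrib_mat[OF _ p p] minus_mult_distrib_mat[OF p p]
          assoc_mult_mat[of _ n n _ n _ n])
    have "x * (y * z - z * y) - (y * z - z * y) * x + (y * (z * x - x * z) - (z * x - x * z) * y)
        + (z * (x * y - y * x) - (x * y - y * x) * z) = 0\<^sub>m n n"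
      unfolding d[OF xy z] d[OF xy(2) z xy(1)] d[OF z xy]
      using xy z by (intro eq_matI) (auto simp del: index_mult_mat(1))
    then show "x \<otimes>\<^bsub>gl_lie n\<^esub> (y \<otimes>\<^bsub>gl_lie n\<^esub> z) \<oplus>\<^bsub>gl_lie n\<^esub> y \<otimes>\<^bsub>gl_lie n\<^esub> (z \<otimes>\<^bsub>gl_lie n\<^esub> x)
        \<oplus>\<^bsub>gl_lie n\<^esub> z \<otimes>\<^bsub>gl_lie n\<^esub> (x \<otimes>\<^bsub>gl_lie n\<^esub> y) = \<zero>\<^bsub>gl_lie n\<^esub>"
      by simp
  qed (auto simp: minus_r_inv_mat)
qed

lemma lie_algebra_subalgebra:
  assumes L: "lie_algebra L" and W: "lie_subalgebra W L"
  shows "lie_algebra (L\<lparr>carrier := W\<rparr>)"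
proof -
  interpret L: lie_algebra L by (rule L)
  have sub: "VectorSpace.subspace class_ring W L" and cl: "\<forall>x\<in>W. \<forall>y\<in>W. x \<otimes>\<^bsub>L\<^esub> y \<in> W"
    using W by (auto simp: lie_subalgebra_def)
  have "W \<subseteq> carrier L"
    using sub unfolding VectorSpace.subspace_def submodule_def by blast
  moreover have "vectorspace class_ring (L\<lparr>carrier := W\<rparr>)"
    by (rule L.subspace_is_vs[OF sub])
  ultimately show ?thesis
    using cl by (intro lie_algebra.intro lie_algebra_axioms.intro)
      (auto simp: subset_iff L.bracket_add_left L.bracket_add_right L.bracket_smult_left
        L.bracket_smult_right L.bracket_self L.jacobi)
qed

lemma mtrace_simps:
  assumes "A \<in> carrier_mat n n" "B \<in> carrier_mat n n"
  shows "mtrace (A + B) = mtrace A + mtrace B" "mtrace (A - B) = mtrace A - mtrace B"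
    "mtrace (c \<cdot>\<^sub>m A) = c * mtrace A" "mtrace (A * B) = mtrace (B * A)"
    "mtrace (0\<^sub>m n n) = 0"
proof -
  show "mtrace (A * B) = mtrace (B * A)"
    using assms by (simp add: mtrace_def scalar_prod_def) (subst sum.swap, simp add: mult.commute atLeast0LessThan)
qed (use assms in \<open>auto simp: mtrace_def sum.distrib sum_subtractf sum_distrib_left\<close>)

lemma lie_algebra_sl: "lie_algebra (sl_lie n)"
proof -
  have "lie_subalgebra {A \<in> carrier_mat n n. mtrace A = 0} (gl_lie n)"
    unfolding lie_subalgebra_def VectorSpace.subspace_def submodule_def
    using lie_algebra.axioms(1)[OF lie_algebra_gl, of n]
    by (auto simp: mtrace_simps[where n = n] vectorspace_def) (simp add: mtrace_def)
  from lie_algebra_subalgebra[OF lie_algebra_gl this] show ?thesis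
    by (simp add: sl_lie_def)
qed

section \<open>Matrix units, the cyclic matrix and its invariants\<close>

text \<open>
  The matrix unit \<open>E\<^sub>j\<^sub>k\<close> with integer indices modulo \<open>N\<close>. The entries of
  \<^typ>\<open>complex mat\<close> are numbered from 0, the mathematical indices from 1.
\<close>

definition munit :: "nat \<Rightarrow> int \<Rightarrow> int \<Rightarrow> complex mat" where
  "munit N j k = mat N N (\<lambda>(r, c).
     if (int r + 1) mod int N = j mod int N \<and> (int c + 1) mod int N = k mod int N then 1 else 0)"

definition matsum :: "nat \<Rightarrow> ('i \<Rightarrow> complex mat) \<Rightarrow> 'i set \<Rightarrow> complex mat" where
  "matsum N f I = mat N N (\<lambda>rc. \<Sum>i\<in>I. f i $$ rc)"

definition Lam :: "nat \<Rightarrow> complex mat" where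
  "Lam N = (if odd N then 1 else exp (pi * \<i> / N)) \<cdot>\<^sub>m
     (matsum N (\<lambda>j. munit N j (j + 1)) {1..int N - 1} + munit N (int N) 1)"

definition twist :: "nat \<Rightarrow> nat \<Rightarrow> complex mat \<Rightarrow> complex mat" where
  "twist N p X = (Lam N ^\<^sub>m p) * X * the (mat_inverse (Lam N ^\<^sub>m p))"

definition g0 :: "nat \<Rightarrow> nat \<Rightarrow> complex mat set" where
  "g0 N p = {X \<in> carrier (sl_lie N). twist N p X = X}"

text \<open>The vectors \<open>e\<^sub>k\<close> of \<open>\<complex>\<^sup>N\<close> are identified with the diagonal matrices \<open>E\<^sub>k\<^sub>k\<close>.\<close>

definition e_vec :: "nat \<Rightarrow> int \<Rightarrow> complex mat" where
  "e_vec N k = munit N k k"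

definition pairing :: "complex mat \<Rightarrow> complex mat \<Rightarrow> complex" where
  "pairing u v = (\<Sum>i<dim_row u. u $$ (i, i) * v $$ (i, i))"

definition functional :: "complex mat set \<Rightarrow> complex mat \<Rightarrow> complex mat \<Rightarrow> complex" where
  "functional H u = (\<lambda>h\<in>H. pairing u h)"

definition et :: "nat \<Rightarrow> nat \<Rightarrow> nat \<Rightarrow> int \<Rightarrow> complex mat" where
  "et N p l k = matsum N (\<lambda>m. e_vec N (k + int m * int p)) {..<l}"

definition coroot_t :: "nat \<Rightarrow> nat \<Rightarrow> nat \<Rightarrow> int \<Rightarrow> complex mat" where
  "coroot_t N p l k = et N p l k - et N p l (k + 1)"

definition root_t :: "nat \<Rightarrow> nat \<Rightarrow> nat \<Rightarrow> int \<Rightarrow> complex mat" where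
  "root_t N p l k = (1 / of_nat l) \<cdot>\<^sub>m (et N p l k - et N p l (k + 1))"

definition E_t :: "nat \<Rightarrow> nat \<Rightarrow> nat \<Rightarrow> int \<times> int \<Rightarrow> complex mat" where
  "E_t N p l = (\<lambda>(i, a). matsum N (\<lambda>m. munit N (i + int m * int p) (i + a + int m * int p)) {..<l})"

text \<open>
  The root of \<open>A\<^sub>p\<^sub>-\<^sub>1\<close> belonging to \<open>E_t (i, a)\<close>. It exists only if \<open>i + a\<close>
  lies in \<open>{1..p}\<close> again, which is what \<open>A_ind\<close> adds to the full range \<open>E_ind\<close>: the elements with
  \<open>i + a\<close> outside \<open>{1..p}\<close> join different blocks and do not lie in \<open>sl(p)\<close>.
\<close>

definition root_of :: "nat \<Rightarrow> nat \<Rightarrow> nat \<Rightarrow> int \<times> int \<Rightarrow> complex mat" where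
  "root_of N p l = (\<lambda>(i, a). (1 / of_nat l) \<cdot>\<^sub>m (et N p l i - et N p l (i + a)))"

definition E_ind :: "nat \<Rightarrow> (int \<times> int) set" where
  "E_ind p = {(i, a). 1 \<le> i \<and> i \<le> int p \<and> 1 \<le> \<bar>a\<bar> \<and> \<bar>a\<bar> \<le> int p - 1}"

definition A_ind :: "nat \<Rightarrow> (int \<times> int) set" where
  "A_ind p = {(i, a) \<in> E_ind p. 1 \<le> i + a \<and> i + a \<le> int p}"

definition H_t :: "nat \<Rightarrow> nat \<Rightarrow> nat \<Rightarrow> complex mat set" where
  "H_t N p l = lspan (sl_lie N) (coroot_t N p l ` {1..int p - 1})"

definition g0_t :: "nat \<Rightarrow> nat \<Rightarrow> nat \<Rightarrow> complex mat set" where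
  "g0_t N p l = lspan (sl_lie N) (coroot_t N p l ` {1..int p - 1} \<union> E_t N p l ` A_ind p)"

definition t0 :: "nat \<Rightarrow> nat \<Rightarrow> nat \<Rightarrow> int \<times> int \<Rightarrow> complex mat" where
  "t0 N p l sa = (1 / complex_of_real (sqrt (real l))) \<cdot>\<^sub>m E_t N p l sa"

text \<open>
  The vectors with \<open>a = N\<close> are multiples of \<open>et N p l s\<close>, which is not traceless; hence \<open>V\<close> is a
  subspace of \<open>gl(N)\<close> and only its traceless part lies in \<open>sl(N)\<close>.
\<close>

definition V_ind :: "nat \<Rightarrow> nat \<Rightarrow> (int \<times> int) set" where
  "V_ind N p = {1..int p} \<times> {int p..int N}"

definition V_space :: "nat \<Rightarrow> nat \<Rightarrow> nat \<Rightarrow> complex mat set" where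
  "V_space N p l = lspan (gl_lie N) (t0 N p l ` V_ind N p)"

text \<open>
  The index range of an honest complement of \<open>g0_t\<close>: here it is the column index \<open>s + a\<close>
  that runs through \<open>p + 1, \<dots>, N\<close>.
\<close>

definition W_ind :: "nat \<Rightarrow> nat \<Rightarrow> (int \<times> int) set" where
  "W_ind N p = {(s, a). 1 \<le> s \<and> s \<le> int p \<and> int p < s + a \<and> s + a \<le> int N}"

section \<open>The extended Dynkin diagram\<close>

definition diag_cartan :: "nat \<Rightarrow> complex mat set" where
  "diag_cartan N = {D \<in> carrier (sl_lie N). diagonal_mat D}"

definition ext_root :: "nat \<Rightarrow> int \<Rightarrow> complex mat" where
  "ext_root N k = (if k = 0 then e_vec N (int N) - e_vec N 1 else e_vec N k - e_vec N (k + 1))"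

text \<open>The vertices \<open>0, \<dots>, N - 1\<close> of the diagram with its generalised Cartan matrix.\<close>

definition ext_cartan :: "nat \<Rightarrow> int \<Rightarrow> int \<Rightarrow> complex" where
  "ext_cartan N j k = 2 * pairing (ext_root N j) (ext_root N k)
     / pairing (ext_root N j) (ext_root N j)"

definition root_vec :: "nat \<Rightarrow> int \<Rightarrow> complex mat" where
  "root_vec N k = (if k = 0 then munit N (int N) 1 else munit N k (k + 1))"

definition root_vec_neg :: "nat \<Rightarrow> int \<Rightarrow> complex mat" where
  "root_vec_neg N k = (if k = 0 then munit N 1 (int N) else munit N (k + 1) k)"

definition dropped :: "nat \<Rightarrow> nat \<Rightarrow> int set" where
  "dropped p l = (\<lambda>m. int m * int p) ` {..<l}"

definition kept :: "nat \<Rightarrow> nat \<Rightarrow> nat \<Rightarrow> int set" where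
  "kept N p l = {0..<int N} - dropped p l"

definition kept_algebra :: "nat \<Rightarrow> nat \<Rightarrow> nat \<Rightarrow> complex mat set" where
  "kept_algebra N p l = lie_hull (sl_lie N)
     (diag_cartan N \<union> root_vec N ` kept N p l \<union> root_vec_neg N ` kept N p l)"

text \<open>
  The automorphism that Kac attaches to labels \<open>s\<^sub>k\<close> on the extended diagram:
  \<open>\<sigma>(E\<^sub>k) = exp(2\<pi>i s\<^sub>k / m) E\<^sub>k\<close>, where \<open>m\<close> is the sum of the labels weighted by the marks of the
  diagram, which all equal 1 in type \<open>A\<close>. Dropping a set of roots means giving them label 1
  and all others label 0.
\<close>

definition kac_automorphism :: "nat \<Rightarrow> (int \<Rightarrow> nat) \<Rightarrow> (complex mat \<Rightarrow> complex mat) \<Rightarrow> bool" where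
  "kac_automorphism N s \<sigma> \<longleftrightarrow>
     \<sigma> \<in> lie_iso (sl_lie N) (sl_lie N) \<and> \<sigma> \<in> extensional (carrier (sl_lie N)) \<and>
     (\<forall>k\<in>{0..<int N}. \<sigma> (root_vec N k) =
        exp (2 * pi * \<i> * of_nat (s k) / of_nat (\<Sum>j\<in>{0..<int N}. s j)) \<cdot>\<^sub>m root_vec N k)"

definition drop_labels :: "nat \<Rightarrow> nat \<Rightarrow> int \<Rightarrow> nat" where
  "drop_labels p l k = (if k \<in> dropped p l then 1 else 0)"

end

theory Submission
  imports Defs
begin

text \<open>
  Up to a scalar \<open>\<Lambda>\<^sup>p\<close> is the cyclic shift by \<open>p\<close>, so its invariants are the traceless block circulant
  matrices with blocks of size \<open>p\<close>. Among them the copy of \<open>sl(p)\<close> consists of the block diagonal ones, and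
  the elements \<open>t\<^sup>0\<^sub>s\<^sub>,\<^sub>a\<close> whose column lies outside the first block span the complement. The discrete Fourier
  transform over the blocks diagonalises \<open>\<Lambda>\<^sup>p\<close>; conjugation by it turns the block circulant matrices into the
  block diagonal ones and the given automorphism into conjugation by a diagonal matrix whose entries are
  constant on blocks and run through the \<open>l\<close>-th roots of unity. The latter is Kac's automorphism for the
  dropped roots, and its invariants are generated by the diagonal matrices and the kept root vectors. Splitting
  each of the \<open>l\<close> diagonal blocks into its traceless part and its trace, subject to total trace 0, gives
  the direct sum.
\<close>

text \<open>Writing an index as \<open>m * p + i\<close> identifies C^N with the tensor product of
  C^l and C^p. The shift by \<open>p\<close> acts on the first factor only, so its commutant is
  (circulant matrices of size l) tensor gl(p), and the embedded sl(p) is 1 tensor sl(p). The Fourier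
  transform acts on the first factor; it fixes the embedded sl(p), which therefore becomes the
  diagonal copy in the sum of the \<open>l\<close> blocks. The obstacle lies in the generators.
  Membership in sl(p) depends on the column \<open>s + a\<close>, membership in \<open>V\<close> on
  the offset \<open>a\<close>. Elements with a < p whose column leaves the first block belong to
  neither space, and the elements with a = N are not traceless. Kac's automorphism is unique because
  the root vectors of the extended diagram, E_{N,1} included, generate sl(N) even without their
  negatives.\<close>

section \<open>Subspaces, spans and linear independence\<close>

lemma mat_mult_entry:
  assumes "A \<in> carrier_mat n n" "B \<in> carrier_mat n n" "i < n" "j < n"
  shows "(A * B) $$ (i, j) = (\<Sum>k<n. A $$ (i, k) * B $$ (k, j))"
  using assms by (simp add: scalar_prod_def atLeast0LessThan)

lemma submodule_of_subspace: "VectorSpace.subspace class_ring W L \<Longrightarrow> submodule class_ring W L"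
  by (simp add: VectorSpace.subspace_def)

lemma lie_algebra_module: "lie_algebra L \<Longrightarrow> Module.module class_ring L"
  by (simp add: lie_algebra_def vectorspace_def)

lemma subspaceI:
  assumes "lie_algebra L" "W \<subseteq> carrier L" "\<zero>\<^bsub>L\<^esub> \<in> W"
    "\<And>x y. x \<in> W \<Longrightarrow> y \<in> W \<Longrightarrow> x \<oplus>\<^bsub>L\<^esub> y \<in> W" "\<And>c x. x \<in> W \<Longrightarrow> c \<odot>\<^bsub>L\<^esub> x \<in> W"
  shows "VectorSpace.subspace class_ring W L"
  using assms lie_algebra_module[OF assms(1)]
  by (simp add: VectorSpace.subspace_def submodule_def lie_algebra_def)

lemma subspaceD:
  assumes "VectorSpace.subspace class_ring W L"
  shows "W \<subseteq> carrier L" "\<zero>\<^bsub>L\<^esub> \<in> W"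
    "\<And>x y. x \<in> W \<Longrightarrow> y \<in> W \<Longrightarrow> x \<oplus>\<^bsub>L\<^esub> y \<in> W" "\<And>c x. x \<in> W \<Longrightarrow> c \<odot>\<^bsub>L\<^esub> x \<in> W"
  using submodule_of_subspace[OF assms] by (auto simp: submodule_def)

lemma lie_subalgebraD:
  assumes "lie_subalgebra W L"
  shows "VectorSpace.subspace class_ring W L" "\<And>x y. x \<in> W \<Longrightarrow> y \<in> W \<Longrightarrow> x \<otimes>\<^bsub>L\<^esub> y \<in> W"
  using assms by (auto simp: lie_subalgebra_def)

lemma lspan_subset:
  assumes "lie_algebra L" "VectorSpace.subspace class_ring W L" "S \<subseteq> W"
  shows "lspan L S \<subseteq> W"
  using LinearCombinations.module.span_is_subset[OF lie_algebra_module[OF assms(1)] assms(3)]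
    submodule_of_subspace[OF assms(2)] by blast

lemma lspan_superset: "lie_algebra L \<Longrightarrow> S \<subseteq> carrier L \<Longrightarrow> S \<subseteq> lspan L S"
  by (rule LinearCombinations.module.in_own_span[OF lie_algebra_module])

lemma subspace_lspan:
  "lie_algebra L \<Longrightarrow> S \<subseteq> carrier L \<Longrightarrow> VectorSpace.subspace class_ring (lspan L S) L"
  using LinearCombinations.module.span_is_submodule[OF lie_algebra_module]
  by (auto simp: VectorSpace.subspace_def lie_algebra_def)

text \<open>Spans are identified by minimality among subspaces, so that no explicit linear
  combination has to be handled later.\<close>

lemma lspan_eqI:
  assumes L: "lie_algebra L" and W: "VectorSpace.subspace class_ring W L" and S: "S \<subseteq> W"
    and "\<And>U. VectorSpace.subspace class_ring U L \<Longrightarrow> S \<subseteq> U \<Longrightarrow> W \<subseteq> U"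
  shows "lspan L S = W"
proof -
  have "S \<subseteq> carrier L" using S subspaceD(1)[OF W] by blast
  then show ?thesis
    using assms lspan_subset[OF L W S] lspan_superset[OF L] subspace_lspan[OF L] by blast
qed

text \<open>A functional that is nonzero at \<open>v\<close> and zero at the other elements kills
  the rest of any relation, because its kernel is a subspace containing their span. This forces the
  coefficient of \<open>v\<close> to vanish.\<close>

lemma not_lindepI:
  assumes L: "lie_algebra L" and S: "S \<subseteq> carrier L"
    and dual: "\<And>v. v \<in> S \<Longrightarrow> \<exists>f. (\<forall>x\<in>carrier L. \<forall>y\<in>carrier L. f (x \<oplus>\<^bsub>L\<^esub> y) = f x + f y) \<and>
      (\<forall>c. \<forall>x\<in>carrier L. f (c \<odot>\<^bsub>L\<^esub> x) = c * f x) \<and> f v \<noteq> (0 :: complex) \<and> (\<forall>w\<in>S - {v}. f w = 0)"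
  shows "\<not> lindep L S"
proof
  interpret L: lie_algebra L by (rule L)
  assume "lindep L S"
  then obtain A a v where A: "finite A" "A \<subseteq> S" "L.lincomb a A = \<zero>\<^bsub>L\<^esub>" "v \<in> A" "a v \<noteq> 0"
    unfolding L.lin_dep_def by auto
  obtain f where f: "\<And>x y. x \<in> carrier L \<Longrightarrow> y \<in> carrier L \<Longrightarrow> f (x \<oplus>\<^bsub>L\<^esub> y) = f x + f y"
    "\<And>c x. x \<in> carrier L \<Longrightarrow> f (c \<odot>\<^bsub>L\<^esub> x) = c * f x" "f v \<noteq> 0" "\<And>w. w \<in> S - {v} \<Longrightarrow> f w = 0"
    using dual[of v] A by blast
  let ?K = "{x \<in> carrier L. f x = 0}"
  have f0: "f \<zero>\<^bsub>L\<^esub> = 0" using f(2)[of "\<zero>\<^bsub>L\<^esub>" 0] by simp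
  have K: "VectorSpace.subspace class_ring ?K L"
    by (rule subspaceI[OF L]) (auto simp: f f0 L.smult_closed)
  have AC: "A \<subseteq> carrier L" using A S by blast
  have "L.lincomb a (A - {v}) \<in> lspan L (A - {v})"
    unfolding L.span_def using A by auto
  also have "\<dots> \<subseteq> ?K" using f(4) A AC by (intro lspan_subset[OF L K]) auto
  finally have z: "L.lincomb a (A - {v}) \<in> ?K" .
  have "\<zero>\<^bsub>L\<^esub> = a v \<odot>\<^bsub>L\<^esub> v \<oplus>\<^bsub>L\<^esub> L.lincomb a (A - {v})"
    using L.lincomb_del2[OF A(1) AC _ A(4), of a] A(3) by auto
  then have "0 = f (a v \<odot>\<^bsub>L\<^esub> v) + f (L.lincomb a (A - {v}))"
    using f(1)[of "a v \<odot>\<^bsub>L\<^esub> v" "L.lincomb a (A - {v})"] z f0 A(4) AC L.smult_closed[of "a v" v] by auto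
  then have "a v * f v = 0" using z f(2)[of v "a v"] A(4) AC by auto
  then show False using A f by simp
qed

lemma matsum_carrier [simp]: "matsum n f I \<in> carrier_mat n n"
  and matsum_dim [simp]: "dim_row (matsum n f I) = n" "dim_col (matsum n f I) = n"
  by (simp_all add: matsum_def)

lemma matsum_entry: "r < n \<Longrightarrow> c < n \<Longrightarrow> matsum n f I $$ (r, c) = (\<Sum>i\<in>I. f i $$ (r, c))"
  by (simp add: matsum_def)

text \<open>\<open>matsum\<close> adds entries and is not the sum of the module, so closure under it
  needs its own induction. The index set is arbitrary; the family \<open>f\<close> need not be
  injective on it.\<close>

lemma matsum_in_subspace:
  assumes U: "VectorSpace.subspace class_ring U L" and "add L = (+)" "zero L = 0\<^sub>m n n" 
    and "U \<subseteq> carrier_mat n n" and "finite I" "\<And>i. i \<in> I \<Longrightarrow> f i \<in> U"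
  shows "matsum n f I \<in> U"
  using assms(5,6)
proof (induction I rule: finite_induct)
  case empty
  have "matsum n f {} = 0\<^sub>m n n" by (intro eq_matI) (auto simp: matsum_entry)
  then show ?case using subspaceD(2)[OF U] assms by simp
next
  case (insert i I)
  have "matsum n f (insert i I) = f i + matsum n f I"
    using insert assms(4) by (intro eq_matI) (auto simp: matsum_entry)
  then show ?case using subspaceD(3)[OF U] insert assms(2) by force
qed

lemma mem_sl_subspace:
  assumes "VectorSpace.subspace class_ring U (sl_lie n)"
  shows "U \<subseteq> carrier_mat n n" "0\<^sub>m n n \<in> U" "\<And>x y. x \<in> U \<Longrightarrow> y \<in> U \<Longrightarrow> x + y \<in> U"
    "\<And>c x. x \<in> U \<Longrightarrow> c \<cdot>\<^sub>m x \<in> U" "\<And>I f. finite I \<Longrightarrow> (\<And>i. i \<in> I \<Longrightarrow> f i \<in> U) \<Longrightarrow> matsum n f I \<in> U"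
proof -
  show *: "U \<subseteq> carrier_mat n n" using subspaceD(1)[OF assms] by auto
  show "matsum n f I \<in> U" if "finite I" "\<And>i. i \<in> I \<Longrightarrow> f i \<in> U" for I and f :: "'a \<Rightarrow> _"
    by (rule matsum_in_subspace[OF assms _ _ * that]) auto
qed (use subspaceD(2-4)[OF assms] in auto)

lemma mem_gl_subspace:
  assumes "VectorSpace.subspace class_ring U (gl_lie n)"
  shows "U \<subseteq> carrier_mat n n" "0\<^sub>m n n \<in> U" "\<And>x y. x \<in> U \<Longrightarrow> y \<in> U \<Longrightarrow> x + y \<in> U"
    "\<And>c x. x \<in> U \<Longrightarrow> c \<cdot>\<^sub>m x \<in> U" "\<And>I f. finite I \<Longrightarrow> (\<And>i. i \<in> I \<Longrightarrow> f i \<in> U) \<Longrightarrow> matsum n f I \<in> U"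
proof -
  show *: "U \<subseteq> carrier_mat n n" using subspaceD(1)[OF assms] by auto
  show "matsum n f I \<in> U" if "finite I" "\<And>i. i \<in> I \<Longrightarrow> f i \<in> U" for I and f :: "'a \<Rightarrow> _"
    by (rule matsum_in_subspace[OF assms _ _ * that]) auto
qed (use subspaceD(2-4)[OF assms] in auto)

lemma lie_subalgebra_slI:
  assumes "W \<subseteq> carrier (sl_lie n)" "0\<^sub>m n n \<in> W" "\<And>x y. x \<in> W \<Longrightarrow> y \<in> W \<Longrightarrow> x + y \<in> W"
    "\<And>c x. x \<in> W \<Longrightarrow> c \<cdot>\<^sub>m x \<in> W" "\<And>x y. x \<in> W \<Longrightarrow> y \<in> W \<Longrightarrow> x * y - y * x \<in> W"
  shows "lie_subalgebra W (sl_lie n)"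
  unfolding lie_subalgebra_def using subspaceI[OF lie_algebra_sl, of W n] assms by auto

section \<open>Block diagonal and block circulant matrices\<close>

text \<open>Like \<open>circ\<close> below, this carries no trace condition. Both sets are then
  associative algebras, closed under the matrix product, and the trace is imposed only by
  intersecting with sl.\<close>

definition blk :: "nat \<Rightarrow> nat \<Rightarrow> complex mat set" where
  "blk n p = {X \<in> carrier_mat n n. \<forall>r<n. \<forall>c<n. r div p \<noteq> c div p \<longrightarrow> X $$ (r, c) = 0}"

text \<open>The commutant of the cyclic shift by \<open>p\<close>, expressed through
  entries.\<close>

definition circ :: "nat \<Rightarrow> nat \<Rightarrow> complex mat set" where
  "circ n p = {X \<in> carrier_mat n n. \<forall>r<n. \<forall>c<n. X $$ ((r + p) mod n, (c + p) mod n) = X $$ (r, c)}"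

lemma blk_closed:
  "0\<^sub>m n n \<in> blk n p" "X \<in> blk n p \<Longrightarrow> Y \<in> blk n p \<Longrightarrow> X + Y \<in> blk n p"
  "X \<in> blk n p \<Longrightarrow> Y \<in> blk n p \<Longrightarrow> X - Y \<in> blk n p"
  "X \<in> blk n p \<Longrightarrow> k \<cdot>\<^sub>m X \<in> blk n p" "X \<in> blk n p \<Longrightarrow> Y \<in> blk n p \<Longrightarrow> X * Y \<in> blk n p"
proof -
  show "X * Y \<in> blk n p" if X: "X \<in> blk n p" and Y: "Y \<in> blk n p"
  proof -
    have c: "X \<in> carrier_mat n n" "Y \<in> carrier_mat n n" using X Y by (auto simp: blk_def)
    have "X $$ (r, k) * Y $$ (k, c) = 0" if "r < n" "c < n" "k < n" "r div p \<noteq> c div p" for r c k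
      using X Y that by (cases "r div p = k div p") (auto simp: blk_def)
    then show ?thesis unfolding blk_def using c
      by (auto simp del: index_mult_mat(1) simp add: mat_mult_entry[OF c] intro!: sum.neutral)
  qed
qed (auto simp: blk_def)

text \<open>Justifies reindexing sums over all rows or columns by a cyclic shift.\<close>

lemma bij_betw_add_mod: "0 < n \<Longrightarrow> bij_betw (\<lambda>k. (k + p) mod n) {..<n} {..<n::nat}"
proof -
  assume n: "0 < n"
  have "inj_on (\<lambda>k. (k + p) mod n) {..<n}"
  proof (rule inj_onI)
    fix x y assume xy: "x \<in> {..<n}" "y \<in> {..<n}" and e: "(x + p) mod n = (y + p) mod n"
    have "(int x + int p) mod int n = (int y + int p) mod int n" using e by (metis of_nat_add zmod_int)
    then have "int x mod int n = int y mod int n"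
      by (metis add_diff_cancel_right' mod_diff_left_eq)
    then show "x = y" using xy by (simp add: zmod_int[symmetric])
  qed
  moreover have "(\<lambda>k. (k + p) mod n) ` {..<n} \<subseteq> {..<n}" using n by auto
  ultimately show ?thesis by (simp add: bij_betw_def endo_inj_surj)
qed

lemma circ_closed:
  "0\<^sub>m n n \<in> circ n p" "X \<in> circ n p \<Longrightarrow> Y \<in> circ n p \<Longrightarrow> X + Y \<in> circ n p"
  "X \<in> circ n p \<Longrightarrow> Y \<in> circ n p \<Longrightarrow> X - Y \<in> circ n p"
  "X \<in> circ n p \<Longrightarrow> k \<cdot>\<^sub>m X \<in> circ n p" "X \<in> circ n p \<Longrightarrow> Y \<in> circ n p \<Longrightarrow> X * Y \<in> circ n p"
proof -
  show "X * Y \<in> circ n p" if X: "X \<in> circ n p" and Y: "Y \<in> circ n p"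
  proof -
    have c: "X \<in> carrier_mat n n" "Y \<in> carrier_mat n n" using X Y by (auto simp: circ_def)
    have "(\<Sum>k<n. X $$ ((r + p) mod n, k) * Y $$ (k, (c + p) mod n)) = (\<Sum>k<n. X $$ (r, k) * Y $$ (k, c))"
      if "r < n" "c < n" for r c
    proof -
      have "(\<Sum>k<n. X $$ ((r + p) mod n, k) * Y $$ (k, (c + p) mod n)) =
          (\<Sum>k<n. X $$ ((r + p) mod n, (k + p) mod n) * Y $$ ((k + p) mod n, (c + p) mod n))"
        using that by (intro sum.reindex_bij_betw[symmetric] bij_betw_add_mod) auto
      also have "\<dots> = (\<Sum>k<n. X $$ (r, k) * Y $$ (k, c))"
        using X Y that by (intro sum.cong) (auto simp: circ_def)
      finally show ?thesis .
    qed
    then show ?thesis unfolding circ_def using c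
      by (auto simp del: index_mult_mat(1) simp add: mat_mult_entry[OF c])
  qed
qed (auto simp: circ_def)

lemma mtrace_commutator: "A \<in> carrier_mat n n \<Longrightarrow> B \<in> carrier_mat n n \<Longrightarrow> mtrace (A * B - B * A) = 0"
  using mtrace_simps(2)[of "A * B" n "B * A"] mtrace_simps(4)[of A n B] by simp

lemma mtrace_zero [simp]: "mtrace (0\<^sub>m n n) = 0"
  by (simp add: mtrace_def)

text \<open>Commutators have trace 0, so every associative algebra of matrices meets sl in a Lie
  subalgebra.\<close>

lemma lie_subalgebra_sl_inter:
  assumes "W \<subseteq> carrier_mat n n" "0\<^sub>m n n \<in> W" "\<And>x y. x \<in> W \<Longrightarrow> y \<in> W \<Longrightarrow> x + y \<in> W"
    "\<And>c x. x \<in> W \<Longrightarrow> c \<cdot>\<^sub>m x \<in> W" "\<And>x y. x \<in> W \<Longrightarrow> y \<in> W \<Longrightarrow> x - y \<in> W"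
    "\<And>x y. x \<in> W \<Longrightarrow> y \<in> W \<Longrightarrow> x * y \<in> W"
  shows "lie_subalgebra (W \<inter> carrier (sl_lie n)) (sl_lie n)"
  using assms by (intro lie_subalgebra_slI)
    (auto simp: subset_iff mtrace_simps[where n = n] mtrace_commutator[where n = n])

lemma lie_subalgebra_blk: "lie_subalgebra (blk n p \<inter> carrier (sl_lie n)) (sl_lie n)"
  by (rule lie_subalgebra_sl_inter) (simp_all add: blk_closed, simp add: blk_def)

lemma lie_subalgebra_circ: "lie_subalgebra (circ n p \<inter> carrier (sl_lie n)) (sl_lie n)"
  by (rule lie_subalgebra_sl_inter) (simp_all add: circ_closed, simp add: circ_def)

lemma lie_subalgebra_circ_blk: "lie_subalgebra (circ n p \<inter> blk n p \<inter> carrier (sl_lie n)) (sl_lie n)"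
  by (rule lie_subalgebra_sl_inter) (simp_all add: circ_closed blk_closed, auto simp add: circ_def)

text \<open>Matrix units are given by congruences modulo \<open>N\<close>. Both sides always lie
  within distance \<open>N\<close> after a suitable choice of representatives, which turns the
  congruences into equations.\<close>

lemma mod_eq_iff_close:
  fixes a b n :: int
  assumes "\<bar>a - b\<bar> < n"
  shows "a mod n = b mod n \<longleftrightarrow> a = b"
proof
  assume "a mod n = b mod n"
  then have "n dvd a - b" by (simp add: mod_eq_dvd_iff)
  then show "a = b" using assms dvd_imp_le_int[of "a - b" n] by (cases "a = b") auto
qed simp

lemma mod_cong_dvd: "(a mod n = b mod n) = (c mod n = d mod n)" if "a - b = c - d \<or> a - b = d - c"
  for a b c d n :: int
  using that unfolding mod_eq_dvd_iff by (metis dvd_minus_iff minus_diff_eq)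

lemma munit_entry: "r < n \<Longrightarrow> c < n \<Longrightarrow> munit n j k $$ (r, c) =
  (if (int r + 1) mod int n = j mod int n \<and> (int c + 1) mod int n = k mod int n then 1 else 0)"
  by (simp add: munit_def)

lemma munit_carrier [simp]: "munit n j k \<in> carrier_mat n n"
  by (simp add: munit_def)

locale blocks =
  fixes N p l :: nat
  assumes N: "N = p * l" and p: "2 \<le> p" and l: "2 \<le> l"
begin

lemma N_pos: "0 < N" "p < N" "p dvd N" "2 * p \<le> N"
  using p l by (auto simp: N)

lemma block_index: "r < N \<Longrightarrow> r div p < l" "r < N \<Longrightarrow> r mod p < p" "r mod p < N"
  "i < p \<Longrightarrow> m < l \<Longrightarrow> m * p + i < N"
proof -
  show "r < N \<Longrightarrow> r div p < l" using N by (simp add: less_mult_imp_div_less mult.commute)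
  show *: "r mod p < p" using p by simp
  then show "r mod p < N" using N_pos by linarith
  assume "i < p" "m < l"
  then have "m * p + i < (m + 1) * p" "(m + 1) * p \<le> l * p"
    by (simp, intro mult_right_mono) auto
  then show "m * p + i < N" using N by (simp add: mult.commute)
qed

lemma E_t_carrier [simp]: "E_t N p l x \<in> carrier_mat N N"
  by (cases x) (simp add: E_t_def)

text \<open>The row alone selects the summand \<open>m = r div p\<close>. For that summand the
  column condition depends on the difference of column and row only, and this is what makes the
  element block circulant.\<close>

lemma E_t_entry:
  assumes i: "1 \<le> i" "i \<le> int p" and r: "r < N" "c < N"
  shows "E_t N p l (i, a) $$ (r, c) =
    (if int (r mod p) = i - 1 \<and> (int c - int r) mod int N = a mod int N then 1 else 0)"
proof -
  define j where "j = nat (i - 1)"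
  have j: "i = int j + 1" "j < p" using i by (auto simp: j_def)
  have row: "(int r + 1) mod int N = (i + int m * int p) mod int N \<longleftrightarrow> r mod p = j \<and> m = r div p"
    if m: "m < l" for m
  proof -
    have "m * p + j < N" using block_index(4)[OF j(2) m] .
    then have "\<bar>(int r + 1) - (i + int m * int p)\<bar> < int N"
      using r j by (simp add: abs_less_iff flip: of_nat_mult of_nat_add)
    then have "(int r + 1) mod int N = (i + int m * int p) mod int N \<longleftrightarrow> int r = int (j + m * p)"
      using j by (subst mod_eq_iff_close) auto
    also have "\<dots> \<longleftrightarrow> r mod p = j \<and> m = r div p"
      unfolding of_nat_eq_iff using j(2) by auto
    finally show ?thesis .
  qed
  have col: "(int c + 1) mod int N = (i + a + int (r div p) * int p) mod int N \<longleftrightarrow>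
      (int c - int r) mod int N = a mod int N" if "r mod p = j"
  proof -
    have "int r = int (r div p) * int p + int j"
      using that by (metis div_mult_mod_eq of_nat_add of_nat_mult)
    then show ?thesis using j by (intro mod_cong_dvd) simp
  qed
  have "E_t N p l (i, a) $$ (r, c) = (\<Sum>m<l. munit N (i + int m * int p) (i + a + int m * int p) $$ (r, c))"
    using r by (simp add: E_t_def matsum_entry)
  also have "\<dots> = (\<Sum>m<l. if m = r div p then
      (if r mod p = j \<and> (int c - int r) mod int N = a mod int N then 1 else 0) else 0)"
    using r col by (intro sum.cong refl) (auto simp: munit_entry row simp del: of_nat_Suc)
  finally have "E_t N p l (i, a) $$ (r, c) = (\<Sum>m<l. if m = r div p then
      (if r mod p = j \<and> (int c - int r) mod int N = a mod int N then 1 else 0) else 0)" .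
  then show ?thesis using block_index(1)[OF r(1)] j by auto
qed

lemma et_eq: "et N p l k = E_t N p l (k, 0)"
  by (simp add: et_def E_t_def e_vec_def)

lemma et_entry:
  assumes "1 \<le> k" "k \<le> int p" "r < N" "c < N"
  shows "et N p l k $$ (r, c) = (if r = c \<and> int (r mod p) = k - 1 then 1 else 0)"
proof -
  have "(int c - int r) mod int N = 0 \<longleftrightarrow> r = c"
    using mod_eq_iff_close[of "int c - int r" 0 "int N"] assms by auto
  then show ?thesis using assms by (auto simp: et_eq E_t_entry)
qed

lemma et_carrier [simp]: "et N p l k \<in> carrier_mat N N"
  by (simp add: et_eq)

lemma coroot_carrier [simp]: "coroot_t N p l k \<in> carrier_mat N N"
  unfolding coroot_t_def by (intro minus_carrier_mat et_carrier)

lemma coroot_entry: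
  assumes "1 \<le> k" "k \<le> int p - 1" "r < N" "c < N"
  shows "coroot_t N p l k $$ (r, c) =
    (if r = c then of_bool (int (r mod p) = k - 1) - of_bool (int (r mod p) = k) else 0)"
  using assms carrier_matD[OF et_carrier[of "k + 1"]] unfolding coroot_t_def
  by (subst index_minus_mat) (auto simp: et_entry)

text \<open>The column that results when row \<open>r\<close> is moved back into the first
  \<open>p\<close> rows by shifts of whole blocks. The column may wrap around at 0, hence the
  passage through the integers.\<close>

definition col0 :: "nat \<Rightarrow> nat \<Rightarrow> nat" where
  "col0 r c = nat ((int c - int (r div p * p)) mod int N)"

lemma col0: "col0 r c < N" "int (col0 r c) = (int c - int (r div p * p)) mod int N"
  using N_pos by (auto simp: col0_def nat_less_iff)

lemma col0_row0: "r < p \<Longrightarrow> c < N \<Longrightarrow> col0 r c = c"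
  by (simp add: col0_def nat_mod_distrib)

lemma mod_shift: "(r + p) mod N mod p = r mod p"
  using N_pos(3) by (simp add: mod_mod_cancel)

lemma circ_entry:
  assumes X: "X \<in> circ N p" and r: "r < N" "c < N"
  shows "X $$ (r, c) = X $$ (r mod p, col0 r c)"
proof -
  \<comment> \<open>The defining invariance is iterated; \<open>r div p\<close> shifts lead from the
    first \<open>p\<close> rows back to \<open>(r, c)\<close>.\<close>
  have it: "X $$ ((i + k * p) mod N, (j + k * p) mod N) = X $$ (i, j)" if "i < N" "j < N" for i j k
  proof (induction k)
    case (Suc k)
    have "X $$ (((i + k * p) mod N + p) mod N, ((j + k * p) mod N + p) mod N)
      = X $$ ((i + k * p) mod N, (j + k * p) mod N)"
      using X N_pos(1) unfolding circ_def by auto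
    then have "X $$ ((i + k * p + p) mod N, (j + k * p + p) mod N) = X $$ (i, j)"
      using Suc by (simp only: mod_add_left_eq)
    then show ?case by (simp add: ac_simps)
  qed (use that in simp)
  have "(r mod p + r div p * p) mod N = r" using r by simp
  moreover have "int ((col0 r c + r div p * p) mod N) = int c"
    using r by (simp add: zmod_int col0(2) mod_add_left_eq)
  ultimately show ?thesis
    using it[of "r mod p" "col0 r c" "r div p"] block_index(3) col0(1) by simp
qed

text \<open>Since \<open>p\<close> divides \<open>N\<close>, the shift by \<open>p\<close> changes
  neither the residue of the row modulo \<open>p\<close> nor the offset of the column modulo
  \<open>N\<close>.\<close>

lemma circI:
  assumes "X \<in> carrier_mat N N" "\<And>r c. r < N \<Longrightarrow> c < N \<Longrightarrow> X $$ (r, c) = f (r mod p) ((int c - int r) mod int N)"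
  shows "X \<in> circ N p"
proof -
  have "(int ((c + p) mod N) - int ((r + p) mod N)) mod int N = (int c - int r) mod int N" for r c
    by (simp add: zmod_int mod_diff_eq)
  then show ?thesis using assms N_pos(1) by (auto simp: circ_def mod_shift)
qed

lemma E_t_circ: "1 \<le> i \<Longrightarrow> i \<le> int p \<Longrightarrow> E_t N p l (i, a) \<in> circ N p"
  by (intro circI[where f = "\<lambda>r d. if int r = i - 1 \<and> d = a mod int N then 1 else 0"])
    (auto simp: E_t_entry)

text \<open>
  A block circulant matrix is determined by its first \<open>p\<close> rows: the entry \<open>(r, c)\<close> is repeated from
  the entry \<open>(r mod p, col0 r c)\<close>. \<open>Eb i c\<close> is the one whose only entry in these rows is a 1 at \<open>(i, c)\<close>.
\<close>

definition Eb :: "nat \<Rightarrow> nat \<Rightarrow> complex mat" where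
  "Eb i c = E_t N p l (int i + 1, int c - int i)"

lemma Eb_carrier [simp]: "Eb i c \<in> carrier_mat N N"
  by (simp add: Eb_def)

lemma Eb_circ: "i < p \<Longrightarrow> Eb i c \<in> circ N p"
  unfolding Eb_def by (rule E_t_circ) auto

lemma Eb_entry:
  assumes "i < p" "j < N" "r < N" "c < N"
  shows "Eb i j $$ (r, c) = (if r mod p = i \<and> col0 r c = j then 1 else 0)"
proof -
  have "(int c - int r) mod int N = (int j - int i) mod int N \<longleftrightarrow> col0 r c = j" if "r mod p = i"
  proof -
    have e: "int r = int (r div p * p) + int i"
      using that by (metis div_mult_mod_eq of_nat_add)
    have "(int c - int r) mod int N = (int j - int i) mod int N \<longleftrightarrow>
        (int c - int (r div p * p)) mod int N = int j mod int N"
      using e by (intro mod_cong_dvd) linarith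
    also have "\<dots> \<longleftrightarrow> int (col0 r c) = int j" using assms(2) by (simp only: col0(2)) simp
    finally show ?thesis by simp
  qed
  then show ?thesis using assms unfolding Eb_def by (subst E_t_entry) auto
qed

lemma Eb_entry_row0:
  "i < p \<Longrightarrow> j < N \<Longrightarrow> r < p \<Longrightarrow> c < N \<Longrightarrow> Eb i j $$ (r, c) = (if r = i \<and> c = j then 1 else 0)"
  using N_pos by (subst Eb_entry) (auto simp: col0_row0)

lemma circ_eqI:
  assumes "X \<in> circ N p" "Y \<in> circ N p" "\<And>i c. i < p \<Longrightarrow> c < N \<Longrightarrow> X $$ (i, c) = Y $$ (i, c)"
  shows "X = Y"
proof (rule eq_matI)
  have c: "X \<in> carrier_mat N N" "Y \<in> carrier_mat N N" using assms by (auto simp: circ_def)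
  then show "dim_row X = dim_row Y" "dim_col X = dim_col Y" by auto
  fix r j assume "r < dim_row Y" "j < dim_col Y"
  then show "X $$ (r, j) = Y $$ (r, j)"
    using c circ_entry[OF assms(1), of r j] circ_entry[OF assms(2), of r j] assms(3)[of "r mod p" "col0 r j"]
      col0(1) block_index(2) by auto
qed

text \<open>Reducing the column modulo \<open>N\<close> brings all the families
  \<open>coroot_t\<close>, \<open>E_t\<close> and \<open>t0\<close> into the single basis
  \<open>Eb\<close>, in which membership and products can be read off.\<close>

lemma E_t_Eb:
  assumes "1 \<le> i" "i \<le> int p"
  shows "E_t N p l (i, a) = Eb (nat (i - 1)) (nat ((i - 1 + a) mod int N))"
proof -
  have *: "(int j - int k) mod int N = a mod int N \<longleftrightarrow> j = nat ((i - 1 + a) mod int N)"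
    if "int k = i - 1" "j < N" for j k
  proof -
    have "(int j - int k) mod int N = a mod int N \<longleftrightarrow> int j mod int N = (i - 1 + a) mod int N"
      using that by (intro mod_cong_dvd) simp
    then show ?thesis using that N_pos(1) by auto
  qed
  show ?thesis
  proof (intro circ_eqI E_t_circ Eb_circ assms)
    show i: "nat (i - 1) < p" using assms by auto
    fix k j assume kj: "k < p" "j < N"
    have b: "nat ((i - 1 + a) mod int N) < N" using N_pos(1) by (simp add: nat_less_iff)
    have "int (k mod p) = i - 1 \<longleftrightarrow> k = nat (i - 1)" using assms kj by auto
    then show "E_t N p l (i, a) $$ (k, j) = Eb (nat (i - 1)) (nat ((i - 1 + a) mod int N)) $$ (k, j)"
      using *[of k j] kj assms N_pos(2) by (simp only: E_t_entry[of i k j a] Eb_entry_row0[OF i b kj]) auto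
  qed
qed

lemma circ_expand:
  assumes "X \<in> circ N p"
  shows "X = matsum N (\<lambda>(i, c). X $$ (i, c) \<cdot>\<^sub>m Eb i c) ({..<p} \<times> {..<N})"
proof (rule eq_matI)
  have c: "X \<in> carrier_mat N N" using assms by (auto simp: circ_def)
  then show "dim_row X = dim_row (matsum N (\<lambda>(i, c). X $$ (i, c) \<cdot>\<^sub>m Eb i c) ({..<p} \<times> {..<N}))"
    "dim_col X = dim_col (matsum N (\<lambda>(i, c). X $$ (i, c) \<cdot>\<^sub>m Eb i c) ({..<p} \<times> {..<N}))" by auto
  fix r j assume "r < dim_row (matsum N (\<lambda>(i, c). X $$ (i, c) \<cdot>\<^sub>m Eb i c) ({..<p} \<times> {..<N}))"
    "j < dim_col (matsum N (\<lambda>(i, c). X $$ (i, c) \<cdot>\<^sub>m Eb i c) ({..<p} \<times> {..<N}))"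
  then have r: "r < N" "j < N" by auto
  have "matsum N (\<lambda>(i, c). X $$ (i, c) \<cdot>\<^sub>m Eb i c) ({..<p} \<times> {..<N}) $$ (r, j)
    = (\<Sum>x\<in>{..<p} \<times> {..<N}. if x = (r mod p, col0 r j) then X $$ x else 0)"
    unfolding matsum_entry[OF r]
  proof (intro sum.cong refl)
    fix x assume "x \<in> {..<p} \<times> {..<N}"
    then obtain i c where x: "x = (i, c)" "i < p" "c < N" by auto
    then show "(case x of (i, c) \<Rightarrow> X $$ (i, c) \<cdot>\<^sub>m Eb i c) $$ (r, j)
      = (if x = (r mod p, col0 r j) then X $$ x else 0)"
      using r carrier_matD[OF Eb_carrier[of i c]] by (auto simp: Eb_entry)
  qed
  also have "\<dots> = X $$ (r, j)"
    using r block_index(2) col0(1) circ_entry[OF assms r] by (subst sum.delta) auto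
  finally show "X $$ (r, j) = matsum N (\<lambda>(i, c). X $$ (i, c) \<cdot>\<^sub>m Eb i c) ({..<p} \<times> {..<N}) $$ (r, j)"
    by simp
qed

text \<open>Only the closure properties of \<open>U\<close> are assumed, so that subspaces of gl(N)
  and of sl(N) are both covered. Basis elements are required only at nonzero coefficients because
  \<open>Eb i i\<close> is not traceless and cannot lie in a subspace of sl(N).\<close>

lemma circ_in_subspace:
  assumes X: "X \<in> circ N p" and U: "0\<^sub>m N N \<in> U" "\<And>c x. x \<in> U \<Longrightarrow> c \<cdot>\<^sub>m x \<in> U"
    "\<And>I f. finite (I :: (nat \<times> nat) set) \<Longrightarrow> (\<And>i. i \<in> I \<Longrightarrow> f i \<in> U) \<Longrightarrow> matsum N f I \<in> U"
    and E: "\<And>i c. i < p \<Longrightarrow> c < N \<Longrightarrow> X $$ (i, c) \<noteq> 0 \<Longrightarrow> Eb i c \<in> U"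
  shows "X \<in> U"
proof (subst circ_expand[OF X], intro U(3))
  fix x assume "x \<in> {..<p} \<times> {..<N}"
  then obtain i c where x: "x = (i, c)" "i < p" "c < N" by auto
  have "0 \<cdot>\<^sub>m Eb i c = 0\<^sub>m N N" using carrier_matD[OF Eb_carrier[of i c]] by (intro eq_matI) auto
  then show "(case x of (i, c) \<Rightarrow> X $$ (i, c) \<cdot>\<^sub>m Eb i c) \<in> U"
    using x U(1) U(2)[OF E[OF x(2,3)]] by (cases "X $$ (i, c) = 0") auto
qed simp

text \<open>Moving back by whole blocks preserves the difference of the block numbers modulo
  \<open>l\<close>. Row and column share a block exactly when the column ends up in the first block
  together with the row.\<close>

lemma col0_less_iff: "r < N \<Longrightarrow> c < N \<Longrightarrow> col0 r c < p \<longleftrightarrow> r div p = c div p"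
proof
  assume r: "r < N" "c < N"
  { assume "col0 r c < p"
    moreover have "(int (col0 r c) + int (r div p * p)) mod int N = int c mod int N"
      by (simp add: col0(2) mod_add_left_eq)
    \<comment> \<open>Within the first block the shift forward does not wrap around, so the
      congruence becomes an equation.\<close>
    moreover have "r div p * p + col0 r c < N" if "col0 r c < p"
      using that block_index(4)[OF that block_index(1)[OF r(1)]] by simp
    ultimately have "col0 r c + r div p * p = c"
      using r by (metis add.commute mod_less of_nat_add of_nat_eq_iff zmod_int)
    then have "c div p = (col0 r c + r div p * p) div p" by simp
    then show "r div p = c div p" using \<open>col0 r c < p\<close> by simp }
  assume e: "r div p = c div p"
  have "int c - int (c div p * p) = int (c mod p)"
    by (metis add_diff_cancel_left' div_mult_mod_eq of_nat_add)
  then show "col0 r c < p" using block_index[of c] r(2) e by (simp add: col0_def nat_mod_distrib)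
qed

lemma circ_blk_iff: "X \<in> circ N p \<Longrightarrow> X \<in> blk N p \<longleftrightarrow> (\<forall>i<p. \<forall>c<N. p \<le> c \<longrightarrow> X $$ (i, c) = 0)"
proof
  assume X: "X \<in> circ N p"
  { assume "X \<in> blk N p"
    then show "\<forall>i<p. \<forall>c<N. p \<le> c \<longrightarrow> X $$ (i, c) = 0"
      using p N_pos(2) by (auto simp: blk_def div_eq_0_iff) }
  assume "\<forall>i<p. \<forall>c<N. p \<le> c \<longrightarrow> X $$ (i, c) = 0"
  then have "X $$ (r, c) = 0" if "r < N" "c < N" "r div p \<noteq> c div p" for r c
    using circ_entry[OF X that(1,2)] col0_less_iff[OF that(1,2)] that(3) col0(1)[of r c]
      block_index(2)[OF that(1)] by (metis not_less)
  then show "X \<in> blk N p" using X by (simp add: blk_def circ_def)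
qed

lemma Eb_blk: "i < p \<Longrightarrow> c < p \<Longrightarrow> Eb i c \<in> blk N p"
  using N_pos by (subst circ_blk_iff) (auto simp: Eb_circ Eb_entry_row0)

lemma mtrace_Eb: "i < p \<Longrightarrow> c < N \<Longrightarrow> c \<noteq> i \<Longrightarrow> mtrace (Eb i c) = 0"
  unfolding mtrace_def
proof (intro sum.neutral ballI)
  fix r assume a: "i < p" "c < N" "c \<noteq> i" "r \<in> {..<dim_row (Eb i c)}"
  have "int r - int (r div p * p) = int (r mod p)"
    by (metis add_diff_cancel_left' div_mult_mod_eq of_nat_add)
  then have "col0 r r = r mod p" if "r < N"
    using that block_index[of r] by (simp only: col0_def) (simp add: nat_mod_distrib)
  then show "Eb i c $$ (r, r) = 0" using a carrier_matD[OF Eb_carrier[of i c]] by (auto simp: Eb_entry)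
qed

end

lemma mtrace_smult [simp]: "mtrace (c \<cdot>\<^sub>m A) = c * mtrace A" if "A \<in> carrier_mat n n"
  using mtrace_simps(3)[OF that that] .

section \<open>Scaled cyclic shifts, powers of the cyclic matrix, and the twist\<close>

definition cyc :: "nat \<Rightarrow> complex \<Rightarrow> nat \<Rightarrow> complex mat" where
  "cyc n k q = mat n n (\<lambda>(r, c). if c = (r + q) mod n then k else 0)"

lemma cyc_carrier [simp]: "cyc n k q \<in> carrier_mat n n"
  by (simp add: cyc_def)

lemma cyc_mult_left:
  assumes "A \<in> carrier_mat n n" "r < n" "c < n"
  shows "(cyc n k q * A) $$ (r, c) = k * A $$ ((r + q) mod n, c)"
proof -
  have "(cyc n k q * A) $$ (r, c) = (\<Sum>t<n. if t = (r + q) mod n then k * A $$ (t, c) else 0)"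
    using assms by (subst mat_mult_entry[where n = n]) (auto simp: cyc_def if_distrib[of "\<lambda>x. x * _"] cong: if_cong)
  then show ?thesis using assms by simp
qed

lemma cyc_mult_right:
  assumes "A \<in> carrier_mat n n" "r < n" "c < n"
  shows "(A * cyc n k q) $$ (r, (c + q) mod n) = A $$ (r, c) * k"
proof -
  have "(c + q) mod n = (t + q) mod n \<longleftrightarrow> t = c" if "t < n" for t
    using inj_on_eq_iff[OF bij_betw_imp_inj_on[OF bij_betw_add_mod[of n q]], of c t] assms that by auto
  then have "A $$ (r, t) * cyc n k q $$ (t, (c + q) mod n) = (if t = c then A $$ (r, t) * k else 0)"
    if "t < n" for t
    using that assms by (simp add: cyc_def)
  then have "(A * cyc n k q) $$ (r, (c + q) mod n) = (\<Sum>t<n. if t = c then A $$ (r, t) * k else 0)"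
    using assms by (subst mat_mult_entry[where n = n]) (auto intro!: sum.cong)
  then show ?thesis using assms by simp
qed

lemma cyc_mult_cyc: "cyc n k q * cyc n k' q' = cyc n (k * k') (q + q')"
proof (rule eq_matI)
  fix r c assume "r < dim_row (cyc n (k * k') (q + q'))" "c < dim_col (cyc n (k * k') (q + q'))"
  then have "r < n" "c < n" by (auto simp: cyc_def)
  then show "(cyc n k q * cyc n k' q') $$ (r, c) = cyc n (k * k') (q + q') $$ (r, c)"
    using mod_add_left_eq[of "r + q" n q'] by (simp add: cyc_mult_left del: index_mult_mat(1)) (auto simp: cyc_def ac_simps)
qed (auto simp: cyc_def)

lemma cyc_pow: "cyc n k 1 ^\<^sub>m q = cyc n (k ^ q) q"
proof (induction q)
  case 0 show ?case by (intro eq_matI) (auto simp: cyc_def)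
qed (simp add: cyc_mult_cyc mult.commute)

lemma Lam_eq:
  assumes "2 \<le> n"
  shows "Lam n = cyc n (if odd n then 1 else exp (pi * \<i> / n)) 1"
proof -
  have "(matsum n (\<lambda>j. munit n j (j + 1)) {1..int n - 1} + munit n (int n) 1) $$ (r, c) =
      (if c = (r + 1) mod n then 1 else 0)" if r: "r < n" "c < n" for r c
  proof -
    have row: "(int r + 1) mod int n = j mod int n \<longleftrightarrow> j = int r + 1" if "j \<in> {1..int n - 1}" for j
      using that r by (subst mod_eq_iff_close) auto
    have col: "(int c + 1) mod int n = (int r + 1 + 1) mod int n \<longleftrightarrow> c = r + 1" if "r + 1 < n"
      using that r by (subst mod_eq_iff_close) auto
    have last: "(int r + 1) mod int n = 0 \<longleftrightarrow> r + 1 = n"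
      using r mod_eq_iff_close[of "int r + 1" "int n" "int n"] by auto
    have first: "(int c + 1) mod int n = 1 \<longleftrightarrow> c = 0"
      using r mod_eq_iff_close[of "int c + 1" 1 "int n"] assms by auto
    have "munit n j (j + 1) $$ (r, c) = (if j = int r + 1 then if c = r + 1 then 1 else 0 else 0)"
      if j: "j \<in> {1..int n - 1}" for j
      unfolding munit_entry[OF r] row[OF j] using j col by (cases "j = int r + 1") auto
    then have "(\<Sum>j\<in>{1..int n - 1}. munit n j (j + 1) $$ (r, c)) =
        (\<Sum>j\<in>{1..int n - 1}. if j = int r + 1 then if c = r + 1 then 1 else 0 else 0)"
      by (intro sum.cong) auto
    also have "\<dots> = (if c = r + 1 then 1 else 0)" using r by auto
    finally show ?thesis using r assms first
      by (auto simp: matsum_entry munit_entry last carrier_matD[OF munit_carrier] mod_Suc split: if_splits)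
  qed
  then show ?thesis unfolding Lam_def
    by (intro eq_matI) (auto simp: cyc_def carrier_matD[OF munit_carrier] simp del: index_add_mat(1))
qed

context blocks begin

text \<open>The inverse in \<open>twist\<close> is the result of Gauss-Jordan elimination. The
  opposite shift by \<open>N - p\<close> shows that \<open>P\<close> is invertible and hence that a
  result exists. Its form is never computed: the relation \<open>P * X = Y * P\<close> with the
  shifted matrix \<open>Y\<close> suffices, and the scalar in \<open>P\<close> cancels.\<close>

lemma twist_carrier: "X \<in> carrier_mat N N \<Longrightarrow> twist N p X \<in> carrier_mat N N"
  and twist_entry: "X \<in> carrier_mat N N \<Longrightarrow> r < N \<Longrightarrow> c < N \<Longrightarrow>
    twist N p X $$ (r, c) = X $$ ((r + p) mod N, (c + p) mod N)"
proof -
  assume X: "X \<in> carrier_mat N N"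
  define k where "k = (if odd N then 1 else exp (pi * \<i> / N) :: complex) ^ p"
  define P where "P = Lam N ^\<^sub>m p"
  define B where "B = the (mat_inverse P)"
  define Y where "Y = mat N N (\<lambda>(r, c). X $$ ((r + p) mod N, (c + p) mod N))"
  have k: "k \<noteq> 0" by (simp add: k_def)
  have P: "P = cyc N k p" using p N_pos unfolding P_def k_def by (subst Lam_eq) (auto simp only: cyc_pow)
  have "P * cyc N (1 / k) (N - p) = 1\<^sub>m N"
    using k N_pos unfolding P cyc_mult_cyc by (intro eq_matI) (auto simp: cyc_def)
  then have "cyc N (1 / k) (N - p) * P = 1\<^sub>m N"
    by (intro mat_mult_left_right_inverse[of P N]) (auto simp: P)
  then have "P \<in> Units (ring_mat TYPE(complex) N ())"
    using \<open>P * cyc N (1 / k) (N - p) = 1\<^sub>m N\<close>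
    unfolding Units_def by (auto simp: P ring_mat_simps intro!: bexI[of _ "cyc N (1 / k) (N - p)"])
  then have "mat_inverse P \<noteq> None" using mat_inverse(1)[of P N "()"] P by (metis cyc_carrier)
  then have B: "P * B = 1\<^sub>m N" "B \<in> carrier_mat N N"
    using mat_inverse(2)[of P N B] by (auto simp: P B_def)
  have Pc: "P \<in> carrier_mat N N" and Y: "Y \<in> carrier_mat N N" by (simp_all add: P Y_def)
  have "P * X = Y * P"
  proof (rule eq_matI)
    show "dim_row (P * X) = dim_row (Y * P)" "dim_col (P * X) = dim_col (Y * P)" using Pc Y X by auto
    fix r c' assume "r < dim_row (Y * P)" "c' < dim_col (Y * P)"
    then have r: "r < N" "c' < N" using Pc Y by auto
    then obtain c where c: "c < N" "c' = (c + p) mod N"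
      using bij_betw_add_mod[of N p] by (auto simp: bij_betw_def image_iff set_eq_iff)
    show "(P * X) $$ (r, c') = (Y * P) $$ (r, c')"
      unfolding P using r c X Y
      by (simp add: cyc_mult_left cyc_mult_right del: index_mult_mat(1)) (simp add: Y_def)
  qed
  then have "twist N p X = Y"
    unfolding twist_def P_def[symmetric] B_def[symmetric] using assoc_mult_mat[OF Y Pc B(2)] B Y by simp
  then show "twist N p X \<in> carrier_mat N N"
    "r < N \<Longrightarrow> c < N \<Longrightarrow> twist N p X $$ (r, c) = X $$ ((r + p) mod N, (c + p) mod N)"
    using Y by (simp_all add: Y_def)
qed

text \<open>Conjugation by a shift permutes the positions, so a fixed matrix is constant along the
  orbits of the shift. From here on the cyclic matrix enters only through the entries of
  \<open>twist\<close>.\<close>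

lemma g0_eq: "g0 N p = circ N p \<inter> carrier (sl_lie N)"
proof -
  have "twist N p X = X \<longleftrightarrow> X \<in> circ N p" if X: "X \<in> carrier_mat N N" for X
  proof
    assume "twist N p X = X"
    then have "X $$ ((r + p) mod N, (c + p) mod N) = X $$ (r, c)" if "r < N" "c < N" for r c
      using twist_entry[OF X that] by metis
    then show "X \<in> circ N p" using X by (simp add: circ_def)
  next
    assume "X \<in> circ N p"
    then have "twist N p X $$ (r, c) = X $$ (r, c)" if "r < N" "c < N" for r c
      using twist_entry[OF X that] that by (simp add: circ_def)
    then show "twist N p X = X" using twist_carrier[OF X] X by (intro eq_matI) auto
  qed
  then show ?thesis by (auto simp: g0_def)
qed

section \<open>Blockwise sums and generators of the embedded sl(p)\<close>

lemma sum_blocks: "(\<Sum>r<N. f r) = (\<Sum>m<l. \<Sum>i<p. f (m * p + i))" for f :: "nat \<Rightarrow> complex"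
proof -
  have "sum f {m * p..<m * p + p} = (\<Sum>i<p. f (m * p + i))" for m
    by (simp add: sum.shift_bounds_nat_ivl[of f 0 "m * p" p, simplified] atLeast0LessThan add.commute)
  then show ?thesis using sum.nat_group[of f p l] by (simp add: N mult.commute)
qed

lemma circ_shift:
  assumes "X \<in> circ N p" "m < l" "i < p" "j < p"
  shows "X $$ (m * p + i, m * p + j) = X $$ (i, j)"
proof -
  have d: "(m * p + i) div p = m" "(m * p + i) mod p = i"
    "(m * p + j) div p = m" using assms by auto
  have "int (m * p + j) - int (m * p) = int j" by simp
  then have "col0 (m * p + i) (m * p + j) = j"
    using assms(4) N_pos(2) unfolding col0_def d by (simp add: nat_mod_distrib)
  then show ?thesis using circ_entry[OF assms(1), of "m * p + i" "m * p + j"] block_index(4)[OF _ assms(2)] assms d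
    by simp
qed

lemma mtrace_circ: "X \<in> circ N p \<Longrightarrow> mtrace X = of_nat l * (\<Sum>i<p. X $$ (i, i))"
proof -
  assume X: "X \<in> circ N p"
  have "mtrace X = (\<Sum>m<l. \<Sum>i<p. X $$ (m * p + i, m * p + i))"
    using X sum_blocks[of "\<lambda>r. X $$ (r, r)"] by (auto simp: mtrace_def circ_def)
  also have "\<dots> = (\<Sum>m<l. \<Sum>i<p. X $$ (i, i))"
    using circ_shift[OF X] by (intro sum.cong refl) auto
  finally show ?thesis by simp
qed

definition Hd :: "complex mat set" where
  "Hd = circ N p \<inter> Collect diagonal_mat \<inter> carrier (sl_lie N)"

lemma Hd_subspace: "VectorSpace.subspace class_ring Hd (sl_lie N)"
  by (rule subspaceI[OF lie_algebra_sl])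
    (auto simp: Hd_def circ_closed diagonal_mat_def mtrace_simps[where n = N])

lemma coroot_Hd:
  assumes "1 \<le> k" "k \<le> int p - 1"
  shows "coroot_t N p l k \<in> Hd"
proof -
  have C: "coroot_t N p l k \<in> circ N p"
    unfolding coroot_t_def et_eq using assms by (intro circ_closed E_t_circ) auto
  have "(\<Sum>i<p. coroot_t N p l k $$ (i, i)) = (\<Sum>i<p. of_bool (i = nat (k - 1)) - of_bool (i = nat k))"
    using assms N_pos by (intro sum.cong refl) (auto simp: coroot_entry)
  also have "\<dots> = 0" using assms by (subst sum_subtractf) (auto simp: of_bool_def)
  finally show ?thesis
    using C mtrace_circ[OF C] carrier_matD[OF coroot_carrier[of k]] assms
    by (auto simp: Hd_def diagonal_mat_def coroot_entry)
qed

text \<open>Summation by parts: the coefficient of the \<open>k\<close>-th coroot is the partial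
  trace \<open>s k\<close> of the first block.\<close>

lemma Hd_in_subspace:
  assumes U: "VectorSpace.subspace class_ring U (sl_lie N)" and "coroot_t N p l ` {1..int p - 1} \<subseteq> U"
    and D: "D \<in> Hd"
  shows "D \<in> U"
proof -
  define s where "s k = (\<Sum>i<k. D $$ (i, i))" for k
  have Dc: "D \<in> circ N p" "diagonal_mat D" "mtrace D = 0" using D by (auto simp: Hd_def)
  have sp: "s p = 0" using mtrace_circ[OF Dc(1)] Dc(3) l by (simp add: s_def)
  let ?M = "matsum N (\<lambda>k. s (nat k) \<cdot>\<^sub>m coroot_t N p l k) {1..int p - 1}"
  have "D = ?M"
  proof (rule circ_eqI[OF Dc(1)])
    have "?M \<in> Hd"
      using mem_sl_subspace(4,5)[OF Hd_subspace] coroot_Hd by (auto intro!: mem_sl_subspace(5)[OF Hd_subspace])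
    then show "?M \<in> circ N p" by (simp add: Hd_def)
    fix r c assume r: "r < p" "c < N"
    have "?M $$ (r, c) = (\<Sum>k\<in>{1..int p - 1}. if r = c then
        (if k = int r + 1 then s (nat k) else 0) - (if k = int r then s (nat k) else 0) else 0)"
      using r N_pos carrier_matD[OF coroot_carrier]
      by (auto simp: matsum_entry coroot_entry intro!: sum.cong)
    \<comment> \<open>Coroots exist only for \<open>1 \<le> k \<le> p - 1\<close>. The two missing
      boundary terms are harmless since \<open>s 0 = 0\<close>, and \<open>s p = 0\<close> by
      tracelessness.\<close>
    also have "\<dots> = (if r = c then (if r + 1 < p then s (r + 1) else 0) - (if 1 \<le> r then s r else 0) else 0)"
      using r by (auto simp: sum_subtractf nat_add_distrib)
    also have "\<dots> = D $$ (r, c)"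
    proof (cases "r = c")
      case True
      have "s (r + 1) - s r = D $$ (r, r)" by (simp add: s_def)
      moreover have "s (r + 1) = 0" if "\<not> r + 1 < p"
        using that r sp by (metis Suc_eq_plus1 Suc_lessI)
      moreover have "s r = 0" if "\<not> 1 \<le> r" using that by (cases r) (auto simp: s_def)
      ultimately show ?thesis using True by (cases "1 \<le> r"; cases "r + 1 < p") auto
    next
      case False
      then show ?thesis using Dc r N_pos by (auto simp: diagonal_mat_def circ_def)
    qed
    finally show "D $$ (r, c) = ?M $$ (r, c)" by simp
  qed
  then show ?thesis using assms(2) mem_sl_subspace(4,5)[OF U] by (metis (no_types, lifting) finite_atLeastAtMost_int image_subset_iff)
qed

lemma H_t_eq: "H_t N p l = Hd"
  unfolding H_t_def using coroot_Hd Hd_in_subspace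
  by (intro lspan_eqI[OF lie_algebra_sl Hd_subspace]) auto

text \<open>The diagonal is split off as a whole because its single basis elements
  \<open>Eb i i\<close> leave sl(N); it is then covered by the coroots.\<close>

definition dpart :: "complex mat \<Rightarrow> complex mat" where
  "dpart X = mat N N (\<lambda>(r, c). if r = c then X $$ (r, c) else 0)"

lemma dpart:
  assumes "X \<in> circ N p" "mtrace X = 0"
  shows "dpart X \<in> Hd" "X = dpart X + (X - dpart X)" "X - dpart X \<in> circ N p"
    "r < N \<Longrightarrow> (X - dpart X) $$ (r, r) = 0"
    "r < N \<Longrightarrow> c < N \<Longrightarrow> r \<noteq> c \<Longrightarrow> (X - dpart X) $$ (r, c) = X $$ (r, c)"
proof -
  have X: "X \<in> carrier_mat N N" using assms by (simp add: circ_def)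
  have e: "(r + p) mod N = (c + p) mod N \<longleftrightarrow> r = c" if "r < N" "c < N" for r c
    using inj_on_eq_iff[OF bij_betw_imp_inj_on[OF bij_betw_add_mod[of N p]], of r c] that by auto
  have c: "dpart X \<in> circ N p" using assms e by (auto simp: circ_def dpart_def)
  have "mtrace (dpart X) = mtrace X" using X by (simp add: mtrace_def dpart_def)
  then show "dpart X \<in> Hd" using c assms by (auto simp: Hd_def diagonal_mat_def dpart_def)
  show "X = dpart X + (X - dpart X)" using X by (intro eq_matI) (auto simp: dpart_def)
  show "X - dpart X \<in> circ N p" using c assms by (rule_tac circ_closed)
qed (auto simp: dpart_def)

abbreviation "g0b \<equiv> circ N p \<inter> blk N p \<inter> carrier (sl_lie N)"

lemma Hd_blk: "Hd \<subseteq> blk N p"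
proof
  fix X assume X: "X \<in> Hd"
  then have c: "X \<in> carrier_mat N N" by (simp add: Hd_def)
  have "X $$ (r, c) = 0" if "r < N" "c < N" "r div p \<noteq> c div p" for r c
  proof -
    have "r \<noteq> c" using that(3) by blast
    then show ?thesis using X c that by (simp add: Hd_def diagonal_mat_def)
  qed
  then show "X \<in> blk N p" using c by (simp add: blk_def)
qed

lemma E_t_A_ind:
  assumes "(i, a) \<in> A_ind p"
  shows "E_t N p l (i, a) = Eb (nat (i - 1)) (nat (i - 1 + a))" "nat (i - 1) < p" "nat (i - 1 + a) < p"
    "nat (i - 1) \<noteq> nat (i - 1 + a)"
  using assms N_pos(2) by (auto simp: A_ind_def E_ind_def E_t_Eb)

lemma Eb_A_ind: "i < p \<Longrightarrow> c < p \<Longrightarrow> i \<noteq> c \<Longrightarrow> Eb i c \<in> E_t N p l ` A_ind p"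
  unfolding Eb_def by (intro imageI) (auto simp: A_ind_def E_ind_def)

lemma Eb_g0b: "i < p \<Longrightarrow> c < p \<Longrightarrow> i \<noteq> c \<Longrightarrow> Eb i c \<in> g0b"
  using Eb_circ Eb_blk mtrace_Eb N_pos(2) by auto

lemma g0b_in_subspace:
  assumes U: "VectorSpace.subspace class_ring U (sl_lie N)"
    and S: "coroot_t N p l ` {1..int p - 1} \<union> E_t N p l ` A_ind p \<subseteq> U" and X: "X \<in> g0b"
  shows "X \<in> U"
proof -
  have Xc: "X \<in> circ N p" "mtrace X = 0" using X by auto
  note d = dpart[OF Xc]
  have "X - dpart X \<in> U"
  proof (rule circ_in_subspace[OF d(3) mem_sl_subspace(2)[OF U] mem_sl_subspace(4)[OF U] mem_sl_subspace(5)[OF U]])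
    fix i c assume i: "i < p" "c < N" and nz: "(X - dpart X) $$ (i, c) \<noteq> 0"
    have "i \<noteq> c" using d(4)[of i] X i nz N_pos by auto
    then have "X $$ (i, c) \<noteq> 0" using d(5)[of i c] X i nz N_pos by auto
    then have "c < p" using X i circ_blk_iff[of X] by (metis IntD1 IntD2 not_less)
    then show "Eb i c \<in> U" using Eb_A_ind[of i c] i \<open>i \<noteq> c\<close> S by auto
  qed
  moreover have "dpart X \<in> U" using Hd_in_subspace[OF U _ d(1)] S X by auto
  ultimately show ?thesis using d(2) X mem_sl_subspace(3)[OF U] by (metis IntD1 IntD2 mem_Collect_eq sl_lie_simps(1))
qed

lemma generators_g0b: "coroot_t N p l ` {1..int p - 1} \<union> E_t N p l ` A_ind p \<subseteq> g0b"
proof -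
  have "E_t N p l (i, a) \<in> g0b" if "(i, a) \<in> A_ind p" for i a
    using E_t_A_ind[OF that] Eb_g0b by metis
  then show ?thesis using coroot_Hd Hd_blk by (auto simp: Hd_def)
qed

text \<open>\<open>g0_t\<close> is defined as a linear span only. Its description by entries yields
  closure under the bracket.\<close>

lemma g0_t_eq: "g0_t N p l = g0b"
  unfolding g0_t_def using generators_g0b g0b_in_subspace lie_subalgebraD(1)[OF lie_subalgebra_circ_blk]
  by (intro lspan_eqI[OF lie_algebra_sl]) blast+

subsection \<open>The complement of \<open>sl(p)\<close>\<close>

text \<open>The position, within the first \<open>p\<close> rows, of the only entry 1 of
  \<open>E_t (s, a)\<close>.\<close>

definition idx :: "int \<times> int \<Rightarrow> nat \<times> nat" where
  "idx = (\<lambda>(s, a). (nat (s - 1), nat ((s - 1 + a) mod int N)))"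

lemma idx_bounds: "1 \<le> s \<Longrightarrow> s \<le> int p \<Longrightarrow> fst (idx (s, a)) < p \<and> snd (idx (s, a)) < N"
  using N_pos by (auto simp: idx_def nat_less_iff)

lemma E_t_idx: "1 \<le> s \<Longrightarrow> s \<le> int p \<Longrightarrow> E_t N p l (s, a) = case_prod Eb (idx (s, a))"
  by (simp add: idx_def E_t_Eb)

lemma E_t_at_idx:
  assumes "1 \<le> s" "s \<le> int p" "1 \<le> s'" "s' \<le> int p"
  shows "E_t N p l (s, a) $$ idx (s', a') = (if idx (s, a) = idx (s', a') then 1 else 0)"
proof -
  obtain i c i' c' where i: "idx (s, a) = (i, c)" "idx (s', a') = (i', c')" by fastforce
  have "i < p" "c < N" "i' < p" "c' < N"
    using idx_bounds[OF assms(1,2), of a] idx_bounds[OF assms(3,4), of a'] i by auto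
  then show ?thesis using E_t_idx[OF assms(1,2), of a] by (auto simp: i Eb_entry_row0)
qed

lemma sqrt_l: "complex_of_real (sqrt (real l)) \<noteq> 0"
  using l by simp

lemma t0_E_t: "complex_of_real (sqrt (real l)) \<cdot>\<^sub>m t0 N p l x = E_t N p l x"
  using sqrt_l carrier_matD[OF E_t_carrier[of x]] by (intro eq_matI) (auto simp: t0_def)

lemma t0_carrier [simp]: "t0 N p l x \<in> carrier_mat N N"
  by (simp add: t0_def)

text \<open>The entry at \<open>idx x\<close> is a functional dual to the family. The offset is
  visible in a matrix only modulo \<open>N\<close>; the hypothesis \<open>close\<close> makes it
  recoverable. The algebra \<open>L\<close> is left open because \<open>V\<close> is a subspace of
  gl(N), while its replacement indexed by \<open>W_ind\<close> lies in sl(N).\<close>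

lemma t0_independent:
  assumes S: "\<And>s a. (s, a) \<in> S \<Longrightarrow> 1 \<le> s \<and> s \<le> int p"
    and close: "\<And>s a b. (s, a) \<in> S \<Longrightarrow> (s, b) \<in> S \<Longrightarrow> \<bar>a - b\<bar> < int N"
  shows "inj_on (t0 N p l) S"
    and "lie_algebra L \<Longrightarrow> add L = (+) \<Longrightarrow> module.smult L = (\<cdot>\<^sub>m) \<Longrightarrow> carrier L \<subseteq> carrier_mat N N
      \<Longrightarrow> t0 N p l ` S \<subseteq> carrier L \<Longrightarrow> \<not> lindep L (t0 N p l ` S)"
proof -
  have idx: "x = y" if xy: "x \<in> S" "y \<in> S" "idx x = idx y" for x y
  proof -
    obtain s a s' b where x: "x = (s, a)" "y = (s', b)" by fastforce
    have s: "s = s'" using xy S[of s a] S[of s' b] by (auto simp: x idx_def)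
    have "(s - 1 + a) mod int N = (s - 1 + b) mod int N"
      using xy N_pos(1) by (simp add: x s idx_def eq_nat_nat_iff)
    then have "s - 1 + a = s - 1 + b"
      using close[of s a b] xy unfolding x s by (subst (asm) mod_eq_iff_close) auto
    then show ?thesis by (simp add: x s)
  qed
  have at: "t0 N p l x $$ idx y = (if x = y then 1 / complex_of_real (sqrt (real l)) else 0)"
    if xy: "x \<in> S" "y \<in> S" for x y
  proof -
    obtain s a s' b where x: "x = (s, a)" "y = (s', b)" by fastforce
    have s: "1 \<le> s" "s \<le> int p" "1 \<le> s'" "s' \<le> int p" using S[of s a] S[of s' b] xy x by auto
    obtain i c where ic: "idx y = (i, c)" by fastforce
    then have i: "idx y = (i, c)" "i < p" "c < N" using idx_bounds[OF s(3,4), of b] x by auto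
    have "t0 N p l x $$ idx y = 1 / complex_of_real (sqrt (real l)) * E_t N p l x $$ idx y"
      using i N_pos(2) carrier_matD[OF E_t_carrier[of x]] by (simp add: t0_def)
    also have "E_t N p l x $$ idx y = (if x = y then 1 else 0)"
      using E_t_at_idx[OF s, of a b] idx[OF xy] unfolding x by metis
    finally show ?thesis by simp
  qed
  show inj: "inj_on (t0 N p l) S"
  proof (rule inj_onI)
    fix x y assume xy: "x \<in> S" "y \<in> S" "t0 N p l x = t0 N p l y"
    have "t0 N p l y $$ idx x = 1 / complex_of_real (sqrt (real l))"
      using at[OF xy(1) xy(1)] unfolding xy(3) by simp
    then show "x = y" using at[OF xy(2,1)] sqrt_l by (metis divide_eq_0_iff zero_neq_one)
  qed
  assume L: "lie_algebra L" "add L = (+)" "module.smult L = (\<cdot>\<^sub>m)" "carrier L \<subseteq> carrier_mat N N"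
    "t0 N p l ` S \<subseteq> carrier L"
  show "\<not> lindep L (t0 N p l ` S)"
  proof (rule not_lindepI[OF L(1,5)])
    fix v assume "v \<in> t0 N p l ` S"
    then obtain x where x: "x \<in> S" "v = t0 N p l x" by auto
    obtain s a where sa: "x = (s, a)" by fastforce
    obtain i c where ic: "idx x = (i, c)" by fastforce
    then have i: "idx x = (i, c)" "i < N" "c < N" using idx_bounds[of s a] S[of s a] x N_pos(2) sa by auto
    show "\<exists>f. (\<forall>x\<in>carrier L. \<forall>y\<in>carrier L. f (x \<oplus>\<^bsub>L\<^esub> y) = f x + f y) \<and>
        (\<forall>c. \<forall>x\<in>carrier L. f (c \<odot>\<^bsub>L\<^esub> x) = c * f x) \<and> f v \<noteq> (0 :: complex) \<and> (\<forall>w\<in>t0 N p l ` S - {v}. f w = 0)"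
    proof (intro exI[of _ "\<lambda>M. M $$ idx x"] conjI ballI allI)
      fix M M' k assume M: "M \<in> carrier L"
      then have d: "dim_row M = N" "dim_col M = N" using L(4) by auto
      then show "(k \<odot>\<^bsub>L\<^esub> M) $$ idx x = k * M $$ idx x" using L(3) i by simp
      assume "M' \<in> carrier L"
      then have "dim_row M' = N" "dim_col M' = N" using L(4) by auto
      then show "(M \<oplus>\<^bsub>L\<^esub> M') $$ idx x = M $$ idx x + M' $$ idx x" using L(2) i d by simp
    next
      show "v $$ idx x \<noteq> 0" using at[OF x(1) x(1)] sqrt_l x(2) by simp
      fix w assume "w \<in> t0 N p l ` S - {v}"
      then obtain y where "y \<in> S" "w = t0 N p l y" "y \<noteq> x" using x by blast
      then show "w $$ idx x = 0" using at[of y x] x(1) by simp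
    qed
  qed
qed

lemma V_W_ind:
  "(s, a) \<in> V_ind N p \<Longrightarrow> 1 \<le> s \<and> s \<le> int p" "(s, a) \<in> W_ind N p \<Longrightarrow> 1 \<le> s \<and> s \<le> int p"
  "(s, a) \<in> V_ind N p \<Longrightarrow> (s, b) \<in> V_ind N p \<Longrightarrow> \<bar>a - b\<bar> < int N"
  "(s, a) \<in> W_ind N p \<Longrightarrow> (s, b) \<in> W_ind N p \<Longrightarrow> \<bar>a - b\<bar> < int N"
  using p by (auto simp: V_ind_def W_ind_def)

lemma E_t_W_ind:
  assumes "(s, a) \<in> W_ind N p"
  shows "E_t N p l (s, a) = Eb (nat (s - 1)) (nat (s - 1 + a))" "nat (s - 1) < p" "nat (s - 1 + a) < N"
    "p \<le> nat (s - 1 + a)"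
  using assms N_pos(2) by (auto simp: W_ind_def E_t_Eb)

lemma t0_W_ind_sl: "t0 N p l ` W_ind N p \<subseteq> carrier (sl_lie N)"
proof -
  have "mtrace (t0 N p l (s, a)) = 0" if "(s, a) \<in> W_ind N p" for s a
    using E_t_W_ind[OF that] mtrace_Eb[of "nat (s - 1)" "nat (s - 1 + a)"]
    by (simp add: t0_def mtrace_smult[OF Eb_carrier])
  then show ?thesis by auto
qed

lemma V_W_independent:
  "inj_on (t0 N p l) (V_ind N p)" "\<not> lindep (gl_lie N) (t0 N p l ` V_ind N p)"
  "inj_on (t0 N p l) (W_ind N p)" "\<not> lindep (sl_lie N) (t0 N p l ` W_ind N p)"
proof -
  show "inj_on (t0 N p l) (V_ind N p)"
    by (rule t0_independent(1)) (erule V_W_ind(1), erule (1) V_W_ind(3))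
  show "\<not> lindep (gl_lie N) (t0 N p l ` V_ind N p)"
    by (rule t0_independent(2)[OF _ _ lie_algebra_gl], erule V_W_ind(1), erule (1) V_W_ind(3)) auto
  show "inj_on (t0 N p l) (W_ind N p)"
    by (rule t0_independent(1)) (erule V_W_ind(2), erule (1) V_W_ind(4))
  show "\<not> lindep (sl_lie N) (t0 N p l ` W_ind N p)"
    by (rule t0_independent(2)[OF _ _ lie_algebra_sl], erule V_W_ind(2), erule (1) V_W_ind(4))
      (use t0_W_ind_sl in simp_all)
qed

lemma Eb_mult_row0:
  assumes "i < p" "j < N" "Y \<in> carrier_mat N N" "r < p" "c < N"
  shows "(Eb i j * Y) $$ (r, c) = (if r = i then Y $$ (j, c) else 0)"
proof -
  have "(Eb i j * Y) $$ (r, c) = (\<Sum>k<N. Eb i j $$ (r, k) * Y $$ (k, c))"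
    using assms N_pos(2) by (intro mat_mult_entry) auto
  also have "\<dots> = (\<Sum>k<N. if k = j then if r = i then Y $$ (k, c) else 0 else 0)"
    using assms by (intro sum.cong refl) (auto simp: Eb_entry_row0)
  finally show ?thesis using assms by simp
qed

text \<open>As long as the inner indices stay in the first block, these elements multiply like
  matrix units. The last column \<open>c\<close> is free to leave that block.\<close>

lemma Eb_mult_block: "i < p \<Longrightarrow> j < p \<Longrightarrow> k < p \<Longrightarrow> c < N \<Longrightarrow>
    Eb i j * Eb k c = (if j = k then Eb i c else 0\<^sub>m N N)"
  using N_pos(2) by (intro circ_eqI circ_closed Eb_circ)
    (auto simp: Eb_mult_row0 Eb_entry_row0 Eb_circ circ_closed simp del: index_mult_mat(1))

lemma Eb_mult_zero: "i < p \<Longrightarrow> c < N \<Longrightarrow> k < p \<Longrightarrow> d < N \<Longrightarrow> c mod p \<noteq> k \<Longrightarrow> Eb i c * Eb k d = 0\<^sub>m N N"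
  using N_pos(2) by (intro circ_eqI circ_closed Eb_circ)
    (auto simp: Eb_mult_row0 Eb_entry simp del: index_mult_mat(1))

lemma circ_subspace: "VectorSpace.subspace class_ring (circ N p) (gl_lie N)"
  by (rule subspaceI[OF lie_algebra_gl]) (auto simp: circ_closed, auto simp: circ_def)

lemma t0_subspace:
  assumes U: "VectorSpace.subspace class_ring U L" and "module.smult L = (\<cdot>\<^sub>m)" "t0 N p l x \<in> U"
  shows "E_t N p l x \<in> U"
  using subspaceD(4)[OF U assms(3)] t0_E_t[of x] assms(2) by metis

lemma t0_circ: "1 \<le> s \<Longrightarrow> s \<le> int p \<Longrightarrow> t0 N p l (s, a) \<in> circ N p"
  by (simp add: t0_def circ_closed E_t_circ)

lemma t0_V_circ: "t0 N p l ` V_ind N p \<subseteq> circ N p"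
  using t0_circ V_W_ind(1) by auto

lemma t0_V_carrier: "t0 N p l ` V_ind N p \<subseteq> carrier (gl_lie N)"
  by auto

lemma V_space_circ: "V_space N p l \<subseteq> circ N p"
  unfolding V_space_def by (rule lspan_subset[OF lie_algebra_gl circ_subspace t0_V_circ])

lemma Eb_V_space: "i < p \<Longrightarrow> i + p \<le> c \<Longrightarrow> c < N \<Longrightarrow> Eb i c \<in> V_space N p l"
proof -
  assume i: "i < p" "i + p \<le> c" "c < N"
  have sub: "VectorSpace.subspace class_ring (V_space N p l) (gl_lie N)"
    unfolding V_space_def by (rule subspace_lspan[OF lie_algebra_gl t0_V_carrier])
  have "(int i + 1, int c - int i) \<in> V_ind N p" using i by (auto simp: V_ind_def)
  then have "t0 N p l (int i + 1, int c - int i) \<in> V_space N p l"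
    unfolding V_space_def using lspan_superset[OF lie_algebra_gl t0_V_carrier] by auto
  then show "Eb i c \<in> V_space N p l" unfolding Eb_def by (intro t0_subspace[OF sub]) auto
qed

lemma g0_subalgebra: "lie_subalgebra (g0 N p) (sl_lie N)"
  unfolding g0_eq by (rule lie_subalgebra_circ)

lemma g0b_V_hull: "lie_hull (sl_lie N) (g0_t N p l \<union> (V_space N p l \<inter> carrier (sl_lie N))) = g0 N p"
proof -
  have "g0 N p \<subseteq> U" if U: "lie_subalgebra U (sl_lie N)" "g0b \<union> (V_space N p l \<inter> carrier (sl_lie N)) \<subseteq> U" for U
  proof
    note US = lie_subalgebraD(1)[OF U(1)]
    fix X assume "X \<in> g0 N p"
    then have X: "X \<in> circ N p" "mtrace X = 0" by (auto simp: g0_eq)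
    note d = dpart[OF X]
    have V: "Eb i c \<in> U" if "i < p" "i + p \<le> c" "c < N" for i c
      using Eb_V_space[OF that] mtrace_Eb[of i c] that p U(2) by auto
    have "X - dpart X \<in> U"
    proof (rule circ_in_subspace[OF d(3) mem_sl_subspace(2)[OF US] mem_sl_subspace(4)[OF US] mem_sl_subspace(5)[OF US]])
      fix i c assume i: "i < p" "c < N" and nz: "(X - dpart X) $$ (i, c) \<noteq> 0"
      have ic: "i \<noteq> c" using d(4)[of i] i nz N_pos by auto
      show "Eb i c \<in> U"
      proof (cases "c < p \<or> i + p \<le> c")
        case True
        then show ?thesis using Eb_g0b[of i c] V[of i c] i ic U(2) by auto
      next
        case False
        \<comment> \<open>Here \<open>p \<le> c < i + p\<close>. Subtracting \<open>p\<close> gives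
          a column \<open>j < i\<close> of the first block, so \<open>Eb i j\<close> lies in sl(p),
          while \<open>Eb j c\<close> has offset exactly \<open>p\<close> and lies in
          \<open>V\<close>. The reversed product vanishes because
          \<open>c mod p = j \<noteq> i\<close>.\<close>
        define j where "j = c - p"
        have j: "c = p + j" "j < i" using False by (auto simp: j_def)
        \<comment> \<open>\<open>Eb i c\<close> lies neither in \<open>sl(p)\<close> nor in \<open>V\<close>, but is a bracket of elements of these spaces.\<close>
        have "Eb i j * Eb j c - Eb j c * Eb i j = Eb i c - 0\<^sub>m N N"
          using i j p N_pos(2) by (subst Eb_mult_block, simp_all) (subst Eb_mult_zero, auto)
        also have "\<dots> = Eb i c" using carrier_matD[OF Eb_carrier[of i c]] by (intro eq_matI) auto
        finally show ?thesis
          using lie_subalgebraD(2)[OF U(1), of "Eb i j" "Eb j c"] Eb_g0b[of i j] V[of j c] i j U(2) by auto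
      qed
    qed
    moreover have "dpart X \<in> U" using d(1) Hd_blk U(2) by (auto simp: Hd_def)
    ultimately show "X \<in> U" using d(2) mem_sl_subspace(3)[OF US] by metis
  qed
  moreover have "g0b \<union> (V_space N p l \<inter> carrier (sl_lie N)) \<subseteq> g0 N p"
    using V_space_circ by (auto simp: g0_eq)
  ultimately show ?thesis
    unfolding lie_hull_def g0_t_eq using g0_subalgebra by blast
qed

lemma span_all_eq_g0:
  "lspan (gl_lie N) (coroot_t N p l ` {1..int p - 1} \<union> E_t N p l ` E_ind p \<union> t0 N p l ` V_ind N p)
    \<inter> carrier (sl_lie N) = g0 N p"
proof -
  let ?S = "coroot_t N p l ` {1..int p - 1} \<union> E_t N p l ` E_ind p \<union> t0 N p l ` V_ind N p"
  have "lspan (gl_lie N) ?S = circ N p"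
  proof (rule lspan_eqI[OF lie_algebra_gl circ_subspace])
    have "coroot_t N p l ` {1..int p - 1} \<subseteq> circ N p" using coroot_Hd by (auto simp: Hd_def)
    moreover have "E_t N p l ` E_ind p \<subseteq> circ N p" by (auto simp: E_ind_def E_t_circ)
    ultimately show "?S \<subseteq> circ N p" using t0_V_circ by blast
    fix U assume U: "VectorSpace.subspace class_ring U (gl_lie N)" "?S \<subseteq> U"
    have V: "E_t N p l (s, a) \<in> U" if "(s, a) \<in> V_ind N p" for s a
      using that U(2) by (intro t0_subspace[OF U(1)]) auto
    show "circ N p \<subseteq> U"
    proof
      fix X assume "X \<in> circ N p"
      then show "X \<in> U"
      proof (rule circ_in_subspace[OF _ mem_gl_subspace(2)[OF U(1)] mem_gl_subspace(4)[OF U(1)] mem_gl_subspace(5)[OF U(1)]])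
        fix i c assume i: "i < p" "c < N"
        consider "c = i" | "(int i + 1, int c - int i) \<in> E_ind p" | "(int i + 1, int c - int i) \<in> V_ind N p"
        proof -
          \<comment> \<open>A negative offset is larger than \<open>- p\<close> because the row is
            at most \<open>p - 1\<close>; it therefore falls into the range of
            \<open>E_ind\<close>.\<close>
          have "c = i \<or> 1 \<le> \<bar>int c - int i\<bar> \<and> \<bar>int c - int i\<bar> \<le> int p - 1 \<or> int p \<le> int c - int i"
            using i by arith
          then show ?thesis using that i by (auto simp: E_ind_def V_ind_def)
        qed
        then show "Eb i c \<in> U"
        proof cases
          case 1
          \<comment> \<open>Offset \<open>N\<close> is offset 0: the diagonal basis elements are the
            ones that \<open>V\<close> contributes outside sl(N).\<close>
          have "Eb i c = E_t N p l (int i + 1, int N)" unfolding Eb_def 1 using i by (simp add: E_t_Eb)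
          then show ?thesis using V[of "int i + 1" "int N"] i N_pos(2) by (simp add: V_ind_def)
        next
          case 2
          then show ?thesis using U(2) unfolding Eb_def by blast
        next
          case 3
          then show ?thesis using V unfolding Eb_def by blast
        qed
      qed
    qed
  qed
  then show ?thesis by (simp add: g0_eq)
qed

text \<open>By circulance a vanishing first diagonal block makes all diagonal blocks vanish, and
  with them the trace.\<close>

definition offb :: "complex mat set" where
  "offb = {X \<in> circ N p. \<forall>i<p. \<forall>c<p. X $$ (i, c) = 0}"

lemma offb_sl: "offb \<subseteq> carrier (sl_lie N)"
  using mtrace_circ by (auto simp: offb_def) (simp add: circ_def)

lemma offb_subspace: "VectorSpace.subspace class_ring offb (sl_lie N)"
  using N_pos(2) offb_sl
  by (intro subspaceI[OF lie_algebra_sl]) (auto simp: offb_def circ_closed circ_def)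

lemma span_W_ind: "lspan (sl_lie N) (t0 N p l ` W_ind N p) = offb"
proof (rule lspan_eqI[OF lie_algebra_sl offb_subspace])
  have "t0 N p l (s, a) \<in> offb" if sa: "(s, a) \<in> W_ind N p" for s a
    using t0_circ[of s a] V_W_ind(2)[OF sa] E_t_W_ind[OF sa] N_pos(2)
      carrier_matD[OF Eb_carrier[of "nat (s - 1)" "nat (s - 1 + a)"]]
    by (auto simp: offb_def) (auto simp: t0_def Eb_entry_row0)
  then show "t0 N p l ` W_ind N p \<subseteq> offb" by auto
  fix U assume U: "VectorSpace.subspace class_ring U (sl_lie N)" "t0 N p l ` W_ind N p \<subseteq> U"
  show "offb \<subseteq> U"
  proof
    fix X assume X: "X \<in> offb"
    then have "X \<in> circ N p" by (simp add: offb_def)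
    then show "X \<in> U"
    proof (rule circ_in_subspace[OF _ mem_sl_subspace(2)[OF U(1)] mem_sl_subspace(4)[OF U(1)] mem_sl_subspace(5)[OF U(1)]])
      fix i c assume i: "i < p" "c < N" "X $$ (i, c) \<noteq> 0"
      have "\<forall>i<p. \<forall>c<p. X $$ (i, c) = 0" using X by (simp add: offb_def)
      then have "p \<le> c" using i by (cases "c < p") auto
      then have "(int i + 1, int c - int i) \<in> W_ind N p" using i by (auto simp: W_ind_def)
      then show "Eb i c \<in> U" using U(2) unfolding Eb_def by (intro t0_subspace[OF U(1)]) auto
    qed
  qed
qed

lemma g0_decomposition:
  "LinearCombinations.module.submodule_sum (sl_lie N) (g0_t N p l) (lspan (sl_lie N) (t0 N p l ` W_ind N p)) = g0 N p"
  "g0_t N p l \<inter> lspan (sl_lie N) (t0 N p l ` W_ind N p) = {\<zero>\<^bsub>sl_lie N\<^esub>}"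
proof -
  have sum: "LinearCombinations.module.submodule_sum (sl_lie N) A B = {x + y | x y. x \<in> A \<and> y \<in> B}" for A B
    unfolding LinearCombinations.module.submodule_sum_def[OF lie_algebra_module[OF lie_algebra_sl]] by force
  have "X \<in> {x + y | x y. x \<in> g0b \<and> y \<in> offb}" if "X \<in> circ N p" "mtrace X = 0" for X
  proof -
    \<comment> \<open>\<open>B\<close> keeps the first diagonal block of \<open>X\<close> together
      with its repetitions. It contains the whole diagonal, so it inherits trace 0 and the remainder
      lies in \<open>offb\<close>.\<close>
    define B where "B = matsum N (\<lambda>(i, c). X $$ (i, c) \<cdot>\<^sub>m Eb i c) ({..<p} \<times> {..<p})"
    have B: "B \<in> circ N p"
      unfolding B_def by (intro mem_gl_subspace(5)[OF circ_subspace]) (auto simp: circ_closed Eb_circ)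
    have Be: "B $$ (r, c) = (if c < p then X $$ (r, c) else 0)" if r: "r < p" "c < N" for r c
    proof -
      have "B $$ (r, c) = (\<Sum>x\<in>{..<p} \<times> {..<p}. if x = (r, c) then X $$ x else 0)"
        unfolding B_def using r N_pos(2) carrier_matD[OF Eb_carrier]
        by (subst matsum_entry, simp, simp) (intro sum.cong refl, auto simp: Eb_entry_row0 split: if_splits)
      then show ?thesis using r by simp
    qed
    have c: "X \<in> carrier_mat N N" "B \<in> carrier_mat N N" using B that by (auto simp: circ_def)
    have "mtrace B = mtrace X"
      using mtrace_circ[OF B] mtrace_circ[OF that(1)] Be N_pos(2) by simp
    then have "B \<in> g0b" using B Be circ_blk_iff[OF B] that(2) c by simp
    moreover have "X - B \<in> offb"
      using circ_closed(3)[OF that(1) B] Be N_pos(2) c by (auto simp: offb_def)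
    moreover have "X = B + (X - B)" using c by (intro eq_matI) auto
    ultimately show ?thesis by blast
  qed
  moreover have "x + y \<in> circ N p \<inter> carrier (sl_lie N)" if "x \<in> g0b" "y \<in> offb" for x y
    using that offb_sl mtrace_simps(1)[of x N y] by (auto simp: circ_closed offb_def)
  ultimately show "LinearCombinations.module.submodule_sum (sl_lie N) (g0_t N p l)
      (lspan (sl_lie N) (t0 N p l ` W_ind N p)) = g0 N p"
    unfolding sum span_W_ind g0_t_eq g0_eq by auto
  have "X = 0\<^sub>m N N" if "X \<in> g0b" "X \<in> offb" for X
  proof (rule circ_eqI)
    show "X \<in> circ N p" "0\<^sub>m N N \<in> circ N p" using that by (auto simp: circ_closed)
    fix i c assume "i < p" "c < N"
    then show "X $$ (i, c) = 0\<^sub>m N N $$ (i, c)"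
      using that circ_blk_iff[of X] N_pos(2) by (cases "c < p") (auto simp: offb_def)
  qed
  moreover have "0\<^sub>m N N \<in> g0b" "0\<^sub>m N N \<in> offb"
    using N_pos(2) by (auto simp: circ_closed blk_closed offb_def)
  ultimately show "g0_t N p l \<inter> lspan (sl_lie N) (t0 N p l ` W_ind N p) = {\<zero>\<^bsub>sl_lie N\<^esub>}"
    unfolding span_W_ind g0_t_eq by auto
qed

end

section \<open>Roots of algebras with a diagonal Cartan subalgebra\<close>

lemma diagonal_bracket:
  fixes h X :: "complex mat"
  assumes "h \<in> carrier_mat n n" "diagonal_mat h" "X \<in> carrier_mat n n" "r < n" "c < n"
  shows "(h * X - X * h) $$ (r, c) = (h $$ (r, r) - h $$ (c, c)) * X $$ (r, c)"
proof -
  have "(h * X) $$ (r, c) = (\<Sum>k<n. if k = r then h $$ (r, r) * X $$ (r, c) else 0)"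
    using assms by (subst mat_mult_entry[where n = n], simp_all del: sum.delta sum.delta')
      (intro sum.cong refl, auto simp: diagonal_mat_def)
  moreover have "(X * h) $$ (r, c) = (\<Sum>k<n. if k = c then X $$ (r, c) * h $$ (c, c) else 0)"
    using assms by (subst mat_mult_entry[where n = n], simp_all del: sum.delta sum.delta')
      (intro sum.cong refl, auto simp: diagonal_mat_def)
  moreover have "(h * X - X * h) $$ (r, c) = (h * X) $$ (r, c) - (X * h) $$ (r, c)"
    using assms by (intro index_minus_mat) auto
  ultimately show ?thesis using assms(4,5)
    by (simp add: algebra_simps del: index_mult_mat(1))
qed

text \<open>The functional e_r - e_c on \<open>H\<close>, with positions counted from 0;
  extensional, as \<open>roots\<close> demands.\<close>

definition diff_root :: "complex mat set \<Rightarrow> nat \<Rightarrow> nat \<Rightarrow> complex mat \<Rightarrow> complex" where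
  "diff_root H r c = (\<lambda>h\<in>H. h $$ (r, r) - h $$ (c, c))"

text \<open>Simple roots are numbered from 1 and positions from 0, so the simple root
  \<open>k\<close> is the difference of the positions \<open>k - 1\<close> and \<open>k\<close>. The
  sum of consecutive simple roots telescopes.\<close>

lemma sum_telescope_int:
  "(\<Sum>k\<in>{int r + 1..int r + int d}. f (nat (k - 1)) - f (nat k)) = f r - (f (r + d) :: complex)"
proof (induction d)
  case (Suc d)
  have "{int r + 1..int r + int (Suc d)} = insert (int r + int (Suc d)) {int r + 1..int r + int d}"
    by auto
  then show ?case using Suc by (simp add: nat_add_distrib)
qed simp

text \<open>
  Both \<open>sl(p)\<close>, embedded as scalar block matrices, and the algebra of the kept roots are of this
  kind. Distinct pairs in \<open>R\<close> may belong to the same root: in the embedded \<open>sl(p)\<close> every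
  diagonal block gives the same roots.
\<close>

locale diagonal_roots =
  fixes n :: nat and W H :: "complex mat set" and R :: "(nat \<times> nat) set"
  assumes W: "lie_subalgebra W (sl_lie n)"
    and H: "H = {X \<in> W. diagonal_mat X}"
    and R: "(r, c) \<in> R \<Longrightarrow> r < n \<and> c < n \<and> r \<noteq> c"
    and support: "X \<in> W \<Longrightarrow> r < n \<Longrightarrow> c < n \<Longrightarrow> r \<noteq> c \<Longrightarrow> X $$ (r, c) \<noteq> 0 \<Longrightarrow> (r, c) \<in> R"
    and separated: "(r, c) \<in> R \<Longrightarrow> \<exists>h\<in>H. h $$ (r, r) \<noteq> h $$ (c, c)"
    and root_vector: "(r, c) \<in> R \<Longrightarrow> \<exists>X\<in>W. X \<noteq> 0\<^sub>m n n \<and>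
      (\<forall>h\<in>H. h * X - X * h = (h $$ (r, r) - h $$ (c, c)) \<cdot>\<^sub>m X)"
begin

abbreviation "L \<equiv> (sl_lie n)\<lparr>carrier := W\<rparr>"

lemma lie_algebra_L: "lie_algebra L"
  by (rule lie_algebra_subalgebra[OF lie_algebra_sl W])

lemma W_carrier: "X \<in> W \<Longrightarrow> X \<in> carrier_mat n n"
  using subspaceD(1)[OF lie_subalgebraD(1)[OF W]] by auto

lemmas W_closed = mem_sl_subspace(2-4)[OF lie_subalgebraD(1)[OF W]]

lemma H_W: "h \<in> H \<Longrightarrow> h \<in> W" and H_diag: "h \<in> H \<Longrightarrow> diagonal_mat h"
  by (simp_all add: H)

lemma bracket_H: "x \<in> H \<Longrightarrow> y \<in> H \<Longrightarrow> x * y - y * x = 0\<^sub>m n n"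
proof -
  assume xy: "x \<in> H" "y \<in> H"
  have c: "x \<in> carrier_mat n n" "y \<in> carrier_mat n n" using xy H_W W_carrier by auto
  have "(x * y - y * x) $$ (r, s) = 0" if rs: "r < n" "s < n" for r s
    using diagonal_bracket[OF c(1) H_diag[OF xy(1)] c(2) rs] H_diag[OF xy(2)] c rs
    by (cases "r = s") (simp_all add: diagonal_mat_def)
  then show ?thesis using c by (intro eq_matI) (auto simp del: index_mult_mat(1) index_minus_mat(1))
qed

lemma subspace_H: "VectorSpace.subspace class_ring H L"
proof (rule subspaceI[OF lie_algebra_L])
  fix x y assume xy: "x \<in> H" "y \<in> H"
  have c: "x \<in> carrier_mat n n" "y \<in> carrier_mat n n" using xy H_W W_carrier by auto
  show "x \<oplus>\<^bsub>L\<^esub> y \<in> H"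
    using xy c W_closed(2)[of x y] by (auto simp: H diagonal_mat_def)
qed (use W_closed W_carrier in \<open>auto simp: H diagonal_mat_def\<close>)

text \<open>\<open>H\<close> is abelian, hence nilpotent. It is its own normaliser: if
  \<open>x\<close> had an entry off the diagonal at \<open>(r, c)\<close>, an element of
  \<open>H\<close> separating \<open>r\<close> and \<open>c\<close> would produce a bracket that is
  not diagonal.\<close>

lemma cartan_subalgebra_H: "cartan_subalgebra H L"
proof -
  have z: "0\<^sub>m n n \<in> H" using subspaceD(2)[OF subspace_H] by simp
  have zero: "VectorSpace.subspace class_ring {0\<^sub>m n n} L"
    by (rule subspaceI[OF lie_algebra_L]) (use z H_W in auto)
  have S: "{x \<otimes>\<^bsub>L\<^esub> y | x y. x \<in> H \<and> y \<in> H} \<subseteq> {0\<^sub>m n n}"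
    using bracket_H by auto
  have "{x \<otimes>\<^bsub>L\<^esub> y | x y. x \<in> H \<and> y \<in> H} \<subseteq> carrier L" using bracket_H z H_W by auto
  then have "\<zero>\<^bsub>L\<^esub> \<in> lspan L {x \<otimes>\<^bsub>L\<^esub> y | x y. x \<in> H \<and> y \<in> H}"
    by (intro subspaceD(2)[OF subspace_lspan[OF lie_algebra_L]])
  then have "lower_central L H 1 = {\<zero>\<^bsub>L\<^esub>}"
    using lspan_subset[OF lie_algebra_L zero S] by auto
  moreover have "x \<in> H" if x: "x \<in> W" and n: "\<forall>h\<in>H. x * h - h * x \<in> H" for x
  proof -
    have "x $$ (r, c) = 0" if rc: "r < n" "c < n" "r \<noteq> c" for r c
    proof (rule ccontr)
      assume nz: "x $$ (r, c) \<noteq> 0"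
      then obtain h where h: "h \<in> H" "h $$ (r, r) \<noteq> h $$ (c, c)"
        using separated[OF support[OF x rc]] by auto
      have hc: "h \<in> carrier_mat n n" "x \<in> carrier_mat n n" using h H_W W_carrier x by auto
      have "diagonal_mat (x * h - h * x)" using n h H_diag by blast
      then have "(x * h - h * x) $$ (r, c) = 0" using hc rc by (simp add: diagonal_mat_def del: index_mult_mat(1) index_minus_mat(1))
      then have "(h * x - x * h) $$ (r, c) = 0" using hc rc by (simp del: index_mult_mat(1))
      then show False
        using diagonal_bracket[OF hc(1) H_diag[OF h(1)] hc(2) rc(1,2)] nz h(2) by simp
    qed
    then show ?thesis using x W_carrier[OF x] by (simp add: H diagonal_mat_def)
  qed
  moreover have "x \<in> W \<and> (\<forall>h\<in>H. x * h - h * x \<in> H)" if "x \<in> H" for x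
    using that bracket_H z H_W by auto
  moreover have "lie_subalgebra H L"
    unfolding lie_subalgebra_def using subspace_H bracket_H z by auto
  ultimately show ?thesis
    unfolding cartan_subalgebra_def by (auto intro!: exI[of _ 1])
qed

text \<open>A nonzero weight vector has a nonzero entry \<open>(r, c)\<close>; comparing this entry
  on both sides of the weight equation forces the weight to be e_r - e_c. The case
  \<open>r = c\<close> would give weight 0.\<close>

lemma roots_L: "roots L H = (\<lambda>(r, c). diff_root H r c) ` R"
proof (intro equalityI subsetI)
  fix \<beta> assume "\<beta> \<in> roots L H"
  then have b: "\<beta> \<in> extensional H" "\<exists>h\<in>H. \<beta> h \<noteq> 0" "weight_space L H \<beta> \<noteq> {0\<^sub>m n n}"
    by (auto simp: roots_def)
  have "0\<^sub>m n n \<in> weight_space L H \<beta>"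
    using W_closed(1) right_mult_zero_mat[OF W_carrier[OF H_W]] left_mult_zero_mat[OF W_carrier[OF H_W]]
    by (auto simp: weight_space_def)
  then obtain X where X: "X \<in> weight_space L H \<beta>" "X \<noteq> 0\<^sub>m n n" using b(3) by blast
  then have XW: "X \<in> W" and hX: "\<And>h. h \<in> H \<Longrightarrow> h * X - X * h = \<beta> h \<cdot>\<^sub>m X"
    by (auto simp: weight_space_def)
  have Xc: "X \<in> carrier_mat n n" using W_carrier XW by auto
  obtain r c where rc: "r < n" "c < n" "X $$ (r, c) \<noteq> 0"
    using X(2) Xc by (metis carrier_matD eq_matI index_zero_mat)
  have val: "\<beta> h = h $$ (r, r) - h $$ (c, c)" if h: "h \<in> H" for h
  proof -
    have "(h $$ (r, r) - h $$ (c, c)) * X $$ (r, c) = \<beta> h * X $$ (r, c)"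
      using diagonal_bracket[of h n X r c] h H_W W_carrier H_diag Xc rc hX[OF h] by auto
    then show ?thesis using rc by simp
  qed
  then have "\<beta> = diff_root H r c"
    using b(1) by (auto simp: diff_root_def extensional_def)
  moreover have "r \<noteq> c" using b(2) val by auto
  ultimately show "\<beta> \<in> (\<lambda>(r, c). diff_root H r c) ` R" using support[OF XW rc(1,2) _ rc(3)] by force
next
  fix \<beta> assume "\<beta> \<in> (\<lambda>(r, c). diff_root H r c) ` R"
  then obtain r c where rc: "(r, c) \<in> R" "\<beta> = diff_root H r c" by auto
  obtain X where X: "X \<in> W" "X \<noteq> 0\<^sub>m n n" "\<forall>h\<in>H. h * X - X * h = (h $$ (r, r) - h $$ (c, c)) \<cdot>\<^sub>m X"
    using root_vector[OF rc(1)] by auto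
  obtain h where h: "h \<in> H" "h $$ (r, r) \<noteq> h $$ (c, c)" using separated[OF rc(1)] by auto
  have "X \<in> weight_space L H \<beta>" using X rc by (auto simp: weight_space_def diff_root_def)
  then show "\<beta> \<in> roots L H" using X h rc by (auto simp: roots_def diff_root_def)
qed

text \<open>The elements in \<open>dual\<close> are fundamental coweights and give independence. By
  \<open>chain\<close>, each root has a representing pair between whose positions all simple roots
  are available, so it is plus or minus a sum of consecutive simple roots with coefficients 0 and 1.
  The change of pair is needed because different pairs may define the same functional.\<close>

lemma root_base_L:
  assumes I: "finite I" "\<And>k. k \<in> I \<Longrightarrow> 1 \<le> k"
    and simple: "\<And>k. k \<in> I \<Longrightarrow> (nat (k - 1), nat k) \<in> R \<and> \<alpha> k = diff_root H (nat (k - 1)) (nat k)"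
    and dual: "\<And>k. k \<in> I \<Longrightarrow> \<exists>h\<in>H. \<forall>j\<in>I. h $$ (nat (j - 1), nat (j - 1)) - h $$ (nat j, nat j) = (if j = k then 1 else 0)"
    and chain: "\<And>r c. (r, c) \<in> R \<Longrightarrow> \<exists>r' c'. diff_root H r c = diff_root H r' c' \<and>
      {int (min r' c') + 1..int (max r' c')} \<subseteq> I"
  shows "root_base L H I \<alpha>"
proof -
  have \<alpha>: "\<alpha> k h = h $$ (nat (k - 1), nat (k - 1)) - h $$ (nat k, nat k)" if "k \<in> I" "h \<in> H" for k h
    using simple that by (simp add: diff_root_def)
  have "c k = 0" if z: "\<forall>h\<in>H. (\<Sum>i\<in>I. c i * \<alpha> i h) = 0" and k: "k \<in> I" for c k
  proof -
    obtain h where h: "h \<in> H" "\<forall>j\<in>I. h $$ (nat (j - 1), nat (j - 1)) - h $$ (nat j, nat j) = (if j = k then 1 else 0)"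
      using dual[OF k] by auto
    have "(\<Sum>i\<in>I. c i * \<alpha> i h) = (\<Sum>i\<in>I. if i = k then c i else 0)"
      using h by (intro sum.cong refl) (auto simp: \<alpha>)
    then show ?thesis using z h I k by auto
  qed
  moreover have "\<exists>m :: int \<Rightarrow> nat. (\<forall>h\<in>H. \<beta> h = (\<Sum>i\<in>I. of_nat (m i) * \<alpha> i h)) \<or>
      (\<forall>h\<in>H. \<beta> h = - (\<Sum>i\<in>I. of_nat (m i) * \<alpha> i h))" if b: "\<beta> \<in> roots L H" for \<beta>
  proof -
    obtain r c where rc: "\<beta> = diff_root H r c" "{int (min r c) + 1..int (max r c)} \<subseteq> I"
      using b chain unfolding roots_L by fastforce
    let ?J = "{int (min r c) + 1..int (max r c)}"
    have s: "(\<Sum>i\<in>I. of_nat (of_bool (i \<in> ?J)) * \<alpha> i h) =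
        h $$ (min r c, min r c) - h $$ (max r c, max r c)" if h: "h \<in> H" for h
    proof -
      have "(\<Sum>i\<in>I. of_nat (of_bool (i \<in> ?J)) * \<alpha> i h) = (\<Sum>i\<in>?J. \<alpha> i h)"
        using rc(2) I(1) by (intro sum.mono_neutral_cong_right) auto
      also have "\<dots> = (\<Sum>k\<in>?J. h $$ (nat (k - 1), nat (k - 1)) - h $$ (nat k, nat k))"
        using rc(2) h by (intro sum.cong refl \<alpha>) auto
      also have "?J = {int (min r c) + 1..int (min r c) + int (max r c - min r c)}" by auto
      finally show ?thesis
        unfolding sum_telescope_int[of "\<lambda>k. h $$ (k, k)" "min r c" "max r c - min r c"] by simp
    qed
    show ?thesis
      using s rc(1) by (intro exI[of _ "\<lambda>i. of_bool (i \<in> ?J)"])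
        (cases "r \<le> c"; simp add: diff_root_def min_def max_def)
  qed
  moreover have "\<alpha> ` I \<subseteq> roots L H" unfolding roots_L using simple by force
  ultimately show ?thesis unfolding root_base_def using I(1) by blast
qed

end

subsection \<open>The block diagonal algebra\<close>

context blocks begin

text \<open>Subtracting the mean makes a diagonal matrix traceless without changing the differences
  of its entries. All separating elements and coweights are obtained this way.\<close>

definition centred :: "(nat \<Rightarrow> complex) \<Rightarrow> complex mat" where
  "centred f = mat N N (\<lambda>(r, c). if r = c then f r - (\<Sum>i<N. f i) / of_nat N else 0)"

lemma centred_diag_cartan: "centred f \<in> diag_cartan N"
  using N_pos(1) by (auto simp: diag_cartan_def centred_def diagonal_mat_def mtrace_def sum_subtractf)

lemma centred_diff: "r < N \<Longrightarrow> c < N \<Longrightarrow> centred f $$ (r, r) - centred f $$ (c, c) = f r - f c"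
  by (simp add: centred_def)

lemma sum_mod_blocks: "(\<Sum>r<N. f (r mod p)) = of_nat l * (\<Sum>i<p. f i)" for f :: "nat \<Rightarrow> complex"
  by (simp add: sum_blocks)

lemma centred_mod_Hd: "centred (\<lambda>r. f (r mod p)) \<in> Hd"
proof -
  have "(int c - int r) mod int N = 0 \<longleftrightarrow> r = c" if "r < N" "c < N" for r c
    using mod_eq_iff_close[of "int c - int r" 0 "int N"] that by auto
  then have "centred (\<lambda>r. f (r mod p)) \<in> circ N p"
    by (intro circI[where f = "\<lambda>r d. if d = 0 then f r - (\<Sum>i<N. f (i mod p)) / of_nat N else 0"])
      (auto simp: centred_def)
  then show ?thesis using centred_diag_cartan by (auto simp: Hd_def diag_cartan_def)
qed

definition same_block :: "(nat \<times> nat) set" where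
  "same_block = {(r, c). r < N \<and> c < N \<and> r \<noteq> c \<and> r div p = c div p}"

definition unit_mat :: "nat \<Rightarrow> nat \<Rightarrow> complex mat" where
  "unit_mat r c = mat N N (\<lambda>(i, j). if i = r \<and> j = c then 1 else 0)"

lemma bracket_Eb_Hd:
  assumes h: "h \<in> Hd" and i: "i < p" "c < p"
  shows "h * Eb i c - Eb i c * h = (h $$ (i, i) - h $$ (c, c)) \<cdot>\<^sub>m Eb i c"
proof (rule circ_eqI)
  have hc: "h \<in> circ N p" "h \<in> carrier_mat N N" "diagonal_mat h" using h by (auto simp: Hd_def)
  show "h * Eb i c - Eb i c * h \<in> circ N p" "(h $$ (i, i) - h $$ (c, c)) \<cdot>\<^sub>m Eb i c \<in> circ N p"
    using hc i by (auto intro!: circ_closed Eb_circ)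
  fix r j assume r: "r < p" "j < N"
  then show "(h * Eb i c - Eb i c * h) $$ (r, j) = ((h $$ (i, i) - h $$ (c, c)) \<cdot>\<^sub>m Eb i c) $$ (r, j)"
    using i N_pos(2) diagonal_bracket[OF hc(2,3) Eb_carrier, of r j i c] carrier_matD[OF Eb_carrier[of i c]]
    by (simp add: Eb_entry_row0)
qed

text \<open>Here the diagonal is unrestricted up to trace: centred indicators of single positions
  separate the indices, and matrix units are the root vectors.\<close>

sublocale kept: diagonal_roots N "blk N p \<inter> carrier (sl_lie N)" "diag_cartan N" same_block
proof
  show "diag_cartan N = {X \<in> blk N p \<inter> carrier (sl_lie N). diagonal_mat X}"
  proof (intro equalityI subsetI)
    fix X assume X: "X \<in> diag_cartan N"
    then have c: "X \<in> carrier_mat N N" "diagonal_mat X" by (auto simp: diag_cartan_def)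
    have "X $$ (r, c) = 0" if "r < N" "c < N" "r div p \<noteq> c div p" for r c
    proof -
      have "r \<noteq> c" using that(3) by blast
      then show ?thesis using c that by (simp add: diagonal_mat_def)
    qed
    then show "X \<in> {X \<in> blk N p \<inter> carrier (sl_lie N). diagonal_mat X}"
      using X c by (simp add: blk_def diag_cartan_def)
  qed (auto simp: diag_cartan_def)
  fix r c assume rc: "(r, c) \<in> same_block"
  show "\<exists>h\<in>diag_cartan N. h $$ (r, r) \<noteq> h $$ (c, c)"
  proof (rule bexI[OF _ centred_diag_cartan[of "\<lambda>i. of_bool (i = r)"]])
    have "centred (\<lambda>i. of_bool (i = r)) $$ (r, r) - centred (\<lambda>i. of_bool (i = r)) $$ (c, c) = 1"
      using rc by (subst centred_diff) (auto simp: same_block_def)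
    then show "centred (\<lambda>i. of_bool (i = r)) $$ (r, r) \<noteq> centred (\<lambda>i. of_bool (i = r)) $$ (c, c)" by auto
  qed
  have u: "unit_mat r c \<in> carrier_mat N N" by (simp add: unit_mat_def)
  have "unit_mat r c \<in> blk N p \<inter> carrier (sl_lie N)"
    using rc by (auto simp: unit_mat_def same_block_def blk_def mtrace_def)
  moreover have "unit_mat r c \<noteq> 0\<^sub>m N N"
  proof
    assume "unit_mat r c = 0\<^sub>m N N"
    then have "unit_mat r c $$ (r, c) = 0\<^sub>m N N $$ (r, c)" by simp
    then show False using rc by (simp add: unit_mat_def same_block_def)
  qed
  moreover have "h * unit_mat r c - unit_mat r c * h = (h $$ (r, r) - h $$ (c, c)) \<cdot>\<^sub>m unit_mat r c"
    if h: "h \<in> diag_cartan N" for h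
  proof (rule eq_matI)
    have hc: "h \<in> carrier_mat N N" "diagonal_mat h" using h by (auto simp: diag_cartan_def)
    fix i j assume "i < dim_row ((h $$ (r, r) - h $$ (c, c)) \<cdot>\<^sub>m unit_mat r c)"
      "j < dim_col ((h $$ (r, r) - h $$ (c, c)) \<cdot>\<^sub>m unit_mat r c)"
    then have ij: "i < N" "j < N" using u by auto
    show "(h * unit_mat r c - unit_mat r c * h) $$ (i, j) = ((h $$ (r, r) - h $$ (c, c)) \<cdot>\<^sub>m unit_mat r c) $$ (i, j)"
      unfolding diagonal_bracket[OF hc u ij] using ij by (simp add: unit_mat_def)
  qed (use h u in \<open>auto simp: diag_cartan_def\<close>)
  ultimately show "\<exists>X\<in>blk N p \<inter> carrier (sl_lie N). X \<noteq> 0\<^sub>m N N \<and>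
      (\<forall>h\<in>diag_cartan N. h * X - X * h = (h $$ (r, r) - h $$ (c, c)) \<cdot>\<^sub>m X)" by blast
qed (use lie_subalgebra_blk in blast, auto simp: same_block_def blk_def)

lemma Hd_entry_mod: "h \<in> Hd \<Longrightarrow> r < N \<Longrightarrow> h $$ (r, r) = h $$ (r mod p, r mod p)"
  using circ_shift[of h "r div p" "r mod p" "r mod p"] block_index[of r] by (simp add: Hd_def)

lemma diff_root_mod: "(r, c) \<in> same_block \<Longrightarrow>
    diff_root Hd r c = diff_root Hd (r mod p) (c mod p) \<and> r mod p \<noteq> c mod p \<and> r mod p < p \<and> c mod p < p"
proof -
  assume rc: "(r, c) \<in> same_block"
  then have "r mod p \<noteq> c mod p"
    by (auto simp: same_block_def) (metis div_mult_mod_eq)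
  then show ?thesis using rc p by (auto simp: same_block_def diff_root_def Hd_entry_mod[of _ r] Hd_entry_mod[of _ c])
qed

text \<open>Elements of \<open>Hd\<close> repeat from block to block and see only residues modulo
  \<open>p\<close>. The indicator is therefore that of a residue, and the root vector for a pair in
  any block is the \<open>Eb\<close> of the two residues.\<close>

sublocale slp: diagonal_roots N g0b Hd same_block
proof
  show "Hd = {X \<in> g0b. diagonal_mat X}" using Hd_blk by (auto simp: Hd_def)
  fix r c assume rc: "(r, c) \<in> same_block"
  note d = diff_root_mod[OF rc]
  show "\<exists>h\<in>Hd. h $$ (r, r) \<noteq> h $$ (c, c)"
  proof (rule bexI[OF _ centred_mod_Hd[of "\<lambda>i. of_bool (i = r mod p)"]])
    let ?h = "centred (\<lambda>i. of_bool (i mod p = r mod p))"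
    have "?h $$ (r, r) - ?h $$ (c, c) = 1"
      using rc d by (subst centred_diff) (auto simp: same_block_def)
    then show "?h $$ (r, r) \<noteq> ?h $$ (c, c)" by auto
  qed
  have "Eb (r mod p) (c mod p) \<noteq> 0\<^sub>m N N"
  proof
    assume "Eb (r mod p) (c mod p) = 0\<^sub>m N N"
    then have "Eb (r mod p) (c mod p) $$ (r mod p, c mod p) = 0\<^sub>m N N $$ (r mod p, c mod p)" by simp
    then show False using d N_pos(2) by (simp add: Eb_entry_row0)
  qed
  moreover have "h * Eb (r mod p) (c mod p) - Eb (r mod p) (c mod p) * h =
      (h $$ (r, r) - h $$ (c, c)) \<cdot>\<^sub>m Eb (r mod p) (c mod p)" if "h \<in> Hd" for h
    using bracket_Eb_Hd[OF that, of "r mod p" "c mod p"] Hd_entry_mod[OF that] rc d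
    by (simp add: same_block_def)
  ultimately show "\<exists>X\<in>g0b. X \<noteq> 0\<^sub>m N N \<and> (\<forall>h\<in>Hd. h * X - X * h = (h $$ (r, r) - h $$ (c, c)) \<cdot>\<^sub>m X)"
    using Eb_g0b[of "r mod p" "c mod p"] d by blast
qed (use lie_subalgebra_circ_blk in blast, auto simp: same_block_def blk_def)

section \<open>Roots and Chevalley basis of the embedded sl(p)\<close>

lemma pairing_commute: "u \<in> carrier_mat N N \<Longrightarrow> v \<in> carrier_mat N N \<Longrightarrow> pairing u v = pairing v u"
  by (simp add: pairing_def mult.commute)

text \<open>Every entry of \<open>h\<close> occurs \<open>l\<close> times along the diagonal; the
  factor \<open>1 / l\<close> in the roots compensates for this repetition.\<close>

lemma pairing_et_diff:
  assumes i: "1 \<le> i" "i \<le> int p" "1 \<le> j" "j \<le> int p" and h: "h \<in> Hd"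
  shows "pairing ((1 / of_nat l) \<cdot>\<^sub>m (et N p l i - et N p l j)) h =
    h $$ (nat (i - 1), nat (i - 1)) - h $$ (nat (j - 1), nat (j - 1))"
proof -
  have "pairing ((1 / of_nat l) \<cdot>\<^sub>m (et N p l i - et N p l j)) h = (\<Sum>r<N. (\<lambda>x. (1 / of_nat l) *
      ((if x = nat (i - 1) then h $$ (x, x) else 0) - (if x = nat (j - 1) then h $$ (x, x) else 0))) (r mod p))"
    unfolding pairing_def
  proof (intro sum.cong)
    show "{..<dim_row ((1 / complex_of_nat l) \<cdot>\<^sub>m (et N p l i - et N p l j))} = {..<N}"
      using carrier_matD[OF et_carrier[of j]] by simp
    fix r assume "r \<in> {..<N}"
    then have r: "r < N" by simp
    have e: "int (r mod p) = i - 1 \<longleftrightarrow> r mod p = nat (i - 1)" "int (r mod p) = j - 1 \<longleftrightarrow> r mod p = nat (j - 1)"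
      using i by auto
    show "((1 / complex_of_nat l) \<cdot>\<^sub>m (et N p l i - et N p l j)) $$ (r, r) * h $$ (r, r) =
      (\<lambda>x. (1 / of_nat l) * ((if x = nat (i - 1) then h $$ (x, x) else 0) - (if x = nat (j - 1) then h $$ (x, x) else 0))) (r mod p)"
      using r Hd_entry_mod[OF h r] carrier_matD[OF et_carrier[of i]] carrier_matD[OF et_carrier[of j]] i e
      by (auto simp: et_entry simp del: int_nat_eq)
  qed
  also have "\<dots> = of_nat l * (\<Sum>x<p. (1 / of_nat l) *
      ((if x = nat (i - 1) then h $$ (x, x) else 0) - (if x = nat (j - 1) then h $$ (x, x) else 0)))"
    by (rule sum_mod_blocks)
  also have "\<dots> = h $$ (nat (i - 1), nat (i - 1)) - h $$ (nat (j - 1), nat (j - 1))"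
    using l i unfolding sum_distrib_left[symmetric] sum_subtractf by (simp add: nat_less_iff)
  finally show ?thesis .
qed

text \<open>By symmetry of the pairing this is the value of a simple root at a coroot, to which
  \<open>pairing_et_diff\<close> applies.\<close>

lemma pairing_coroot_root:
  assumes "j \<in> {1..int p - 1}" "k \<in> {1..int p - 1}"
  shows "pairing (coroot_t N p l j) (root_t N p l k) = cartan_A j k"
proof -
  have "root_t N p l k \<in> carrier_mat N N" using carrier_matD[OF et_carrier[of "k + 1"]] unfolding root_t_def by auto
  then have "pairing (coroot_t N p l j) (root_t N p l k) = pairing (root_t N p l k) (coroot_t N p l j)"
    by (intro pairing_commute) auto
  also have "\<dots> = coroot_t N p l j $$ (nat (k - 1), nat (k - 1)) - coroot_t N p l j $$ (nat k, nat k)"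
    unfolding root_t_def using pairing_et_diff[of k "k + 1" "coroot_t N p l j"] assms coroot_Hd[of j] by simp
  also have "\<dots> = cartan_A j k"
  proof -
    have "nat (k - 1) mod p = nat (k - 1)" "nat k mod p = nat k" using assms by auto
    then show ?thesis
      using assms N_pos(2) by (subst (1 2) coroot_entry) (auto simp: cartan_A_def)
  qed
  finally show ?thesis .
qed

abbreviation "rt \<equiv> diff_root Hd"

lemma functional_root_of: "(i, a) \<in> A_ind p \<Longrightarrow> functional Hd (root_of N p l (i, a)) = rt (nat (i - 1)) (nat (i - 1 + a))"
  using pairing_et_diff[of i "i + a"]
  by (auto simp: functional_def diff_root_def root_of_def A_ind_def E_ind_def fun_eq_iff algebra_simps)

lemma functional_root_t: "k \<in> {1..int p - 1} \<Longrightarrow> functional Hd (root_t N p l k) = rt (nat (k - 1)) (nat k)"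
  using pairing_et_diff[of k "k + 1"]
  by (auto simp: functional_def diff_root_def root_t_def fun_eq_iff)

lemma rt_centred: "i < p \<Longrightarrow> c < p \<Longrightarrow> rt i c (centred (\<lambda>r. f (r mod p))) = f i - f c"
  using N_pos(2) by (simp add: diff_root_def centred_mod_Hd centred_diff)

text \<open>Centred indicators of the residues \<open>i\<close> and \<open>c\<close> detect where
  the functional has its positive and its negative part.\<close>

lemma rt_inject:
  assumes "i < p" "c < p" "i' < p" "c' < p" "i \<noteq> c" "rt i c = rt i' c'"
  shows "i = i' \<and> c = c'"
proof -
  have e: "f i - f c = f i' - f c'" for f :: "nat \<Rightarrow> complex"
    using rt_centred[of i c f] rt_centred[of i' c' f] assms by simp
  have "i' = i" using e[of "\<lambda>x. of_bool (x = i)"] assms(5) by (auto simp: of_bool_def split: if_splits)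
  moreover have "c' = c" using e[of "\<lambda>x. of_bool (x = c)"] assms(5) by (auto simp: of_bool_def split: if_splits)
  ultimately show ?thesis by simp
qed

lemma roots_slp: "roots ((sl_lie N)\<lparr>carrier := g0b\<rparr>) Hd = {rt i c | i c. i < p \<and> c < p \<and> i \<noteq> c}"
proof -
  have "(i, c) \<in> same_block" if "i < p" "c < p" "i \<noteq> c" for i c
    using that N_pos(2) by (auto simp: same_block_def)
  then have "{rt i c | i c. i < p \<and> c < p \<and> i \<noteq> c} \<subseteq> (\<lambda>(r, c). rt r c) ` same_block" by force
  moreover have "rt r c \<in> {rt i c | i c. i < p \<and> c < p \<and> i \<noteq> c}" if "(r, c) \<in> same_block" for r c
    using diff_root_mod[OF that] by blast
  ultimately show ?thesis unfolding slp.roots_L by auto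
qed

lemma rt_A_ind: "i < p \<Longrightarrow> c < p \<Longrightarrow> i \<noteq> c \<Longrightarrow> (int i + 1, int c - int i) \<in> A_ind p \<and>
    functional Hd (root_of N p l (int i + 1, int c - int i)) = rt i c"
proof -
  assume "i < p" "c < p" "i \<noteq> c"
  then have "(int i + 1, int c - int i) \<in> A_ind p" by (auto simp: A_ind_def E_ind_def)
  then show ?thesis using functional_root_of[of "int i + 1" "int c - int i"] by simp
qed

lemma bij_betw_roots: "bij_betw (\<lambda>ia. functional Hd (root_of N p l ia)) (A_ind p)
    (roots ((sl_lie N)\<lparr>carrier := g0b\<rparr>) Hd)"
proof (rule bij_betwI')
  fix x y assume xy: "x \<in> A_ind p" "y \<in> A_ind p"
  obtain i a where x: "x = (i, a)" by fastforce
  obtain j b where y: "y = (j, b)" by fastforce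
  show "functional Hd (root_of N p l x) = functional Hd (root_of N p l y) \<longleftrightarrow> x = y"
  proof
    assume "functional Hd (root_of N p l x) = functional Hd (root_of N p l y)"
    then have "rt (nat (i - 1)) (nat (i - 1 + a)) = rt (nat (j - 1)) (nat (j - 1 + b))"
      using xy x y functional_root_of by metis
    then have "nat (i - 1) = nat (j - 1) \<and> nat (i - 1 + a) = nat (j - 1 + b)"
      using xy E_t_A_ind(2-4)[of i a] E_t_A_ind(2-4)[of j b] unfolding x y by (intro rt_inject) auto
    then show "x = y" using xy by (auto simp: x y A_ind_def E_ind_def)
  qed simp
next
  fix x assume x: "x \<in> A_ind p"
  then show "functional Hd (root_of N p l x) \<in> roots ((sl_lie N)\<lparr>carrier := g0b\<rparr>) Hd"
  proof (cases x)
    case (Pair i a)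
    have A: "(i, a) \<in> A_ind p" using x Pair by simp
    show ?thesis
      unfolding roots_slp Pair functional_root_of[OF A] using E_t_A_ind(2-4)[OF A] by blast
  qed
next
  fix \<beta> assume "\<beta> \<in> roots ((sl_lie N)\<lparr>carrier := g0b\<rparr>) Hd"
  then obtain i c where "i < p" "c < p" "i \<noteq> c" "\<beta> = rt i c" unfolding roots_slp by blast
  then show "\<exists>x\<in>A_ind p. \<beta> = functional Hd (root_of N p l x)"
    using rt_A_ind[of i c] by (intro bexI[of _ "(int i + 1, int c - int i)"]) simp_all
qed

lemma rt_neg: "root_neg Hd (rt i c) = rt c i"
  by (auto simp: root_neg_def diff_root_def fun_eq_iff)

lemma rt_plus: "root_plus Hd (rt i c) (rt c d) = rt i d" "root_plus Hd (rt c d) (rt i c) = rt i d"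
  by (auto simp: root_plus_def diff_root_def fun_eq_iff)

lemma rt_diag: "rt i i \<notin> roots ((sl_lie N)\<lparr>carrier := g0b\<rparr>) Hd"
  by (auto simp: roots_def diff_root_def)

lemma coroot_Eb: "k \<in> {1..int p - 1} \<Longrightarrow>
    coroot_t N p l k = Eb (nat (k - 1)) (nat (k - 1)) - Eb (nat k) (nat k)"
  using N_pos(2) by (simp add: coroot_t_def et_eq E_t_Eb)

lemma root_base_slp: "root_base ((sl_lie N)\<lparr>carrier := g0b\<rparr>) Hd {1..int p - 1}
    (\<lambda>k. functional Hd (root_t N p l k))"
proof (rule slp.root_base_L)
  fix k assume k: "k \<in> {1..int p - 1}"
  then show "(nat (k - 1), nat k) \<in> same_block \<and> functional Hd (root_t N p l k) = rt (nat (k - 1)) (nat k)"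
    using functional_root_t N_pos(2) by (auto simp: same_block_def)
  show "\<exists>h\<in>Hd. \<forall>j\<in>{1..int p - 1}. h $$ (nat (j - 1), nat (j - 1)) - h $$ (nat j, nat j) = (if j = k then 1 else 0)"
  \<comment> \<open>The fundamental coweight: the indicator of the first \<open>k\<close> positions
    of each block drops by 1 exactly between the positions \<open>k - 1\<close> and
    \<open>k\<close>.\<close>
  proof (rule bexI[OF _ centred_mod_Hd[of "\<lambda>i. of_bool (i < nat k)"]], rule ballI)
    fix j assume j: "j \<in> {1..int p - 1}"
    then have "nat (j - 1) < p" "nat j < p" "nat (j - 1) < N" "nat j < N" using N_pos(2) by auto
    then show "centred (\<lambda>r. of_bool (r mod p < nat k)) $$ (nat (j - 1), nat (j - 1)) -
        centred (\<lambda>r. of_bool (r mod p < nat k)) $$ (nat j, nat j) = (if j = k then 1 else 0)"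
      using j k by (subst centred_diff) auto
  qed
next
  fix r c assume "(r, c) \<in> same_block"
  note d = diff_root_mod[OF this]
  then show "\<exists>r' c'. rt r c = rt r' c' \<and> {int (min r' c') + 1..int (max r' c')} \<subseteq> {1..int p - 1}"
    by (intro exI[of _ "r mod p"] exI[of _ "c mod p"]) auto
qed auto

text \<open>The root vectors multiply like the matrix units of gl(p), so the structure constants are
  1, -1 and 0, and passing to the negative roots transposes all of them, which reverses the sign.
  Values of \<open>x\<close> outside the roots are left free.\<close>

lemma chevalley_basis_slp:
  assumes x: "\<And>i c. i < p \<Longrightarrow> c < p \<Longrightarrow> i \<noteq> c \<Longrightarrow> x (rt i c) = Eb i c"
  shows "chevalley_basis ((sl_lie N)\<lparr>carrier := g0b\<rparr>) Hd {1..int p - 1}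
    (\<lambda>k. functional Hd (root_t N p l k)) (coroot_t N p l) x"
proof -
  let ?L = "(sl_lie N)\<lparr>carrier := g0b\<rparr>" and ?I = "{1..int p - 1}"
  have rootE: "\<exists>i c. i < p \<and> c < p \<and> i \<noteq> c \<and> \<beta> = rt i c" if "\<beta> \<in> roots ?L Hd" for \<beta>
    using that unfolding roots_slp by auto
  have rootI: "rt i c \<in> roots ?L Hd" if "i < p" "c < p" "i \<noteq> c" for i c
    using that unfolding roots_slp by auto
  have mult: "Eb i j * Eb k c = (if j = k then Eb i c else 0\<^sub>m N N)" if "i < p" "j < p" "k < p" "c < p" for i j k c
    using Eb_mult_block[of i j k c] that N_pos(2) by simp
  have minus0: "Eb i c - 0\<^sub>m N N = Eb i c" "0\<^sub>m N N - Eb i c = (- 1) \<cdot>\<^sub>m Eb i c" "0\<^sub>m N N - 0\<^sub>m N N = 0 \<cdot>\<^sub>m Eb i c"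
    for i c using carrier_matD[OF Eb_carrier[of i c]] by (auto intro!: eq_matI)
  have weight: "x \<beta> \<in> weight_space ?L Hd \<beta>" if b: "\<beta> \<in> roots ?L Hd" for \<beta>
  proof -
    obtain i c where ic: "i < p" "c < p" "i \<noteq> c" "\<beta> = rt i c" using rootE[OF b] by auto
    have "h * Eb i c - Eb i c * h = rt i c h \<cdot>\<^sub>m Eb i c" if "h \<in> Hd" for h
      using bracket_Eb_Hd[OF that ic(1,2)] that by (simp add: diff_root_def)
    then show ?thesis using Eb_g0b[OF ic(1-3)] x[OF ic(1-3)] ic(4) by (auto simp: weight_space_def)
  qed
  have coroot: "x (rt i c) * x (rt c i) - x (rt c i) * x (rt i c) = Eb i i - Eb c c"
    if "i < p" "c < p" "i \<noteq> c" for i c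
    using that by (simp add: x mult)
  have Hdd: "Eb i i - Eb c c \<in> Hd" if ic: "i < p" "c < p" "i \<noteq> c" for i c
  proof -
    have C: "Eb i i - Eb c c \<in> circ N p" using ic by (intro circ_closed Eb_circ)
    have "(\<Sum>k<p. (Eb i i - Eb c c) $$ (k, k)) = (\<Sum>k<p. (if k = i then 1 else 0) - (if k = c then 1 else 0))"
      using ic N_pos(2) carrier_matD[OF Eb_carrier[of c c]] by (intro sum.cong refl) (simp add: Eb_entry_row0)
    then have t: "mtrace (Eb i i - Eb c c) = 0" using ic unfolding mtrace_circ[OF C] by (simp add: sum_subtractf)
    have et: "Eb i i = et N p l (int i + 1)" "Eb c c = et N p l (int c + 1)"
      by (simp_all add: Eb_def et_eq)
    have "diagonal_mat (Eb i i - Eb c c)"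
      unfolding et diagonal_mat_def using ic carrier_matD[OF et_carrier[of "int c + 1"]]
      by (auto simp: et_entry)
    then show ?thesis using C t by (simp add: Hd_def minus_carrier_mat)
  qed
  have neg: "root_neg Hd \<beta> \<in> roots ?L Hd \<and> x \<beta> \<otimes>\<^bsub>?L\<^esub> x (root_neg Hd \<beta>) \<in> Hd \<and>
      \<beta> (x \<beta> \<otimes>\<^bsub>?L\<^esub> x (root_neg Hd \<beta>)) = 2" if b: "\<beta> \<in> roots ?L Hd" for \<beta>
  proof -
    obtain i c where ic: "i < p" "c < p" "i \<noteq> c" "\<beta> = rt i c" using rootE[OF b] by auto
    have "rt i c (Eb i i - Eb c c) = 2"
      using Hdd[OF ic(1-3)] ic N_pos(2) carrier_matD[OF Eb_carrier[of c c]]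
      by (simp add: diff_root_def Eb_entry_row0)
    then show ?thesis using ic coroot[OF ic(1-3)] rootI[of c i] Hdd[OF ic(1-3)] by (simp add: rt_neg)
  qed
  have simple: "coroot_t N p l k = x (functional Hd (root_t N p l k)) \<otimes>\<^bsub>?L\<^esub>
      x (root_neg Hd (functional Hd (root_t N p l k)))" if k: "k \<in> ?I" for k
  proof -
    have "nat (k - 1) < p" "nat k < p" "nat (k - 1) \<noteq> nat k" using k by auto
    from coroot[OF this] show ?thesis by (simp add: functional_root_t[OF k] rt_neg coroot_Eb[OF k])
  qed
  have const: "\<exists>c. x \<beta> \<otimes>\<^bsub>?L\<^esub> x \<gamma> = c \<odot>\<^bsub>?L\<^esub> x (root_plus Hd \<beta> \<gamma>) \<and>
      x (root_neg Hd \<beta>) \<otimes>\<^bsub>?L\<^esub> x (root_neg Hd \<gamma>) = (- c) \<odot>\<^bsub>?L\<^esub> x (root_neg Hd (root_plus Hd \<beta> \<gamma>))"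
    if bg: "\<beta> \<in> roots ?L Hd" "\<gamma> \<in> roots ?L Hd" "root_plus Hd \<beta> \<gamma> \<in> roots ?L Hd" for \<beta> \<gamma>
  proof -
    obtain i c where ic: "i < p" "c < p" "i \<noteq> c" "\<beta> = rt i c" using rootE[OF bg(1)] by auto
    obtain j d where jd: "j < p" "d < p" "j \<noteq> d" "\<gamma> = rt j d" using rootE[OF bg(2)] by auto
    obtain u v where uv: "u < p" "v < p" "u \<noteq> v" "root_plus Hd \<beta> \<gamma> = rt u v" using rootE[OF bg(3)] by auto
    \<comment> \<open>Otherwise the two roots would be opposite, and their sum, the zero functional,
      is not a root.\<close>
    have nd: "\<not> (c = j \<and> d = i)" using bg(3) rt_diag by (auto simp: ic jd rt_plus)
    \<comment> \<open>In the third case both brackets vanish, so the form of \<open>\<beta> + \<gamma>\<close> does not matter.\<close>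
    consider "c = j" "d \<noteq> i" | "c \<noteq> j" "d = i" | "c \<noteq> j" "d \<noteq> i" using nd by blast
    then show ?thesis
    proof cases
      case 1
      then show ?thesis using ic jd
        by (intro exI[of _ 1]) (auto simp: x mult rt_neg rt_plus minus0)
    next
      case 2
      then show ?thesis using ic jd
        by (intro exI[of _ "- 1"]) (auto simp: x mult rt_neg rt_plus minus0)
    next
      case 3
      have "0 \<cdot>\<^sub>m Eb u v = 0\<^sub>m N N - 0\<^sub>m N N" "0 \<cdot>\<^sub>m Eb v u = 0\<^sub>m N N - 0\<^sub>m N N"
        using minus0(3) by simp_all
      then show ?thesis using 3 ic jd uv(1-3) unfolding uv(4)
        by (intro exI[of _ 0]) (simp add: x mult rt_neg)
    qed
  qed
  have Eb_inj: "i = i' \<and> c = c'" if "Eb i c = Eb i' c'" "i < p" "c < N" "i' < p" "c' < N" for i c i' c'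
    using that Eb_entry_row0[of i c i c] Eb_entry_row0[of i' c' i c] by (metis zero_neq_one)
  have inj_x: "inj_on x (roots ?L Hd)"
  proof (rule inj_onI)
    fix \<beta> \<gamma> assume "\<beta> \<in> roots ?L Hd" "\<gamma> \<in> roots ?L Hd" and e: "x \<beta> = x \<gamma>"
    then obtain i c j d where "i < p" "c < p" "i \<noteq> c" "\<beta> = rt i c" "j < p" "d < p" "j \<noteq> d" "\<gamma> = rt j d"
      using rootE by metis
    then show "\<beta> = \<gamma>" using e Eb_inj[of i c j d] N_pos(2) by (auto simp: x)
  qed
  \<comment> \<open>Partial traces of the first block: the fundamental weights, dual to the coroots
    and zero on the root vectors. The root vectors themselves are separated by their entry in the
    first block.\<close>
  define s where "s k X = (\<Sum>i<nat k. X $$ (i, i))" for k :: int and X :: "complex mat"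
  have s_coroot: "s j (coroot_t N p l k) = (if j = k then 1 else 0)" if jk: "j \<in> ?I" "k \<in> ?I" for j k
  proof -
    have "s j (coroot_t N p l k) = (\<Sum>i<nat j. (if i = nat (k - 1) then 1 else 0) - (if i = nat k then 1 else 0))"
      unfolding s_def using jk N_pos(2) by (intro sum.cong refl) (auto simp: coroot_entry)
    then show ?thesis using jk by (auto simp: sum_subtractf)
  qed
  have inj_h: "inj_on (coroot_t N p l) ?I"
    using s_coroot by (intro inj_onI) (metis zero_neq_one)
  have vecE: "\<exists>i c. i < p \<and> c < p \<and> i \<noteq> c \<and> v = Eb i c" if v: "v \<in> x ` roots ?L Hd" for v
  proof -
    obtain \<beta> where "\<beta> \<in> roots ?L Hd" "v = x \<beta>" using v by blast
    then show ?thesis using rootE[of \<beta>] x by auto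
  qed
  have x_roots: "x ` roots ?L Hd = E_t N p l ` A_ind p"
  proof (intro equalityI subsetI)
    fix y assume "y \<in> x ` roots ?L Hd"
    then show "y \<in> E_t N p l ` A_ind p" using vecE[of y] Eb_A_ind by auto
  next
    fix y assume "y \<in> E_t N p l ` A_ind p"
    then obtain i a where ia: "(i, a) \<in> A_ind p" "y = E_t N p l (i, a)" by auto
    note A = E_t_A_ind[OF ia(1)]
    have "y = x (rt (nat (i - 1)) (nat (i - 1 + a)))" unfolding ia(2) A(1) x[OF A(2-4)] ..
    then show "y \<in> x ` roots ?L Hd" using rootI[OF A(2-4)] by blast
  qed
  let ?S = "coroot_t N p l ` ?I \<union> x ` roots ?L Hd"
  have S: "?S \<subseteq> g0b" unfolding x_roots by (rule generators_g0b)
  have "\<not> lindep ?L ?S"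
  proof (rule not_lindepI[OF slp.lie_algebra_L])
    fix v assume "v \<in> ?S"
    then consider k where "k \<in> ?I" "v = coroot_t N p l k" | i c where "i < p" "c < p" "i \<noteq> c" "v = Eb i c"
      using vecE[of v] by blast
    then show "\<exists>f. (\<forall>x\<in>carrier ?L. \<forall>y\<in>carrier ?L. f (x \<oplus>\<^bsub>?L\<^esub> y) = f x + f y) \<and>
      (\<forall>c. \<forall>x\<in>carrier ?L. f (c \<odot>\<^bsub>?L\<^esub> x) = c * f x) \<and> f v \<noteq> (0 :: complex) \<and> (\<forall>w\<in>?S - {v}. f w = 0)"
    proof cases
      case 1
      have lin: "s k (X + Y) = s k X + s k Y" "s k (c \<cdot>\<^sub>m X) = c * s k X"
        if "X \<in> carrier_mat N N" "Y \<in> carrier_mat N N" for X Y c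
        using 1(1) that N_pos(2) by (auto simp: s_def sum.distrib sum_distrib_left)
      have "s k w = 0" if w: "w \<in> ?S - {v}" for w
      proof (cases "w \<in> coroot_t N p l ` ?I")
        case True
        then show ?thesis using s_coroot 1 w by auto
      next
        case False
        then obtain i c where "i < p" "c < p" "i \<noteq> c" "w = Eb i c" using w vecE[of w] by blast
        then show ?thesis using 1(1) N_pos(2) by (auto simp: s_def Eb_entry_row0)
      qed
      moreover have "s k v \<noteq> 0" using s_coroot[OF 1(1) 1(1)] 1(2) by simp
      moreover have "s k (X \<oplus>\<^bsub>?L\<^esub> Y) = s k X + s k Y" if "X \<in> carrier ?L" "Y \<in> carrier ?L" for X Y
        using lin(1)[of X Y] that by simp
      moreover have "s k (a \<odot>\<^bsub>?L\<^esub> X) = a * s k X" if "X \<in> carrier ?L" for X a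
        using lin(2)[of X X a] that by simp
      ultimately show ?thesis by blast
    next
      case 2
      have "w $$ (i, c) = 0" if w: "w \<in> ?S - {v}" for w
      proof (cases "w \<in> coroot_t N p l ` ?I")
        case True
        then show ?thesis using 2 N_pos(2) by (auto simp: coroot_entry)
      next
        case False
        then obtain j d where "j < p" "d < p" "j \<noteq> d" "w = Eb j d" using w vecE[of w] by blast
        then show ?thesis using 2 w N_pos(2) by (auto simp: Eb_entry_row0)
      qed
      moreover have "v $$ (i, c) = 1" using 2 N_pos(2) by (simp add: Eb_entry_row0)
      moreover have icN: "i < N" "c < N" using 2 N_pos(2) by auto
      moreover have "(X \<oplus>\<^bsub>?L\<^esub> Y) $$ (i, c) = X $$ (i, c) + Y $$ (i, c)"
        if "X \<in> carrier ?L" "Y \<in> carrier ?L" for X Y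
        using that icN by auto
      moreover have "(a \<odot>\<^bsub>?L\<^esub> X) $$ (i, c) = a * X $$ (i, c)" if "X \<in> carrier ?L" for X a
        using that icN by auto
      ultimately show ?thesis by (intro exI[of _ "\<lambda>X. X $$ (i, c)"]) simp
    qed
  qed (use S in simp)
  moreover have "lspan ?L ?S = g0b"
  proof (rule lspan_eqI[OF slp.lie_algebra_L])
    show "VectorSpace.subspace class_ring g0b ?L"
      using slp.W_closed by (intro subspaceI[OF slp.lie_algebra_L]) simp_all
    fix U assume U: "VectorSpace.subspace class_ring U ?L" "?S \<subseteq> U"
    have "VectorSpace.subspace class_ring U (sl_lie N)"
      using subspaceD[OF U(1)] by (intro subspaceI[OF lie_algebra_sl]) auto
    then show "g0b \<subseteq> U" using g0b_in_subspace U(2) unfolding x_roots by blast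
  qed (rule S)
  ultimately have "lbasis ?L ?S"
    using slp.lie_algebra_L S by (simp add: lie_algebra_def vectorspace.basis_def)
  then show ?thesis
    unfolding chevalley_basis_def
    using slp.cartan_subalgebra_H root_base_slp weight neg simple const inj_h inj_x by blast
qed

text \<open>Chevalley bases are indexed by the roots as functionals, the elements \<open>E_t\<close>
  by pairs; inverting the bijection between the two transfers the indexing.\<close>

lemma chevalley_basis_exists:
  "\<exists>x. (\<forall>ia\<in>A_ind p. x (functional Hd (root_of N p l ia)) = E_t N p l ia) \<and>
    chevalley_basis ((sl_lie N)\<lparr>carrier := g0b\<rparr>) Hd {1..int p - 1}
      (\<lambda>k. functional Hd (root_t N p l k)) (coroot_t N p l) x"
proof -
  define x where "x = (\<lambda>\<beta>. E_t N p l (inv_into (A_ind p) (\<lambda>ia. functional Hd (root_of N p l ia)) \<beta>))"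
  have *: "x (functional Hd (root_of N p l ia)) = E_t N p l ia" if "ia \<in> A_ind p" for ia
    using bij_betw_inv_into_left[OF bij_betw_roots that] by (simp add: x_def)
  have "x (rt i c) = Eb i c" if "i < p" "c < p" "i \<noteq> c" for i c
    using *[of "(int i + 1, int c - int i)"] rt_A_ind[OF that] by (simp add: Eb_def)
  then show ?thesis using * chevalley_basis_slp by blast
qed

end

section \<open>Kac's automorphism\<close>

context blocks begin

lemma kept_iff: "k \<in> kept N p l \<longleftrightarrow> (\<exists>x<N. k = int x \<and> x mod p \<noteq> 0)"
proof
  assume k: "k \<in> kept N p l"
  then have b: "nat k < N" "k = int (nat k)" by (auto simp: kept_def)
  have "nat k mod p \<noteq> 0"
  proof
    assume z: "nat k mod p = 0"
    have "nat k = nat k div p * p + nat k mod p" by simp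
    then have "k = int (nat k div p) * int p" using z b(2) by (metis add.right_neutral of_nat_mult)
    then have "k \<in> dropped p l" using block_index(1)[OF b(1)] by (auto simp: dropped_def)
    then show False using k by (simp add: kept_def)
  qed
  then show "\<exists>x<N. k = int x \<and> x mod p \<noteq> 0" using b by blast
next
  assume "\<exists>x<N. k = int x \<and> x mod p \<noteq> 0"
  then obtain x where x: "x < N" "k = int x" "x mod p \<noteq> 0" by blast
  then show "k \<in> kept N p l" by (auto simp: kept_def dropped_def simp flip: of_nat_mult)
qed

text \<open>The vertex \<open>x\<close> of the diagram joins the diagonal positions
  \<open>x - 1\<close> and \<open>x\<close>. These lie in different blocks exactly when
  \<open>p\<close> divides \<open>x\<close>, which is why the multiples of \<open>p\<close> are
  dropped.\<close>

lemma pred_block: "x mod p \<noteq> 0 \<Longrightarrow> (x - 1) div p = x div p" "x mod p \<noteq> 0 \<Longrightarrow> 0 < x"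
  "0 < x \<Longrightarrow> x mod p = 0 \<Longrightarrow> x div p = Suc ((x - 1) div p)"
proof -
  show "x mod p \<noteq> 0 \<Longrightarrow> (x - 1) div p = x div p" "x mod p \<noteq> 0 \<Longrightarrow> 0 < x"
    by (cases x; simp add: div_Suc mod_Suc split: if_splits)+
  show "0 < x \<Longrightarrow> x mod p = 0 \<Longrightarrow> x div p = Suc ((x - 1) div p)"
    by (cases x) (simp_all add: div_Suc)
qed

lemma e_vec_entry: "1 \<le> k \<Longrightarrow> k \<le> int N \<Longrightarrow> r < N \<Longrightarrow> c < N \<Longrightarrow>
    e_vec N k $$ (r, c) = (if r = nat (k - 1) \<and> c = nat (k - 1) then 1 else 0)"
proof -
  assume k: "1 \<le> k" "k \<le> int N" "r < N" "c < N"
  have "(int x + 1) mod int N = k mod int N \<longleftrightarrow> x = nat (k - 1)" if "x < N" for x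
    using that k by (subst mod_eq_iff_close) auto
  then show ?thesis using k by (simp add: e_vec_def munit_entry)
qed

lemma e_vec_carrier [simp]: "e_vec N k \<in> carrier_mat N N"
  by (simp add: e_vec_def)

lemma ext_root_carrier [simp]: "ext_root N k \<in> carrier_mat N N"
  unfolding ext_root_def by (auto intro!: minus_carrier_mat)

lemma ext_root_entry: "0 < x \<Longrightarrow> x < N \<Longrightarrow> r < N \<Longrightarrow>
    ext_root N (int x) $$ (r, r) = (if r = x - 1 then 1 else 0) - (if r = x then 1 else 0)"
proof -
  assume x: "0 < x" "x < N" "r < N"
  have "nat (int x - 1) = x - 1" by simp
  then show ?thesis
    using x carrier_matD[OF e_vec_carrier[of "int x + 1"]] by (simp add: ext_root_def e_vec_entry)
qed

lemma pairing_ext_root: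
  assumes x: "0 < x" "x < N" and h: "h \<in> carrier_mat N N"
  shows "pairing (ext_root N (int x)) h = h $$ (x - 1, x - 1) - h $$ (x, x)"
proof -
  have "pairing (ext_root N (int x)) h =
      (\<Sum>r<N. (if r = x - 1 then h $$ (r, r) else 0) - (if r = x then h $$ (r, r) else 0))"
    unfolding pairing_def using x carrier_matD[OF ext_root_carrier[of "int x"]]
    by (intro sum.cong) (auto simp: ext_root_entry)
  then show ?thesis using x by (simp add: sum_subtractf)
qed

lemma root_base_kept: "root_base ((sl_lie N)\<lparr>carrier := blk N p \<inter> carrier (sl_lie N)\<rparr>)
    (diag_cartan N) (kept N p l) (\<lambda>k. functional (diag_cartan N) (ext_root N k))"
proof (rule kept.root_base_L)
  show "finite (kept N p l)" by (simp add: kept_def)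
  show "1 \<le> k" if k: "k \<in> kept N p l" for k
  proof -
    obtain x where "k = int x" "x mod p \<noteq> 0" using k unfolding kept_iff by auto
    then show ?thesis using pred_block(2)[of x] by simp
  qed
  fix k assume "k \<in> kept N p l"
  then obtain x where x: "x < N" "k = int x" "x mod p \<noteq> 0" by (auto simp: kept_iff)
  have x0: "0 < x" "(x - 1) div p = x div p" "nat (k - 1) = x - 1" using pred_block x by auto
  have "functional (diag_cartan N) (ext_root N k) = diff_root (diag_cartan N) (x - 1) x"
    using pairing_ext_root[OF x0(1) x(1)] by (auto simp: functional_def diff_root_def x(2) diag_cartan_def)
  then show "(nat (k - 1), nat k) \<in> same_block \<and>
      functional (diag_cartan N) (ext_root N k) = diff_root (diag_cartan N) (nat (k - 1)) (nat k)"
    using x x0 by (auto simp: same_block_def)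
  show "\<exists>h\<in>diag_cartan N. \<forall>j\<in>kept N p l.
      h $$ (nat (j - 1), nat (j - 1)) - h $$ (nat j, nat j) = (if j = k then 1 else 0)"
  \<comment> \<open>The coweight dual to \<open>x\<close> is the indicator of the positions before
    \<open>x\<close> in the block of \<open>x\<close>. Its other jumps occur at block boundaries,
    where no kept vertex sits.\<close>
  proof (rule bexI[OF _ centred_diag_cartan[of "\<lambda>r. of_bool (r div p = x div p \<and> r < x)"]], rule ballI)
    fix j assume "j \<in> kept N p l"
    then obtain y where y: "y < N" "j = int y" "y mod p \<noteq> 0" by (auto simp: kept_iff)
    have y0: "0 < y" "(y - 1) div p = y div p" "nat (j - 1) = y - 1" "y - 1 < N" "nat j = y"
      using pred_block y by auto
    show "centred (\<lambda>r. of_bool (r div p = x div p \<and> r < x)) $$ (nat (j - 1), nat (j - 1)) -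
        centred (\<lambda>r. of_bool (r div p = x div p \<and> r < x)) $$ (nat j, nat j) = (if j = k then 1 else 0)"
      unfolding y0(3,5) centred_diff[OF y0(4) y(1)] y0(2) using x(2) y(2) y0(1) by auto
  qed
next
  fix r c assume rc: "(r, c) \<in> same_block"
  have "{int (min r c) + 1..int (max r c)} \<subseteq> kept N p l"
  proof
    fix k assume k: "k \<in> {int (min r c) + 1..int (max r c)}"
    define x where "x = nat k"
    have x: "k = int x" "min r c < x" "x \<le> max r c" using k by (auto simp: x_def)
    have mm: "max r c div p = min r c div p" using rc by (auto simp: same_block_def max_def min_def)
    \<comment> \<open>A multiple of \<open>p\<close> between the two positions would raise the block
      number, but both positions lie in one block.\<close>
    have "x mod p \<noteq> 0"
    proof
      assume "x mod p = 0"
      then have "x div p = Suc ((x - 1) div p)" using pred_block(3)[of x] x by simp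
      moreover have "min r c div p \<le> (x - 1) div p" using x by (intro div_le_mono) auto
      moreover have "x div p \<le> max r c div p" using x by (intro div_le_mono)
      ultimately show False using mm by simp
    qed
    moreover have "x < N" using x rc by (auto simp: same_block_def)
    ultimately show "k \<in> kept N p l" using x(1) kept_iff by blast
  qed
  then show "\<exists>r' c'. diff_root (diag_cartan N) r c = diff_root (diag_cartan N) r' c' \<and>
      {int (min r' c') + 1..int (max r' c')} \<subseteq> kept N p l" by blast
qed

text \<open>Kept vertices are positive, so the edges that close the extended diagram at vertex 0 do
  not occur. Neighbours \<open>x - 1\<close> and \<open>x\<close> in different blocks would require
  \<open>x\<close> to be a dropped multiple of \<open>p\<close>.\<close>

lemma ext_cartan_kept:
  assumes "x mod p \<noteq> 0" "x < N" "y mod p \<noteq> 0" "y < N"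
  shows "ext_cartan N (int x) (int y) =
    (if x div p = y div p then cartan_A (int (x mod p)) (int (y mod p)) else 0)"
proof -
  have pos: "0 < x" "0 < y" using assms pred_block(2) by auto
  have val: "pairing (ext_root N (int u)) (ext_root N (int v)) =
      (if u = v then 2 else if u = v + 1 \<or> v = u + 1 then -1 else 0)"
    if "0 < u" "u < N" "0 < v" "v < N" for u v
    using that by (subst pairing_ext_root) (auto simp: ext_root_entry)
  have e: "ext_cartan N (int x) (int y) = (if x = y then 2 else if x = y + 1 \<or> y = x + 1 then -1 else 0)"
    using assms pos by (simp add: ext_cartan_def val)
  show ?thesis
  proof (cases "x div p = y div p")
    case True
    define a where "a = x div p * p"
    have xy: "x = a + x mod p" "y = a + y mod p" by (simp add: a_def, simp add: a_def True)
    have "x = y \<longleftrightarrow> x mod p = y mod p" "x = y + 1 \<longleftrightarrow> x mod p = y mod p + 1" "y = x + 1 \<longleftrightarrow> y mod p = x mod p + 1"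
      using xy by linarith+
    then show ?thesis unfolding e using True by (auto simp: cartan_A_def)
  next
    case False
    have "x \<noteq> y + 1" "y \<noteq> x + 1" "x \<noteq> y"
      using False pred_block(1)[OF assms(1)] pred_block(1)[OF assms(3)] by auto
    then show ?thesis unfolding e using False by simp
  qed
qed

text \<open>Division by \<open>p\<close> yields the component as quotient and the vertex of A_{p-1}
  as remainder; remainder 0 belongs to the dropped vertices.\<close>

lemma kept_diagram: "\<exists>f. bij_betw f (kept N p l) ({..<l} \<times> {1..int p - 1}) \<and>
  (\<forall>j\<in>kept N p l. \<forall>k\<in>kept N p l. ext_cartan N j k =
    (if fst (f j) = fst (f k) then cartan_A (snd (f j)) (snd (f k)) else 0))"
proof (intro exI conjI ballI)
  let ?f = "\<lambda>k. (nat k div p, int (nat k mod p))"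
  show "bij_betw ?f (kept N p l) ({..<l} \<times> {1..int p - 1})"
  proof (rule bij_betw_byWitness[where f' = "\<lambda>(m, i). int (m * p) + i"])
    show "\<forall>k\<in>kept N p l. (case ?f k of (m, i) \<Rightarrow> int (m * p) + i) = k"
      by (auto simp: kept_iff simp flip: of_nat_mult of_nat_add)
    show "\<forall>y\<in>{..<l} \<times> {1..int p - 1}. ?f (case y of (m, i) \<Rightarrow> int (m * p) + i) = y"
    proof
      fix y assume "y \<in> {..<l} \<times> {1..int p - 1}"
      then obtain m j where mj: "y = (m, j)" "1 \<le> j" "j \<le> int p - 1" by auto
      define i where "i = nat j"
      have y: "y = (m, int i)" "i < p" using mj by (auto simp: i_def)
      then show "?f (case y of (m, i) \<Rightarrow> int (m * p) + i) = y"
        by (simp flip: of_nat_mult of_nat_add)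
    qed
    show "?f ` kept N p l \<subseteq> {..<l} \<times> {1..int p - 1}"
    proof
      fix z assume "z \<in> ?f ` kept N p l"
      then obtain x where x: "x < N" "x mod p \<noteq> 0" "z = ?f (int x)" by (auto simp: kept_iff)
      then show "z \<in> {..<l} \<times> {1..int p - 1}"
        using block_index(1)[OF x(1)] block_index(2)[OF x(1)] by (simp flip: of_nat_less_iff)
    qed
    show "(\<lambda>(m, i). int (m * p) + i) ` ({..<l} \<times> {1..int p - 1}) \<subseteq> kept N p l"
    proof
      fix k assume "k \<in> (\<lambda>(m, i). int (m * p) + i) ` ({..<l} \<times> {1..int p - 1})"
      then obtain m i where mi: "m < l" "1 \<le> i" "i \<le> int p - 1" "k = int (m * p) + i" by auto
      define x where "x = m * p + nat i"
      have "k = int x" "x < N" "x mod p \<noteq> 0" using mi block_index(4)[of "nat i" m] by (auto simp: x_def)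
      then show "k \<in> kept N p l" unfolding kept_iff by auto
    qed
  qed
  fix j k assume "j \<in> kept N p l" "k \<in> kept N p l"
  then show "ext_cartan N j k =
    (if fst (?f j) = fst (?f k) then cartan_A (snd (?f j)) (snd (?f k)) else 0)"
    using ext_cartan_kept by (auto simp: kept_iff)
qed

subsection \<open>Generation by matrix units\<close>

lemma unit_mat_carrier [simp]: "unit_mat r c \<in> carrier_mat N N"
  by (simp add: unit_mat_def)

lemma unit_mat_entry: "i < N \<Longrightarrow> j < N \<Longrightarrow> unit_mat r c $$ (i, j) = (if i = r \<and> j = c then 1 else 0)"
  by (simp add: unit_mat_def)

lemma unit_mat_mult:
  assumes "r < N" "c < N" "r' < N" "c' < N"
  shows "unit_mat r c * unit_mat r' c' = (if c = r' then unit_mat r c' else 0\<^sub>m N N)"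
proof (rule eq_matI)
  fix i j assume "i < dim_row (if c = r' then unit_mat r c' else 0\<^sub>m N N)"
    "j < dim_col (if c = r' then unit_mat r c' else 0\<^sub>m N N)"
  then have ij: "i < N" "j < N" using carrier_matD[OF unit_mat_carrier[of r c']] by (auto split: if_splits)
  have "(unit_mat r c * unit_mat r' c') $$ (i, j) = (\<Sum>k<N. unit_mat r c $$ (i, k) * unit_mat r' c' $$ (k, j))"
    using ij by (intro mat_mult_entry) auto
  also have "\<dots> = (\<Sum>k<N. if k = c then (if i = r \<and> c = r' \<and> j = c' then 1 else 0) else 0)"
    using ij by (intro sum.cong refl) (auto simp: unit_mat_entry)
  finally show "(unit_mat r c * unit_mat r' c') $$ (i, j) = (if c = r' then unit_mat r c' else 0\<^sub>m N N) $$ (i, j)"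
    using ij assms by (auto simp: unit_mat_entry)
qed (use carrier_matD[OF unit_mat_carrier] in auto)

lemma unit_mat_bracket:
  assumes "r < N" "c < N" "d < N" "r \<noteq> d"
  shows "unit_mat r c * unit_mat c d - unit_mat c d * unit_mat r c = unit_mat r d"
  using assms carrier_matD[OF unit_mat_carrier[of r d]]
  by (subst (1 2) unit_mat_mult) (auto intro!: eq_matI)

lemma sl_in_subspace:
  assumes U: "VectorSpace.subspace class_ring U (sl_lie N)" and X: "X \<in> carrier (sl_lie N)"
    and off: "\<And>r c. r < N \<Longrightarrow> c < N \<Longrightarrow> r \<noteq> c \<Longrightarrow> X $$ (r, c) \<noteq> 0 \<Longrightarrow> unit_mat r c \<in> U"
    and diag: "\<And>r. 0 < r \<Longrightarrow> r < N \<Longrightarrow> unit_mat r r - unit_mat 0 0 \<in> U"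
  shows "X \<in> U"
proof -
  \<comment> \<open>Diagonal entries are multiplied by E_rr - E_00 in place of E_rr, which keeps
    every term in sl(N). The corrections at the position (0, 0) add up to the trace of
    \<open>X\<close>, that is, to 0.\<close>
  define T where "T = (\<lambda>(r, c). if r \<noteq> c then X $$ (r, c) \<cdot>\<^sub>m unit_mat r c
    else X $$ (r, r) \<cdot>\<^sub>m (unit_mat r r - unit_mat 0 0))"
  have Xc: "X \<in> carrier_mat N N" "(\<Sum>r<N. X $$ (r, r)) = 0" using X by (auto simp: mtrace_def)
  have z: "0 \<cdot>\<^sub>m unit_mat r c = 0\<^sub>m N N" "unit_mat r c - unit_mat r c = 0\<^sub>m N N" for r c
    using carrier_matD[OF unit_mat_carrier[of r c]] by (auto intro!: eq_matI)
  have "T rc \<in> U" if mem: "rc \<in> {..<N} \<times> {..<N}" for rc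
  proof -
    obtain r c where rc: "rc = (r, c)" "r < N" "c < N" using mem by auto
    have "X $$ (r, r) \<cdot>\<^sub>m 0\<^sub>m N N = 0\<^sub>m N N" by auto
    then show ?thesis
      using rc mem_sl_subspace(4)[OF U off[of r c]] mem_sl_subspace(4)[OF U diag[of r]] mem_sl_subspace(2)[OF U]
      by (cases "r = c"; cases "X $$ (r, c) = 0"; cases "r = 0") (auto simp: T_def z)
  qed
  then have "matsum N T ({..<N} \<times> {..<N}) \<in> U" by (intro mem_sl_subspace(5)[OF U]) auto
  moreover have "matsum N T ({..<N} \<times> {..<N}) = X"
  proof (rule eq_matI)
    fix i j assume "i < dim_row X" "j < dim_col X"
    then have ij: "i < N" "j < N" using Xc by auto
    have T: "T rc $$ (i, j) = (if rc = (i, j) then X $$ rc else 0) -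
        (if i = 0 \<and> j = 0 then if fst rc = snd rc then X $$ rc else 0 else 0)"
      if "rc \<in> {..<N} \<times> {..<N}" for rc
      using that ij carrier_matD[OF unit_mat_carrier] by (auto simp: T_def unit_mat_entry split: if_splits)
    have "(\<Sum>rc\<in>{..<N} \<times> {..<N}. if fst rc = snd rc then X $$ rc else 0) =
        (\<Sum>r<N. \<Sum>c<N. if c = r then X $$ (r, c) else 0)"
      unfolding sum.cartesian_product by (intro sum.cong) auto
    also have "\<dots> = 0" using Xc(2) by simp
    finally have d: "(\<Sum>rc\<in>{..<N} \<times> {..<N}. if fst rc = snd rc then X $$ rc else 0) = 0" .
    have "matsum N T ({..<N} \<times> {..<N}) $$ (i, j) = (\<Sum>rc\<in>{..<N} \<times> {..<N}. (if rc = (i, j) then X $$ rc else 0) -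
        (if i = 0 \<and> j = 0 then if fst rc = snd rc then X $$ rc else 0 else 0))"
      unfolding matsum_entry[OF ij] by (intro sum.cong refl T)
    also have "\<dots> = X $$ (i, j)"
    proof -
      have "(\<Sum>rc\<in>{..<N} \<times> {..<N}. if i = 0 \<and> j = 0 then if fst rc = snd rc then X $$ rc else 0 else 0) = 0"
      proof (cases "i = 0 \<and> j = 0")
        case True
        then show ?thesis using d by simp
      next
        case False
        then show ?thesis by (intro sum.neutral) auto
      qed
      then show ?thesis using ij by (simp add: sum_subtractf)
    qed
    finally show "matsum N T ({..<N} \<times> {..<N}) $$ (i, j) = X $$ (i, j)" .
  qed (use Xc in auto)
  ultimately show ?thesis by simp
qed

text \<open>The predecessor on the cycle, \<open>(x + N - 1) mod N\<close>, treats the vertex 0 and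
  its vector E_{N,1} on the same footing as the others.\<close>

lemma root_vec_unit: "x < N \<Longrightarrow> root_vec N (int x) = unit_mat ((x + N - 1) mod N) x"
  and root_vec_neg_unit: "x < N \<Longrightarrow> root_vec_neg N (int x) = unit_mat x ((x + N - 1) mod N)"
proof -
  assume x: "x < N"
  define k where "k = (if x = 0 then int N else int x)"
  define y where "y = (x + N - 1) mod N"
  have y: "y = (if x = 0 then N - 1 else x - 1)" "y < N"
    using x N_pos(1) by (auto simp: y_def mod_if)
  have a: "(int i + 1) mod int N = k mod int N \<longleftrightarrow> i = y" if "i < N" for i
    using that x y N_pos(1) by (subst mod_eq_iff_close) (auto simp: k_def)
  have b: "(int i + 1) mod int N = (int x + 1) mod int N \<longleftrightarrow> i = x" if "i < N" for i
    using that x by (subst mod_eq_iff_close) auto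
  have rv: "root_vec N (int x) = munit N k (int x + 1)" "root_vec_neg N (int x) = munit N (int x + 1) k"
    by (auto simp: root_vec_def root_vec_neg_def k_def)
  have d: "dim_row (munit N i j) = N" "dim_col (munit N i j) = N" "dim_row (unit_mat i' j') = N"
    "dim_col (unit_mat i' j') = N" for i j i' j'
    by (simp_all add: munit_def unit_mat_def)
  have "munit N k (int x + 1) $$ (i, j) = unit_mat y x $$ (i, j)"
    "munit N (int x + 1) k $$ (i, j) = unit_mat x y $$ (i, j)" if ij: "i < N" "j < N" for i j
    by (simp_all only: munit_entry[OF ij] unit_mat_entry[OF ij] a[OF ij(1)] b[OF ij(1)] a[OF ij(2)] b[OF ij(2)])
  then show "root_vec N (int x) = unit_mat y x" "root_vec_neg N (int x) = unit_mat x y"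
    unfolding rv by (auto intro!: eq_matI simp only: d)
qed

text \<open>Brackets of consecutive root vectors walk around the cycle and reach E_{r,c} for all r
  \<noteq> c, passing through E_{N,1} when c < r. Brackets of opposite units then supply the
  diagonal.\<close>

lemma sl_generated:
  assumes U: "lie_subalgebra U (sl_lie N)" and S: "root_vec N ` {0..<int N} \<subseteq> U"
  shows "carrier (sl_lie N) \<subseteq> U"
proof -
  have step: "unit_mat r ((r + 1) mod N) \<in> U" if "r < N" for r
  proof -
    have "((r + 1) mod N + N - 1) mod N = r" using that by (cases "r + 1 = N") auto
    moreover have "(r + 1) mod N < N" using N_pos(1) by simp
    moreover from this have "root_vec N (int ((r + 1) mod N)) \<in> U"
      using S by (auto simp: image_subset_iff)
    ultimately show ?thesis using root_vec_unit[of "(r + 1) mod N"] by simp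
  qed
  have gen: "unit_mat r ((r + Suc d) mod N) \<in> U" if "r < N" "Suc d < N" for r d
    using that(2)
  proof (induction d)
    case 0 show ?case using step[OF that(1)] by simp
  next
    case (Suc d)
    let ?t = "(r + Suc d) mod N"
    have t: "?t < N" "(?t + 1) mod N < N" "(?t + 1) mod N = (r + Suc (Suc d)) mod N"
      using N_pos(1) by (auto simp: mod_Suc_eq)
    \<comment> \<open>The walk is shorter than \<open>N\<close> and does not return to its start;
      only then is the bracket a single matrix unit.\<close>
    have "(r + Suc (Suc d)) mod N \<noteq> r" using Suc.prems that(1) by (auto simp: mod_if split: if_splits)
    then show ?case
      using lie_subalgebraD(2)[OF U Suc.IH step[OF t(1)]] Suc.prems unit_mat_bracket[OF that(1) t(1) t(2)] t(3)
      by simp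
  qed
  have off: "unit_mat r c \<in> U" if "r < N" "c < N" "r \<noteq> c" for r c
  proof (cases "r < c")
    case True
    then show ?thesis using gen[of r "c - r - 1"] that by simp
  next
    case False
    have "(r + Suc (N + c - r - 1)) mod N = c" using that False by simp
    then show ?thesis using gen[of r "N + c - r - 1"] that False by simp
  qed
  have "unit_mat r r - unit_mat 0 0 \<in> U" if "0 < r" "r < N" for r
    using lie_subalgebraD(2)[OF U off[of r 0] off[of 0 r]] that N_pos(1) by (simp add: unit_mat_mult)
  then show ?thesis using sl_in_subspace[OF lie_subalgebraD(1)[OF U]] off by blast
qed

text \<open>Inside a block there is no way around the cycle, so both directions are built from
  \<open>root_vec\<close> and \<open>root_vec_neg\<close>, by induction on the distance of the two
  positions. All intermediate vertices are kept because no block boundary is crossed.\<close>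

lemma kept_algebra_eq: "kept_algebra N p l = blk N p \<inter> carrier (sl_lie N)"
proof -
  let ?S = "diag_cartan N \<union> root_vec N ` kept N p l \<union> root_vec_neg N ` kept N p l"
  have rv: "root_vec N (int x) = unit_mat (x - 1) x" "root_vec_neg N (int x) = unit_mat x (x - 1)"
    if "x < N" "x mod p \<noteq> 0" for x
  proof -
    have "x + N - 1 = x - 1 + N" using pred_block(2)[OF that(2)] by simp
    then have "(x + N - 1) mod N = (x - 1) mod N" by (simp only: mod_add_self2)
    also have "\<dots> = x - 1" using that(1) by simp
    finally show "root_vec N (int x) = unit_mat (x - 1) x" "root_vec_neg N (int x) = unit_mat x (x - 1)"
      using root_vec_unit[OF that(1)] root_vec_neg_unit[OF that(1)] by simp_all
  qed
  have sb: "unit_mat r c \<in> blk N p \<inter> carrier (sl_lie N)" if "(r, c) \<in> same_block" for r c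
    using that by (auto simp: unit_mat_def same_block_def blk_def mtrace_def)
  have "(x - 1, x) \<in> same_block \<and> (x, x - 1) \<in> same_block" if "x < N" "x mod p \<noteq> 0" for x
    using pred_block[of x] that by (auto simp: same_block_def)
  then have S: "?S \<subseteq> blk N p \<inter> carrier (sl_lie N)"
    using sb rv kept.H_W by (auto simp: kept_iff)
  have "blk N p \<inter> carrier (sl_lie N) \<subseteq> U" if U: "lie_subalgebra U (sl_lie N)" "?S \<subseteq> U" for U
  proof
    fix X assume X: "X \<in> blk N p \<inter> carrier (sl_lie N)"
    have up: "unit_mat r (r + Suc d) \<in> U \<and> unit_mat (r + Suc d) r \<in> U"
      if "r + Suc d < N" "r div p = (r + Suc d) div p" for r d
      using that
    proof (induction d)
      case 0
      have "(r + 1) mod p \<noteq> 0" using pred_block(3)[of "r + 1"] 0 by auto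
      then have "int (r + 1) \<in> kept N p l" "root_vec N (int (r + 1)) = unit_mat r (r + 1)"
        "root_vec_neg N (int (r + 1)) = unit_mat (r + 1) r"
        using 0 rv[of "r + 1"] kept_iff by auto
      then show ?case using U(2) by (auto simp: image_subset_iff)
    next
      case (Suc d)
      let ?t = "r + Suc d"
      have t: "r div p = ?t div p" "?t div p = (?t + 1) div p"
      proof -
        have "r div p \<le> ?t div p" "?t div p \<le> (?t + 1) div p" by (intro div_le_mono; simp)+
        moreover have "r div p = (?t + 1) div p" using Suc.prems(2) by simp
        ultimately show "r div p = ?t div p" "?t div p = (?t + 1) div p" by linarith+
      qed
      have IH: "unit_mat r ?t \<in> U" "unit_mat ?t r \<in> U" using Suc t by auto
      have "(?t + 1) mod p \<noteq> 0" using pred_block(3)[of "?t + 1"] t by auto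
      then have "int (?t + 1) \<in> kept N p l" "root_vec N (int (?t + 1)) = unit_mat ?t (?t + 1)"
        "root_vec_neg N (int (?t + 1)) = unit_mat (?t + 1) ?t"
        using Suc.prems rv[of "?t + 1"] kept_iff by auto
      then have st: "unit_mat ?t (?t + 1) \<in> U" "unit_mat (?t + 1) ?t \<in> U"
        using U(2) by (metis UnI1 UnI2 imageI subsetD)+
      show ?case
        using lie_subalgebraD(2)[OF U(1) IH(1) st(1)] lie_subalgebraD(2)[OF U(1) st(2) IH(2)] Suc.prems
          unit_mat_bracket[of r ?t "?t + 1"] unit_mat_bracket[of "?t + 1" ?t r] by simp
    qed
    show "X \<in> U"
    proof (rule sl_in_subspace[OF lie_subalgebraD(1)[OF U(1)]])
      show "X \<in> carrier (sl_lie N)" using X by blast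
      fix r c assume rc: "r < N" "c < N" "r \<noteq> c" "X $$ (r, c) \<noteq> 0"
      then have "r div p = c div p" using X by (auto simp: blk_def)
      then show "unit_mat r c \<in> U"
        using up[of r "c - r - 1"] up[of c "r - c - 1"] rc by (cases "r < c") auto
    next
      fix r assume r: "0 < r" "r < N"
      have "mtrace (unit_mat r r - unit_mat 0 0) = (\<Sum>i<N. (if i = r then 1 else 0) - (if i = 0 then 1 else 0))"
        unfolding mtrace_def using carrier_matD[OF unit_mat_carrier] by (intro sum.cong) (auto simp: unit_mat_entry)
      then have "unit_mat r r - unit_mat 0 0 \<in> diag_cartan N"
        using r N_pos(1) carrier_matD[OF unit_mat_carrier]
        by (auto simp: diag_cartan_def diagonal_mat_def unit_mat_entry sum_subtractf intro!: minus_carrier_mat)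
      then show "unit_mat r r - unit_mat 0 0 \<in> U" using U(2) by blast
    qed
  qed
  then show ?thesis
    unfolding kept_algebra_def lie_hull_def using S lie_subalgebra_blk[of N p]
    by (intro equalityI Inter_lower Inter_greatest) auto
qed

end

section \<open>Conjugation as an automorphism of sl(n)\<close>

lemma triple_mult_entry:
  assumes "A \<in> carrier_mat n n" "B \<in> carrier_mat n n" "C \<in> carrier_mat n n" "r < n" "c < n"
  shows "(A * B * C) $$ (r, c) = (\<Sum>j<n. \<Sum>k<n. A $$ (r, j) * B $$ (j, k) * C $$ (k, c))"
proof -
  have "(A * B * C) $$ (r, c) = (\<Sum>k<n. (A * B) $$ (r, k) * C $$ (k, c))"
    using assms by (intro mat_mult_entry) auto
  also have "\<dots> = (\<Sum>k<n. \<Sum>j<n. A $$ (r, j) * B $$ (j, k) * C $$ (k, c))"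
    using assms by (intro sum.cong refl) (simp add: mat_mult_entry[OF assms(1,2,4)] sum_distrib_right del: index_mult_mat(1))
  finally show ?thesis by (subst sum.swap)
qed

lemma conj_lie_iso:
  assumes F: "F \<in> carrier_mat n n" and G: "G \<in> carrier_mat n n" and FG: "F * G = 1\<^sub>m n" "G * F = 1\<^sub>m n"
  shows "(\<lambda>X\<in>carrier (sl_lie n). F * X * G) \<in> lie_iso (sl_lie n) (sl_lie n)"
proof -
  have conj: "F * X * G \<in> carrier_mat n n" if "X \<in> carrier_mat n n" for X using that F G by auto
  have tr: "mtrace (P * X * Q) = mtrace X"
    if "X \<in> carrier_mat n n" "P \<in> carrier_mat n n" "Q \<in> carrier_mat n n" "Q * P = 1\<^sub>m n" for X P Q
    using that mtrace_simps(4)[of "P * X" n Q] assoc_mult_mat[of Q n n P n X n] by simp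
  have inv: "Q * (P * X * Q) * P = X"
    if "X \<in> carrier_mat n n" "P \<in> carrier_mat n n" "Q \<in> carrier_mat n n" "Q * P = 1\<^sub>m n"
    for X P Q :: "complex mat"
  proof -
    have "Q * (P * X * Q) * P = (Q * P) * X * (Q * P)"
      using that(1-3) by (simp add: assoc_mult_mat[of _ n n _ n _ n])
    also have "\<dots> = X"
      unfolding that(4) using left_mult_one_mat[OF that(1)] right_mult_one_mat[OF that(1)] by simp
    finally show ?thesis .
  qed
  have add: "F * (X + Y) * G = F * X * G + F * Y * G" "F * (X - Y) * G = F * X * G - F * Y * G"
    if "X \<in> carrier_mat n n" "Y \<in> carrier_mat n n" for X Y
    using that F G
    by (simp_all add: mult_add_distrib_mat[of F n n X n Y] add_mult_distrib_mat[of "F * X" n n "F * Y" G n]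
        mult_minus_distrib_mat[of F n n X n Y] minus_mult_distrib_mat[of "F * X" n n "F * Y" G n])
  have smult: "F * (c \<cdot>\<^sub>m X) * G = c \<cdot>\<^sub>m (F * X * G)" if "X \<in> carrier_mat n n" for X c
    using that F G by (simp add: mult_smult_distrib[of F n n X n] mult_smult_assoc_mat[of "F * X" n n G n])
  have mult: "(F * X * G) * (F * Y * G) = F * (X * Y) * G"
    if "X \<in> carrier_mat n n" "Y \<in> carrier_mat n n" for X Y
  proof -
    have "(F * X * G) * (F * Y * G) = F * X * (G * F) * Y * G"
      using that F G by (simp add: assoc_mult_mat[of _ n n _ n _ n])
    then show ?thesis using that F G FG by (simp add: assoc_mult_mat[of _ n n _ n _ n])
  qed
  have "bij_betw (\<lambda>X\<in>carrier (sl_lie n). F * X * G) (carrier (sl_lie n)) (carrier (sl_lie n))"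
    by (rule bij_betw_byWitness[where f' = "\<lambda>X. G * X * F"])
      (use F G FG inv tr conj in \<open>auto simp: image_subset_iff\<close>)
  moreover have "F * (X * Y - Y * X) * G = F * X * G * (F * Y * G) - F * Y * G * (F * X * G)"
    if "X \<in> carrier_mat n n" "Y \<in> carrier_mat n n" for X Y
    using that by (simp add: mult add)
  moreover have "F * X * G \<in> carrier (sl_lie n)" if "X \<in> carrier (sl_lie n)" for X
    using that conj[of X] tr[OF _ F G FG(2), of X] by simp
  moreover have "X + Y \<in> carrier (sl_lie n)" "X * Y - Y * X \<in> carrier (sl_lie n)" "c \<cdot>\<^sub>m X \<in> carrier (sl_lie n)"
    if "X \<in> carrier (sl_lie n)" "Y \<in> carrier (sl_lie n)" for X Y c
    using that by (auto simp: mtrace_simps[where n = n] mtrace_commutator[where n = n])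
  moreover have "X \<in> carrier_mat n n" if "X \<in> carrier (sl_lie n)" for X using that by simp
  ultimately show ?thesis
    unfolding lie_iso_def LinearCombinations.module_hom_def
    by (simp add: add(1) smult del: sl_lie_simps(1) index_mult_mat index_minus_mat index_add_mat)
qed

section \<open>Kac's automorphism as conjugation by a diagonal matrix\<close>

context blocks begin

definition om :: complex where "om = cis (2 * pi / real l)"

lemma om_pow: "om ^ k = cis (2 * pi * real k / real l)"
  unfolding om_def Complex.DeMoivre by (simp add: mult_ac)

lemma om_nz [simp]: "om \<noteq> 0"
  by (simp add: om_def)

lemma om_pow_l [simp]: "om ^ l = 1"
  using l by (simp add: om_pow)

lemma om_pow_eq_iff: "a < l \<Longrightarrow> b < l \<Longrightarrow> om ^ a = om ^ b \<longleftrightarrow> a = b"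
  using bij_betw_imp_inj_on[OF bij_betw_roots_unity[of l]] l by (auto simp: om_pow dest: inj_onD)

lemma om_exp: "exp (2 * pi * \<i> / of_nat l) = om"
  by (simp add: om_def cis_conv_exp mult_ac)

text \<open>
  The diagonal matrix with entries \<open>wt\<close> is chosen so that conjugation multiplies \<open>E\<^sub>k\<^sub>,\<^sub>k\<^sub>+\<^sub>1\<close> by the
  root of unity \<open>om\<close> exactly where a new block of length \<open>p\<close> begins, including the wrap-around at \<open>\<alpha>\<^sub>0\<close>.
\<close>

definition wt :: "nat \<Rightarrow> complex" where "wt r = om ^ (r div p)"

lemma wt_nz [simp]: "wt r \<noteq> 0"
  by (simp add: wt_def)

lemma wt_pow_l [simp]: "wt r ^ l = 1"
  unfolding wt_def by (metis om_pow_l power_mult mult.commute power_one)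

lemma wt_eq_iff: "r < N \<Longrightarrow> c < N \<Longrightarrow> wt r = wt c \<longleftrightarrow> r div p = c div p"
  using block_index(1) by (simp add: wt_def om_pow_eq_iff)

definition dg :: "(nat \<Rightarrow> complex) \<Rightarrow> complex mat" where
  "dg w = mat N N (\<lambda>(r, c). if r = c then w r else 0)"

lemma dg_carrier [simp]: "dg w \<in> carrier_mat N N"
  by (simp add: dg_def)

lemma dg_conj_entry:
  assumes "X \<in> carrier_mat N N" "r < N" "c < N"
  shows "(dg u * X * dg v) $$ (r, c) = u r * X $$ (r, c) * v c"
proof -
  have "(dg u * X * dg v) $$ (r, c) = (\<Sum>j<N. \<Sum>k<N. dg u $$ (r, j) * X $$ (j, k) * dg v $$ (k, c))"
    using assms by (intro triple_mult_entry) auto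
  also have "\<dots> = (\<Sum>j<N. \<Sum>k<N. if k = c then if j = r then u r * X $$ (r, c) * v c else 0 else 0)"
    using assms by (intro sum.cong refl) (auto simp: dg_def)
  finally show ?thesis using assms by simp
qed

lemma dg_mult: "(\<And>r. u r * v r = 1) \<Longrightarrow> dg u * dg v = 1\<^sub>m N"
proof (rule eq_matI)
  assume uv: "\<And>r. u r * v r = 1"
  fix i j assume "i < dim_row (1\<^sub>m N :: complex mat)" "j < dim_col (1\<^sub>m N :: complex mat)"
  then have ij: "i < N" "j < N" by auto
  have "(dg u * 1\<^sub>m N * dg v) $$ (i, j) = 1\<^sub>m N $$ (i, j)"
    using ij uv[of j] by (subst dg_conj_entry) auto
  then show "(dg u * dg v) $$ (i, j) = 1\<^sub>m N $$ (i, j)" by (simp add: right_mult_one_mat[of _ N])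
qed (auto simp: dg_def)

text \<open>The inverse weights stand on the left, so the entry \<open>(r, c)\<close> is multiplied
  by \<open>wt c / wt r\<close>; a step into a new block then gives \<open>om\<close> and not its
  inverse.\<close>

definition sg :: "complex mat \<Rightarrow> complex mat" where
  "sg = (\<lambda>X\<in>carrier (sl_lie N). dg (\<lambda>r. 1 / wt r) * X * dg wt)"

lemma sg_iso: "sg \<in> lie_iso (sl_lie N) (sl_lie N)"
  unfolding sg_def by (intro conj_lie_iso dg_mult) auto

lemma sg_carrier: "X \<in> carrier (sl_lie N) \<Longrightarrow> sg X \<in> carrier (sl_lie N)"
  using sg_iso unfolding lie_iso_def by (auto dest!: module_hom_closed)

lemma sg_entry: "X \<in> carrier (sl_lie N) \<Longrightarrow> r < N \<Longrightarrow> c < N \<Longrightarrow> sg X $$ (r, c) = X $$ (r, c) * (wt c / wt r)"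
  by (simp add: sg_def dg_conj_entry del: index_mult_mat(1))

lemma root_vec_sl: "x < N \<Longrightarrow> root_vec N (int x) \<in> carrier (sl_lie N)"
proof -
  assume x: "x < N"
  have "(x + N - 1) mod N \<noteq> x" using x N_pos by (cases "x = 0") (auto simp: mod_if)
  then show ?thesis unfolding root_vec_unit[OF x] using x by (auto simp: unit_mat_def mtrace_def)
qed

text \<open>This is the denominator \<open>m\<close> in Kac's formula, so a dropped root vector is
  multiplied by exactly \<open>om\<close>.\<close>

lemma sum_drop_labels: "(\<Sum>j\<in>{0..<int N}. drop_labels p l j) = l"
proof -
  have "dropped p l \<subseteq> {0..<int N}"
    using block_index(4)[of 0] p by (auto simp: dropped_def simp flip: of_nat_mult)
  then have "(\<Sum>j\<in>{0..<int N}. drop_labels p l j) = (\<Sum>j\<in>dropped p l. 1)"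
    by (intro sum.mono_neutral_cong_right) (auto simp: drop_labels_def)
  also have "\<dots> = card {..<l}"
    unfolding dropped_def using p by (subst card_eq_sum[symmetric], subst card_image) (auto simp: inj_on_def)
  finally show ?thesis by simp
qed

lemma dropped_iff: "x < N \<Longrightarrow> int x \<in> dropped p l \<longleftrightarrow> x mod p = 0"
proof -
  assume x: "x < N"
  have "int x \<in> kept N p l \<longleftrightarrow> x mod p \<noteq> 0" using x unfolding kept_iff by auto
  then show ?thesis using x by (auto simp: kept_def)
qed

lemma wt_step: "x < N \<Longrightarrow> wt x = (if x mod p = 0 then om else 1) * wt ((x + N - 1) mod N)"
proof (cases "x = 0")
  case True
  have "(N - 1) div p = l - 1"
    using l p by (intro div_nat_eqI) (simp_all add: N right_diff_distrib')
  \<comment> \<open>At the wrap-around block 0 follows block \<open>l - 1\<close>; the weights close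
    up because \<open>om\<close> is an \<open>l\<close>-th root of unity.\<close>
  moreover have "om * om ^ (l - 1) = 1" using l by (metis om_pow_l power_eq_if not_numeral_le_zero)
  ultimately show ?thesis using True N_pos(1) by (simp add: wt_def)
next
  assume x: "x < N"
  case False
  have "x + N - 1 = x - 1 + N" using False by simp
  then have "(x + N - 1) mod N = (x - 1) mod N" by (simp only: mod_add_self2)
  then have e: "(x + N - 1) mod N = x - 1" using x by simp
  show ?thesis
    unfolding e using pred_block(1)[of x] pred_block(3)[of x] False by (auto simp: wt_def)
qed

lemma sg_root_vec:
  assumes "k \<in> {0..<int N}"
  shows "sg (root_vec N k) = exp (2 * pi * \<i> * of_nat (drop_labels p l k) /
    of_nat (\<Sum>j\<in>{0..<int N}. drop_labels p l j)) \<cdot>\<^sub>m root_vec N k"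
proof -
  define x where "x = nat k"
  define y where "y = (x + N - 1) mod N"
  have x: "k = int x" "x < N" using assms by (auto simp: x_def)
  have rv: "root_vec N k = unit_mat y x" using root_vec_unit[OF x(2)] x(1) by (simp add: y_def)
  have "exp (2 * pi * \<i> * of_nat (drop_labels p l k) / of_nat (\<Sum>j\<in>{0..<int N}. drop_labels p l j)) =
      (if x mod p = 0 then om else 1)"
    unfolding sum_drop_labels using om_exp dropped_iff[OF x(2)] x(1) by (simp add: drop_labels_def)
  also have "\<dots> = wt x / wt y"
    using wt_step[OF x(2)] by (simp add: y_def)
  finally have e: "exp (2 * pi * \<i> * of_nat (drop_labels p l k) / of_nat (\<Sum>j\<in>{0..<int N}. drop_labels p l j)) =
      wt x / wt y" .
  have "unit_mat y x \<in> carrier (sl_lie N)" using root_vec_sl[OF x(2)] rv x(1) by simp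
  then show ?thesis
    unfolding e rv using sg_carrier[of "unit_mat y x"] carrier_matD[OF unit_mat_carrier[of y x]]
    by (intro eq_matI) (auto simp: sg_entry unit_mat_entry)
qed

lemma kac_sg: "kac_automorphism N (drop_labels p l) sg"
  unfolding kac_automorphism_def using sg_iso sg_root_vec by (auto simp: sg_def)

text \<open>Two homomorphisms agree on a Lie subalgebra. This one contains all root vectors of the
  extended diagram and is therefore everything; extensionality turns agreement on sl(N) into
  equality of functions.\<close>

lemma kac_unique:
  assumes k: "kac_automorphism N (drop_labels p l) \<tau>"
  shows "\<tau> = sg"
proof -
  have \<tau>: "\<tau> \<in> lie_iso (sl_lie N) (sl_lie N)" "\<tau> \<in> extensional (carrier (sl_lie N))"
    "\<And>k. k \<in> {0..<int N} \<Longrightarrow> \<tau> (root_vec N k) = sg (root_vec N k)"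
    using k sg_root_vec by (auto simp: kac_automorphism_def)
  have hom: "f (X + Y) = f X + f Y" "f (c \<cdot>\<^sub>m X) = c \<cdot>\<^sub>m f X" "f (X * Y - Y * X) = f X * f Y - f Y * f X"
    "f X \<in> carrier_mat N N"
    if "f \<in> lie_iso (sl_lie N) (sl_lie N)" "X \<in> carrier (sl_lie N)" "Y \<in> carrier (sl_lie N)" for f X Y c
    using that by (auto simp: lie_iso_def LinearCombinations.module_hom_def)
  let ?U = "{X \<in> carrier (sl_lie N). \<tau> X = sg X}"
  have zero: "f (0\<^sub>m N N) = 0\<^sub>m N N" if f: "f \<in> lie_iso (sl_lie N) (sl_lie N)" for f
  proof -
    have "f (0 \<cdot>\<^sub>m 0\<^sub>m N N) = 0 \<cdot>\<^sub>m f (0\<^sub>m N N)" by (rule hom(2)[OF f, of _ "0\<^sub>m N N"]) auto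
    moreover have "0 \<cdot>\<^sub>m f (0\<^sub>m N N) = 0\<^sub>m N N" using hom(4)[OF f, of "0\<^sub>m N N" "0\<^sub>m N N"] by (intro eq_matI) auto
    ultimately show ?thesis by simp
  qed
  have cl: "X + Y \<in> carrier (sl_lie N)" "c \<cdot>\<^sub>m X \<in> carrier (sl_lie N)" "X * Y - Y * X \<in> carrier (sl_lie N)"
    if "X \<in> carrier (sl_lie N)" "Y \<in> carrier (sl_lie N)" for X Y c
    using that by (auto simp: mtrace_simps[where n = N] mtrace_commutator[where n = N])
  have U: "lie_subalgebra ?U (sl_lie N)"
  proof (rule lie_subalgebra_slI)
    show "0\<^sub>m N N \<in> ?U" using zero[OF \<tau>(1)] zero[OF sg_iso] by simp
    fix X Y c assume "X \<in> ?U"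
    then have X: "X \<in> carrier (sl_lie N)" "\<tau> X = sg X" by auto
    show "c \<cdot>\<^sub>m X \<in> ?U" using hom(2)[OF \<tau>(1) X(1) X(1)] hom(2)[OF sg_iso X(1) X(1)] cl(2)[OF X(1) X(1)] X(2) by simp
    assume "Y \<in> ?U"
    then have Y: "Y \<in> carrier (sl_lie N)" "\<tau> Y = sg Y" by auto
    note h = hom[OF \<tau>(1) X(1) Y(1)] hom[OF sg_iso X(1) Y(1)] and c = cl[OF X(1) Y(1)]
    show "X + Y \<in> ?U" using h(1,5) c(1) X(2) Y(2) by simp
    show "X * Y - Y * X \<in> ?U" using h(3,7) c(3) X(2) Y(2) by simp
  qed auto
  have "root_vec N ` {0..<int N} \<subseteq> ?U"
  proof
    fix y assume "y \<in> root_vec N ` {0..<int N}"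
    then obtain k where k: "k \<in> {0..<int N}" "y = root_vec N k" by blast
    have "nat k < N" using k(1) by auto
    then show "y \<in> ?U" using k \<tau>(3)[OF k(1)] root_vec_sl[of "nat k"] by simp
  qed
  then have sub: "carrier (sl_lie N) \<subseteq> ?U" by (rule sl_generated[OF U])
  show ?thesis
  proof (rule extensionalityI[OF \<tau>(2)])
    show "sg \<in> extensional (carrier (sl_lie N))" by (simp add: sg_def)
    show "\<tau> X = sg X" if "X \<in> carrier (sl_lie N)" for X using sub that by blast
  qed
qed

lemma sg_funpow: "X \<in> carrier (sl_lie N) \<Longrightarrow> (sg ^^ n) X \<in> carrier (sl_lie N) \<and>
    (\<forall>r<N. \<forall>c<N. (sg ^^ n) X $$ (r, c) = X $$ (r, c) * (wt c / wt r) ^ n)"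
proof (induction n)
  case (Suc n)
  note IH = Suc.IH[OF Suc.prems]
  have "(sg ^^ Suc n) X $$ (r, c) = X $$ (r, c) * (wt c / wt r) ^ Suc n" if "r < N" "c < N" for r c
    using sg_entry[of "(sg ^^ n) X" r c] IH that by (simp del: sl_lie_simps)
  then show ?case using sg_carrier[of "(sg ^^ n) X"] IH by simp
qed simp

lemma sg_order: "has_order (carrier (sl_lie N)) sg l"
  unfolding has_order_def
proof (intro conjI ballI allI impI)
  show "0 < l" using l by simp
  fix X assume X: "X \<in> carrier (sl_lie N)"
  show "(sg ^^ l) X = X"
    using sg_funpow[OF X, of l] X by (intro eq_matI) (auto simp: power_divide)
next
  fix k assume k: "0 < k \<and> k < l"
  have p0: "p < N" "(p + N - 1) mod N = p - 1"
  proof -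
    have "p + N - 1 = p - 1 + N" using p by simp
    then have "(p + N - 1) mod N = (p - 1) mod N" by (simp only: mod_add_self2)
    then show "(p + N - 1) mod N = p - 1" using N_pos(2) by simp
  qed (rule N_pos(2))
  have w: "wt p = om" "wt (p - 1) = 1" using p by (auto simp: wt_def)
  \<comment> \<open>The root vector of the dropped root \<alpha>_p is an eigenvector for
    \<open>om\<close>, a primitive \<open>l\<close>-th root of unity, so no smaller power fixes it.
    The vertex exists because \<open>p < N\<close>.\<close>
  let ?X = "root_vec N (int p)"
  have X: "?X \<in> carrier (sl_lie N)" "?X = unit_mat (p - 1) p"
    using root_vec_sl[OF p0(1)] root_vec_unit[OF p0(1)] p0(2) by simp_all
  have "(sg ^^ k) ?X $$ (p - 1, p) = om ^ k"
    using sg_funpow[OF X(1), of k] p0(1) w X(2) by (simp add: unit_mat_entry)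
  moreover have "?X $$ (p - 1, p) = 1" using p0(1) X(2) by (simp add: unit_mat_entry)
  moreover have "om ^ k \<noteq> 1" using om_pow_eq_iff[of k 0] k by simp
  ultimately have "(sg ^^ k) ?X \<noteq> ?X" by metis
  then show "\<exists>x\<in>carrier (sl_lie N). (sg ^^ k) x \<noteq> x" using X(1) by blast
qed

text \<open>\<open>wt\<close> takes different values on different blocks, so invariance kills
  exactly the entries between different blocks.\<close>

lemma sg_fixed: "{X \<in> carrier (sl_lie N). sg X = X} = blk N p \<inter> carrier (sl_lie N)"
proof (intro equalityI subsetI)
  fix X assume "X \<in> {X \<in> carrier (sl_lie N). sg X = X}"
  then have X: "X \<in> carrier (sl_lie N)" "sg X = X" by auto
  have "X $$ (r, c) = 0" if rc: "r < N" "c < N" "r div p \<noteq> c div p" for r c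
  proof -
    have "X $$ (r, c) = X $$ (r, c) * (wt c / wt r)" using sg_entry[OF X(1) rc(1,2)] X(2) by metis
    moreover have "wt c / wt r \<noteq> 1" using wt_eq_iff[OF rc(1,2)] rc(3) by simp
    ultimately show ?thesis by (metis mult_cancel_left2)
  qed
  then show "X \<in> blk N p \<inter> carrier (sl_lie N)" using X(1) by (auto simp: blk_def)
next
  fix X assume X: "X \<in> blk N p \<inter> carrier (sl_lie N)"
  have "sg X $$ (r, c) = X $$ (r, c)" if rc: "r < N" "c < N" for r c
    using sg_entry[of X r c] X rc wt_eq_iff[OF rc] by (cases "r div p = c div p") (auto simp: blk_def)
  then have "sg X = X" using X sg_carrier[of X] by (intro eq_matI) auto
  then show "X \<in> {X \<in> carrier (sl_lie N). sg X = X}" using X by auto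
qed

subsection \<open>The Fourier transform\<close>

text \<open>The columns of \<open>fourier_inv\<close> are eigenvectors of \<open>\<Lambda>\<^sup>p\<close>, so that \<open>\<Lambda>\<^sup>p\<close> becomes diagonal.\<close>

definition fourier :: "complex mat" where
  "fourier = mat N N (\<lambda>(r, c). if r mod p = c mod p then om ^ ((r div p) * (c div p)) / of_nat l else 0)"

definition fourier_inv :: "complex mat" where
  "fourier_inv = mat N N (\<lambda>(r, c). if r mod p = c mod p then 1 / om ^ ((r div p) * (c div p)) else 0)"

lemma fourier_carrier [simp]: "fourier \<in> carrier_mat N N" "fourier_inv \<in> carrier_mat N N"
  by (simp_all add: fourier_def fourier_inv_def)

text \<open>Orthogonality of characters: for different blocks \<open>z\<close> is an
  \<open>l\<close>-th root of unity other than 1, and its geometric sum vanishes. The factor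
  \<open>1 / l\<close> is put into \<open>fourier\<close> alone.\<close>

lemma fourier_mult: "fourier * fourier_inv = 1\<^sub>m N" "fourier_inv * fourier = 1\<^sub>m N"
proof -
  show *: "fourier * fourier_inv = 1\<^sub>m N"
  proof (rule eq_matI)
    fix r c assume "r < dim_row (1\<^sub>m N :: complex mat)" "c < dim_col (1\<^sub>m N :: complex mat)"
    then have rc: "r < N" "c < N" by auto
    define z where "z = om ^ (r div p) / om ^ (c div p)"
    have "(fourier * fourier_inv) $$ (r, c) = (\<Sum>k<N. fourier $$ (r, k) * fourier_inv $$ (k, c))"
      using rc by (intro mat_mult_entry) auto
    also have "\<dots> = (\<Sum>m<l. \<Sum>i<p. fourier $$ (r, m * p + i) * fourier_inv $$ (m * p + i, c))"
      by (rule sum_blocks)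
    also have "\<dots> = (\<Sum>m<l. \<Sum>i<p. if i = r mod p then if r mod p = c mod p then z ^ m / of_nat l else 0 else 0)"
    proof (intro sum.cong refl)
      fix m i assume "m \<in> {..<l}" "i \<in> {..<p}"
      then have mi: "m < l" "i < p" "m * p + i < N" "(m * p + i) mod p = i" "(m * p + i) div p = m"
        using block_index(4) by auto
      show "fourier $$ (r, m * p + i) * fourier_inv $$ (m * p + i, c) =
          (if i = r mod p then if r mod p = c mod p then z ^ m / of_nat l else 0 else 0)"
        using rc mi by (auto simp: fourier_def fourier_inv_def z_def power_divide power_mult mult.commute[of m] simp flip: power_mult)
    qed
    also have "\<dots> = (if r mod p = c mod p then (\<Sum>m<l. z ^ m) / of_nat l else 0)"
      using p by (simp add: sum_divide_distrib)
    also have "\<dots> = (if r = c then 1 else 0)"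
    proof (cases "r mod p = c mod p")
      case True
      show ?thesis
      proof (cases "r = c")
        case True
        then show ?thesis using l by (simp add: z_def)
      next
        case False
        then have "r div p \<noteq> c div p" using True by (metis div_mult_mod_eq)
        then have "z \<noteq> 1" using wt_eq_iff[OF rc] by (simp add: z_def wt_def)
        moreover have "z ^ l = 1"
          using wt_pow_l[of r] wt_pow_l[of c] by (simp add: z_def power_divide wt_def)
        ultimately have "(\<Sum>m<l. z ^ m) = 0" by (simp add: geometric_sum)
        then show ?thesis using False by simp
      qed
    qed auto
    finally show "(fourier * fourier_inv) $$ (r, c) = 1\<^sub>m N $$ (r, c)" using rc by simp
  qed (auto simp: fourier_def fourier_inv_def)
  show "fourier_inv * fourier = 1\<^sub>m N"
    by (rule mat_mult_left_right_inverse[OF _ _ *]) auto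
qed

lemma shift_div: "k < N \<Longrightarrow> (k + p) mod N div p = (k div p + 1) mod l"
proof -
  assume k: "k < N"
  define m i where mi: "m = k div p" "i = k mod p"
  have e: "k = m * p + i" "i < p" "m < l" using block_index[of k] k by (auto simp: mi)
  show ?thesis
  proof (cases "m + 1 < l")
    case True
    have "k + p = (m + 1) * p + i" using e by simp
    then have "(k + p) mod N = (m + 1) * p + i"
      using block_index(4)[OF e(2) True] by (simp only: mod_less)
    moreover have "((m + 1) * p + i) div p = m + 1"
      using e(2) by (intro div_nat_eqI) simp_all
    ultimately show ?thesis using True unfolding mi(1) by (metis mod_less)
  next
    case False
    then have "m + 1 = l" using e by simp
    then have "k + p = i + N" using e N by (metis add.commute add.left_commute mult.commute mult_Suc Suc_eq_plus1)
    moreover have "i < N" using e(2) N_pos(2) by simp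
    ultimately show ?thesis using e(2) \<open>m + 1 = l\<close> by (simp add: mi(1)[symmetric])
  qed
qed

lemma pow_mod_l: "z ^ l = 1 \<Longrightarrow> z ^ (n mod l) = z ^ n" for z :: complex
  by (metis div_mult_mod_eq mult.commute mult_1 power_add power_mult power_one)

text \<open>Rows of \<open>fourier\<close> and columns of \<open>fourier_inv\<close> are
  eigenvectors of the shift by \<open>p\<close>. The block number wraps around modulo
  \<open>l\<close>, which the power does not notice since \<open>wt r ^ l = 1\<close>.\<close>

lemma fourier_shift:
  assumes "r < N" "k < N"
  shows "fourier $$ (r, (k + p) mod N) = fourier $$ (r, k) * wt r"
    and "fourier_inv $$ ((k + p) mod N, r) = fourier_inv $$ (k, r) / wt r"
proof -
  have "om ^ ((r div p) * x) = wt r ^ x" for x by (simp add: wt_def power_mult)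
  then have "om ^ ((r div p) * ((k div p + 1) mod l)) = om ^ ((r div p) * (k div p)) * wt r"
    using pow_mod_l[OF wt_pow_l, of r "k div p + 1"] by simp
  then have "om ^ ((r div p) * ((k + p) mod N div p)) = om ^ ((r div p) * (k div p)) * wt r"
    by (simp add: shift_div[OF assms(2)])
  then show "fourier $$ (r, (k + p) mod N) = fourier $$ (r, k) * wt r"
    "fourier_inv $$ ((k + p) mod N, r) = fourier_inv $$ (k, r) / wt r"
    using assms N_pos(1) by (simp_all add: fourier_def fourier_inv_def mod_shift mult.commute)
qed

definition fmap :: "complex mat \<Rightarrow> complex mat" where
  "fmap = (\<lambda>X\<in>carrier (sl_lie N). fourier * X * fourier_inv)"

lemma fmap_iso: "fmap \<in> lie_iso (sl_lie N) (sl_lie N)"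
  unfolding fmap_def by (intro conj_lie_iso fourier_mult fourier_carrier)

lemma fmap_carrier: "X \<in> carrier (sl_lie N) \<Longrightarrow> fmap X \<in> carrier (sl_lie N)"
  using fmap_iso unfolding lie_iso_def by (auto dest!: module_hom_closed)

lemma twist_sl: "X \<in> carrier (sl_lie N) \<Longrightarrow> twist N p X \<in> carrier (sl_lie N)"
proof -
  assume X: "X \<in> carrier (sl_lie N)"
  then have c: "twist N p X \<in> carrier_mat N N" using twist_carrier by simp
  have "mtrace (twist N p X) = (\<Sum>r<N. X $$ ((r + p) mod N, (r + p) mod N))"
    using c X by (simp add: mtrace_def twist_entry)
  also have "\<dots> = (\<Sum>r<N. X $$ (r, r))"
    using N_pos(1) by (intro sum.reindex_bij_betw bij_betw_add_mod)
  finally show ?thesis using c X by (auto simp: mtrace_def)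
qed

text \<open>Reindexing both summations by the shift replaces \<open>X\<close> by its twist and
  releases the eigenvalues \<open>wt r\<close> and \<open>1 / wt s\<close>; their quotient is the
  factor by which \<open>sg\<close> acts, moved to the other side.\<close>

lemma fmap_twist:
  assumes X: "X \<in> carrier (sl_lie N)"
  shows "fmap (twist N p X) = sg (fmap X)"
proof (rule eq_matI)
  have c: "sg (fmap X) \<in> carrier_mat N N" "fmap (twist N p X) \<in> carrier_mat N N"
    using sg_carrier[OF fmap_carrier[OF X]] fmap_carrier[OF twist_sl[OF X]] by auto
  then show "dim_row (fmap (twist N p X)) = dim_row (sg (fmap X))"
    "dim_col (fmap (twist N p X)) = dim_col (sg (fmap X))" by auto
  have Xc: "X \<in> carrier_mat N N" "twist N p X \<in> carrier_mat N N" using X twist_carrier by auto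
  fix r s assume "r < dim_row (sg (fmap X))" "s < dim_col (sg (fmap X))"
  then have rs: "r < N" "s < N" using c by auto
  let ?q = "\<lambda>k. (k + p) mod N"
  have "fmap X $$ (r, s) = (\<Sum>j<N. \<Sum>k<N. fourier $$ (r, j) * X $$ (j, k) * fourier_inv $$ (k, s))"
    using X Xc rs by (simp add: fmap_def triple_mult_entry del: index_mult_mat(1))
  also have "\<dots> = (\<Sum>j<N. \<Sum>k<N. fourier $$ (r, ?q j) * X $$ (?q j, k) * fourier_inv $$ (k, s))"
    using N_pos(1) by (intro sum.reindex_bij_betw[symmetric] bij_betw_add_mod)
  also have "\<dots> = (\<Sum>j<N. \<Sum>k<N. fourier $$ (r, ?q j) * X $$ (?q j, ?q k) * fourier_inv $$ (?q k, s))"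
    using N_pos(1) by (intro sum.cong refl sum.reindex_bij_betw[symmetric] bij_betw_add_mod)
  also have "\<dots> = (\<Sum>j<N. \<Sum>k<N. fourier $$ (r, j) * twist N p X $$ (j, k) * fourier_inv $$ (k, s) * (wt r / wt s))"
    using rs Xc by (intro sum.cong refl) (simp add: fourier_shift twist_entry)
  also have "\<dots> = fmap (twist N p X) $$ (r, s) * (wt r / wt s)"
  proof -
    have "fmap (twist N p X) $$ (r, s) =
        (\<Sum>j<N. \<Sum>k<N. fourier $$ (r, j) * twist N p X $$ (j, k) * fourier_inv $$ (k, s))"
      using twist_sl[OF X] Xc rs by (simp add: fmap_def triple_mult_entry del: index_mult_mat(1))
    then show ?thesis by (simp only: sum_distrib_right)
  qed
  finally have "fmap X $$ (r, s) = fmap (twist N p X) $$ (r, s) * (wt r / wt s)" .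
  then show "fmap (twist N p X) $$ (r, s) = sg (fmap X) $$ (r, s)"
    using sg_entry[OF fmap_carrier[OF X] rs] by simp
qed

text \<open>The intertwining relation matches the fixed points of \<open>twist\<close> with those of
  \<open>sg\<close>.\<close>

lemma fmap_g0: "fmap ` g0 N p = blk N p \<inter> carrier (sl_lie N)"
proof -
  have bij: "bij_betw fmap (carrier (sl_lie N)) (carrier (sl_lie N))"
    using fmap_iso by (simp add: lie_iso_def)
  have "twist N p X = X \<longleftrightarrow> sg (fmap X) = fmap X" if X: "X \<in> carrier (sl_lie N)" for X
    using inj_on_eq_iff[OF bij_betw_imp_inj_on[OF bij] twist_sl[OF X] X] fmap_twist[OF X] by simp
  then have "g0 N p = {X \<in> carrier (sl_lie N). sg (fmap X) = fmap X}"
    unfolding g0_def by blast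
  moreover have "fmap ` {X \<in> carrier (sl_lie N). sg (fmap X) = fmap X} = {Y \<in> carrier (sl_lie N). sg Y = Y}"
  proof (intro equalityI subsetI)
    fix Y assume "Y \<in> {Y \<in> carrier (sl_lie N). sg Y = Y}"
    then have Y: "Y \<in> carrier (sl_lie N)" "sg Y = Y" by auto
    then obtain X where "X \<in> carrier (sl_lie N)" "Y = fmap X"
      using bij_betw_imp_surj_on[OF bij] by (metis imageE)
    then show "Y \<in> fmap ` {X \<in> carrier (sl_lie N). sg (fmap X) = fmap X}" using Y(2) by blast
  qed (use fmap_carrier in blast)
  ultimately show ?thesis using sg_fixed by simp
qed

end

section \<open>Decomposition into blocks\<close>

lemma lie_iso_comp:
  assumes "f \<in> lie_iso L M" "g \<in> lie_iso M K"
  shows "g \<circ> f \<in> lie_iso L K"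
proof -
  have c: "f x \<in> carrier M" if "x \<in> carrier L" for x
    using assms(1) that by (auto simp: lie_iso_def dest!: module_hom_closed)
  have "bij_betw (g \<circ> f) (carrier L) (carrier K)"
    using assms by (intro bij_betw_trans) (auto simp: lie_iso_def)
  then show ?thesis
    using assms c unfolding lie_iso_def LinearCombinations.module_hom_def by (auto simp: Pi_iff)
qed

lemma lie_iso_restrict:
  assumes "f \<in> lie_iso L M" "W \<subseteq> carrier L"
  shows "f \<in> lie_iso (L\<lparr>carrier := W\<rparr>) (M\<lparr>carrier := f ` W\<rparr>)"
proof -
  have "bij_betw f W (f ` W)"
    using assms inj_on_subset by (auto simp: lie_iso_def bij_betw_def)
  then show ?thesis
    using assms unfolding lie_iso_def LinearCombinations.module_hom_def by (auto simp: subset_iff)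
qed

lemma mtrace_one: "mtrace (1\<^sub>m n) = of_nat n"
  by (simp add: mtrace_def)

text \<open>Scalar matrices are central. Together with the vanishing trace of commutators this makes
  the traceless part a Lie homomorphism from gl(n) to sl(n).\<close>

lemma scalar_shift_commutator:
  fixes A B :: "complex mat"
  assumes A: "A \<in> carrier_mat n n" and B: "B \<in> carrier_mat n n"
  shows "(A - a \<cdot>\<^sub>m 1\<^sub>m n) * (B - b \<cdot>\<^sub>m 1\<^sub>m n) - (B - b \<cdot>\<^sub>m 1\<^sub>m n) * (A - a \<cdot>\<^sub>m 1\<^sub>m n) = A * B - B * A"
proof -
  have *: "(P - a \<cdot>\<^sub>m 1\<^sub>m n) * (Q - b \<cdot>\<^sub>m 1\<^sub>m n) = (P * Q - b \<cdot>\<^sub>m P) - (a \<cdot>\<^sub>m Q - (a * b) \<cdot>\<^sub>m 1\<^sub>m n)"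
    if P: "P \<in> carrier_mat n n" and Q: "Q \<in> carrier_mat n n" for P Q :: "complex mat" and a b
  proof -
    let ?I = "1\<^sub>m n :: complex mat"
    have I: "k \<cdot>\<^sub>m ?I \<in> carrier_mat n n" for k by simp
    have "(P - a \<cdot>\<^sub>m ?I) * (Q - b \<cdot>\<^sub>m ?I) = P * (Q - b \<cdot>\<^sub>m ?I) - (a \<cdot>\<^sub>m ?I) * (Q - b \<cdot>\<^sub>m ?I)"
      using minus_mult_distrib_mat[OF P I minus_carrier_mat[OF I]] by simp
    also have "P * (Q - b \<cdot>\<^sub>m ?I) = P * Q - b \<cdot>\<^sub>m P"
      using mult_minus_distrib_mat[OF P Q I] mult_smult_distrib[OF P, of ?I n b] P by simp
    also have "(a \<cdot>\<^sub>m ?I) * (Q - b \<cdot>\<^sub>m ?I) = a \<cdot>\<^sub>m (Q - b \<cdot>\<^sub>m ?I)"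
      using mult_smult_assoc_mat[OF one_carrier_mat minus_carrier_mat[OF I, of Q b], of a]
        left_mult_one_mat[OF minus_carrier_mat[OF I, of Q b]] by simp
    also have "\<dots> = a \<cdot>\<^sub>m Q - (a * b) \<cdot>\<^sub>m ?I" using Q by (intro eq_matI) (auto simp: algebra_simps)
    finally show ?thesis .
  qed
  show ?thesis
    unfolding *[OF A B] *[OF B A] using A B by (intro eq_matI) (auto simp: algebra_simps)
qed

definition traceless_part :: "nat \<Rightarrow> complex mat \<Rightarrow> complex mat" where
  "traceless_part n A = A - (mtrace A / of_nat n) \<cdot>\<^sub>m 1\<^sub>m n"

lemma traceless_part_carrier: "A \<in> carrier_mat n n \<Longrightarrow> traceless_part n A \<in> carrier_mat n n"
  by (auto simp: traceless_part_def)

lemma traceless_part_sl: "0 < n \<Longrightarrow> A \<in> carrier_mat n n \<Longrightarrow> traceless_part n A \<in> carrier (sl_lie n)"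
proof -
  assume n: "0 < n" and A: "A \<in> carrier_mat n n"
  have "mtrace (traceless_part n A) = mtrace A - mtrace A / of_nat n * of_nat n"
    unfolding traceless_part_def
    using mtrace_simps(2)[OF A, of "(mtrace A / of_nat n) \<cdot>\<^sub>m 1\<^sub>m n"]
      mtrace_smult[of "1\<^sub>m n" n "mtrace A / of_nat n"] mtrace_one[of n] by simp
  then show ?thesis using n traceless_part_carrier[OF A] by simp
qed

lemma traceless_part_linear:
  assumes A: "A \<in> carrier_mat n n" and B: "B \<in> carrier_mat n n"
  shows "traceless_part n (A + B) = traceless_part n A + traceless_part n B"
    and "traceless_part n (c \<cdot>\<^sub>m A) = c \<cdot>\<^sub>m traceless_part n A"
    and "traceless_part n (A * B - B * A) =
      traceless_part n A * traceless_part n B - traceless_part n B * traceless_part n A"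
proof -
  show "traceless_part n (A + B) = traceless_part n A + traceless_part n B"
    using A B unfolding traceless_part_def mtrace_simps(1)[OF A B]
    by (intro eq_matI) (auto simp: add_divide_distrib)
  show "traceless_part n (c \<cdot>\<^sub>m A) = c \<cdot>\<^sub>m traceless_part n A"
    using A unfolding traceless_part_def mtrace_smult[OF A]
    by (intro eq_matI) (auto simp: algebra_simps)
  have "P - 0 \<cdot>\<^sub>m 1\<^sub>m n = P" if "P \<in> carrier_mat n n" for P :: "complex mat"
    using that by (intro eq_matI) auto
  moreover have "A * B - B * A \<in> carrier_mat n n" using A B by (intro minus_carrier_mat) auto
  ultimately have "A * B - B * A - 0 \<cdot>\<^sub>m 1\<^sub>m n = A * B - B * A" by blast
  then show "traceless_part n (A * B - B * A) =
      traceless_part n A * traceless_part n B - traceless_part n B * traceless_part n A"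
    unfolding traceless_part_def scalar_shift_commutator[OF A B] mtrace_commutator[OF A B] by simp
qed

context blocks begin

definition bl :: "nat \<Rightarrow> complex mat \<Rightarrow> complex mat" where
  "bl m X = mat p p (\<lambda>(i, j). X $$ (m * p + i, m * p + j))"

lemma bl_carrier [simp]: "bl m X \<in> carrier_mat p p"
  by (simp add: bl_def)

lemma bl_linear:
  assumes "m < l" "X \<in> carrier_mat N N" "Y \<in> carrier_mat N N"
  shows "bl m (X + Y) = bl m X + bl m Y" "bl m (X - Y) = bl m X - bl m Y" "bl m (c \<cdot>\<^sub>m X) = c \<cdot>\<^sub>m bl m X"
  using assms block_index(4) by (auto simp: bl_def intro!: eq_matI)

lemma bl_mult:
  assumes m: "m < l" and X: "X \<in> blk N p" and Y: "Y \<in> blk N p"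
  shows "bl m (X * Y) = bl m X * bl m Y"
proof (rule eq_matI)
  fix i j assume "i < dim_row (bl m X * bl m Y)" "j < dim_col (bl m X * bl m Y)"
  then have ij: "i < p" "j < p" by (auto simp: bl_def)
  have c: "X \<in> carrier_mat N N" "Y \<in> carrier_mat N N" using X Y by (auto simp: blk_def)
  have "(X * Y) $$ (m * p + i, m * p + j) = (\<Sum>k<N. X $$ (m * p + i, k) * Y $$ (k, m * p + j))"
    using ij m block_index(4) by (intro mat_mult_entry c) auto
  also have "\<dots> = (\<Sum>m'<l. \<Sum>t<p. X $$ (m * p + i, m' * p + t) * Y $$ (m' * p + t, m * p + j))"
    by (rule sum_blocks)
  also have "\<dots> = (\<Sum>m'<l. if m' = m then \<Sum>t<p. X $$ (m * p + i, m * p + t) * Y $$ (m * p + t, m * p + j) else 0)"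
  proof (intro sum.cong refl)
    fix m' assume m': "m' \<in> {..<l}"
    have "X $$ (m * p + i, m' * p + t) = 0" if "m' \<noteq> m" "t < p" for t
      using X ij m m' that block_index(4)[of i m] block_index(4)[of t m'] by (simp add: blk_def)
    then show "(\<Sum>t<p. X $$ (m * p + i, m' * p + t) * Y $$ (m' * p + t, m * p + j)) =
        (if m' = m then \<Sum>t<p. X $$ (m * p + i, m * p + t) * Y $$ (m * p + t, m * p + j) else 0)"
      by (auto intro!: sum.neutral)
  qed
  also have "\<dots> = (\<Sum>t<p. bl m X $$ (i, t) * bl m Y $$ (t, j))"
    using m ij by (simp add: bl_def)
  also have "\<dots> = (bl m X * bl m Y) $$ (i, j)"
    using ij by (intro mat_mult_entry[symmetric]) auto
  finally show "bl m (X * Y) $$ (i, j) = (bl m X * bl m Y) $$ (i, j)"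
    using ij by (simp add: bl_def del: index_mult_mat(1))
qed (auto simp: bl_def)

lemma bl_commutator: "m < l \<Longrightarrow> X \<in> blk N p \<Longrightarrow> Y \<in> blk N p \<Longrightarrow>
    bl m (X * Y - Y * X) = bl m X * bl m Y - bl m Y * bl m X"
  using blk_closed(5)[of X N p Y] blk_closed(5)[of Y N p X]
  by (subst bl_linear(2)) (auto simp: blk_def bl_mult)

lemma mtrace_bl: "X \<in> carrier_mat N N \<Longrightarrow> mtrace X = (\<Sum>m<l. mtrace (bl m X))"
proof -
  assume X: "X \<in> carrier_mat N N"
  have "mtrace X = (\<Sum>r<N. X $$ (r, r))" using X by (auto simp: mtrace_def)
  also have "\<dots> = (\<Sum>m<l. \<Sum>i<p. X $$ (m * p + i, m * p + i))" by (rule sum_blocks)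
  also have "\<dots> = (\<Sum>m<l. mtrace (bl m X))" by (simp add: mtrace_def bl_def)
  finally show ?thesis .
qed

definition unbl :: "(nat \<Rightarrow> complex mat) \<Rightarrow> complex mat" where
  "unbl Y = mat N N (\<lambda>(r, c). if r div p = c div p then Y (r div p) $$ (r mod p, c mod p) else 0)"

lemma unbl_blk: "unbl Y \<in> blk N p"
  by (simp add: unbl_def blk_def)

lemma bl_unbl: "m < l \<Longrightarrow> Y m \<in> carrier_mat p p \<Longrightarrow> bl m (unbl Y) = Y m"
  using block_index(4) by (intro eq_matI) (auto simp: bl_def unbl_def)

lemma unbl_bl:
  assumes X: "X \<in> blk N p" and Y: "\<And>m. m < l \<Longrightarrow> Y m = bl m X"
  shows "unbl Y = X"
proof (rule eq_matI)
  show "dim_row (unbl Y) = dim_row X" "dim_col (unbl Y) = dim_col X" using X by (auto simp: unbl_def blk_def)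
  fix r c assume "r < dim_row X" "c < dim_col X"
  then have rc: "r < N" "c < N" using X by (auto simp: blk_def)
  show "unbl Y $$ (r, c) = X $$ (r, c)"
  proof (cases "r div p = c div p")
    case True
    have "r div p * p + c mod p = c" unfolding True by simp
    moreover have "c div p * p + r mod p = r" unfolding True[symmetric] by simp
    ultimately show ?thesis using True rc block_index(1,2)[OF rc(1)] block_index(2)[OF rc(2)]
      by (simp add: unbl_def Y bl_def)
  next
    case False
    then show ?thesis using X rc by (simp add: unbl_def blk_def)
  qed
qed

lemma unbl_const_circ: "unbl (\<lambda>_. A) \<in> circ N p"
proof -
  have "(r + p) mod N div p = (c + p) mod N div p \<longleftrightarrow> r div p = c div p" if rc: "r < N" "c < N" for r c
    using inj_on_eq_iff[OF bij_betw_imp_inj_on[OF bij_betw_add_mod[of l 1]], of "r div p" "c div p"]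
      block_index(1)[OF rc(1)] block_index(1)[OF rc(2)] l by (simp add: shift_div rc)
  then show ?thesis using N_pos(1) by (auto simp: circ_def unbl_def mod_shift)
qed

text \<open>The first block determines the others, which repeat it. The total trace is
  \<open>l\<close> times the trace of the first block, so tracelessness carries over in both
  directions.\<close>

lemma slp_isomorphic: "lie_isomorphic ((sl_lie N)\<lparr>carrier := g0b\<rparr>) (sl_lie p)"
proof -
  have same: "bl m X = bl 0 X" if "X \<in> g0b" "m < l" for X m
    using that circ_shift[of X m] by (auto simp: bl_def intro!: eq_matI)
  have tr: "mtrace X = of_nat l * mtrace (bl 0 X)" if X: "X \<in> circ N p" for X
    using mtrace_circ[OF X] by (simp add: mtrace_def bl_def)
  have l0: "0 < l" using l by simp
  have cl: "bl 0 X \<in> carrier (sl_lie p)" if "X \<in> g0b" for X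
    using tr[of X] that l0 by auto
  have preimage: "unbl (\<lambda>_. A) \<in> g0b" if A: "A \<in> carrier (sl_lie p)" for A
    using unbl_const_circ[of A] unbl_blk[of "\<lambda>_. A"] tr[OF unbl_const_circ[of A]] bl_unbl[OF l0, of "\<lambda>_. A"] A
    by (simp add: blk_def)
  have "bij_betw (bl 0) g0b (carrier (sl_lie p))"
  proof (rule bij_betw_byWitness[where f' = "\<lambda>A. unbl (\<lambda>_. A)"])
    show "\<forall>X\<in>g0b. unbl (\<lambda>_. bl 0 X) = X"
    proof
      fix X assume X: "X \<in> g0b"
      show "unbl (\<lambda>_. bl 0 X) = X"
        by (rule unbl_bl) (use X in blast, rule same[OF X, symmetric])
    qed
    show "\<forall>A\<in>carrier (sl_lie p). bl 0 (unbl (\<lambda>_. A)) = A" using bl_unbl[OF l0] by simp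
  qed (use cl preimage in blast)+
  moreover have "bl 0 (X + Y) = bl 0 X + bl 0 Y" "bl 0 (c \<cdot>\<^sub>m X) = c \<cdot>\<^sub>m bl 0 X"
    "bl 0 (X * Y - Y * X) = bl 0 X * bl 0 Y - bl 0 Y * bl 0 X" if "X \<in> g0b" "Y \<in> g0b" for X Y c
    using that by (auto intro!: bl_linear[OF l0] bl_commutator[OF l0])
  ultimately have "bl 0 \<in> lie_iso ((sl_lie N)\<lparr>carrier := g0b\<rparr>) (sl_lie p)"
    unfolding lie_iso_def LinearCombinations.module_hom_def using cl by auto
  then show ?thesis by (auto simp: lie_isomorphic_def)
qed

text \<open>Only \<open>l - 1\<close> block traces are recorded: the last one is minus their sum.
  This accounts for the \<open>l - 1\<close> one-dimensional summands.\<close>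

definition block_sum :: "complex mat \<Rightarrow> (nat \<Rightarrow> complex mat) \<times> (nat \<Rightarrow> complex)" where
  "block_sum X = (\<lambda>m\<in>{..<l}. traceless_part p (bl m X), \<lambda>m\<in>{..<l - 1}. mtrace (bl m X))"

abbreviation "target \<equiv> lie_sum (lie_power (sl_lie p) l) (lie_power abelian_line (l - 1))"

lemma block_sum_bij: "bij_betw block_sum (blk N p \<inter> carrier (sl_lie N)) (carrier target)"
proof -
  \<comment> \<open>Ingredients of the inverse map: \<open>\<tau>\<close> restores the trace of the
    last block, and \<open>B\<close> adds to a traceless block the scalar matrix with the prescribed
    trace.\<close>
  define \<tau> where "\<tau> t m = (if m < l - 1 then t m else - (\<Sum>j<l - 1. t j))" for t :: "nat \<Rightarrow> complex" and m
  define B where "B Z s = Z + (s / of_nat p) \<cdot>\<^sub>m 1\<^sub>m p" for Z :: "complex mat" and s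
  have p0: "(of_nat p :: complex) \<noteq> 0" "0 < p" using p by auto
  have split: "(\<Sum>m<l. f m) = (\<Sum>m<l - 1. f m) + f (l - 1)" for f :: "nat \<Rightarrow> complex"
    using l by (metis One_nat_def Suc_pred' not_numeral_le_zero neq0_conv sum.lessThan_Suc)
  have car: "carrier target = ({..<l} \<rightarrow>\<^sub>E carrier (sl_lie p)) \<times> ({..<l - 1} \<rightarrow>\<^sub>E UNIV)"
    by (simp add: lie_sum_def lie_power_def abelian_line_def)
  have B: "B Z s \<in> carrier_mat p p" "mtrace (B Z s) = s" "traceless_part p (B Z s) = Z"
    if Z: "Z \<in> carrier (sl_lie p)" for Z s
  proof -
    have Yc: "Z \<in> carrier_mat p p" "mtrace Z = 0" using Z by auto
    show "B Z s \<in> carrier_mat p p" using Yc by (simp add: B_def)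
    show tr: "mtrace (B Z s) = s"
      using mtrace_simps(1)[OF Yc(1), of "(s / of_nat p) \<cdot>\<^sub>m 1\<^sub>m p"]
        mtrace_smult[of "1\<^sub>m p" p "s / of_nat p"] Yc(2) p0 by (simp add: B_def mtrace_one)
    show "traceless_part p (B Z s) = Z"
      unfolding traceless_part_def tr using Yc by (intro eq_matI) (auto simp: B_def)
  qed
  show ?thesis
  proof (rule bij_betw_byWitness[where f' = "\<lambda>(Y, t). unbl (\<lambda>m. B (Y m) (\<tau> t m))"])
    show "block_sum ` (blk N p \<inter> carrier (sl_lie N)) \<subseteq> carrier target"
      unfolding car block_sum_def
      by (intro image_subsetI SigmaI restrict_PiE_iff[THEN iffD2] ballI
          traceless_part_sl[OF p0(2) bl_carrier] UNIV_I)
    show "(\<lambda>(Y, t). unbl (\<lambda>m. B (Y m) (\<tau> t m))) ` carrier target \<subseteq> blk N p \<inter> carrier (sl_lie N)"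
    proof
      fix X assume "X \<in> (\<lambda>(Y, t). unbl (\<lambda>m. B (Y m) (\<tau> t m))) ` carrier target"
      then obtain Y t where Yt: "Y \<in> {..<l} \<rightarrow>\<^sub>E carrier (sl_lie p)" "X = unbl (\<lambda>m. B (Y m) (\<tau> t m))" unfolding car by auto
      have Ym: "Y m \<in> carrier (sl_lie p)" if "m < l" for m using Yt(1) that by (auto simp: PiE_iff)
      have Xb: "X \<in> blk N p" "X \<in> carrier_mat N N" using unbl_blk Yt(2) by (auto simp: blk_def)
      have "mtrace (bl m X) = \<tau> t m" if m: "m < l" for m
      proof -
        have "bl m X = B (Y m) (\<tau> t m)"
          unfolding Yt(2) by (rule bl_unbl[OF m]) (rule B(1)[OF Ym[OF m]])
        then show ?thesis using B(2)[OF Ym[OF m]] by simp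
      qed
      then have "mtrace X = (\<Sum>m<l. \<tau> t m)" unfolding mtrace_bl[OF Xb(2)] by simp
      also have "\<dots> = 0" unfolding split by (simp add: \<tau>_def)
      finally show "X \<in> blk N p \<inter> carrier (sl_lie N)" using Xb by simp
    qed
    show "\<forall>X\<in>blk N p \<inter> carrier (sl_lie N). (case block_sum X of (Y, t) \<Rightarrow> unbl (\<lambda>m. B (Y m) (\<tau> t m))) = X"
    proof
      fix X assume X: "X \<in> blk N p \<inter> carrier (sl_lie N)"
      then have "(\<Sum>m<l. mtrace (bl m X)) = 0" using mtrace_bl[of X] by simp
      then have "mtrace (bl (l - 1) X) = - (\<Sum>m<l - 1. mtrace (bl m X))"
        unfolding split by (simp add: add_eq_0_iff)
      then have \<tau>: "\<tau> (\<lambda>m\<in>{..<l - 1}. mtrace (bl m X)) m = mtrace (bl m X)" if "m < l" for m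
        using that by (cases "m = l - 1") (auto simp: \<tau>_def)
      show "(case block_sum X of (Y, t) \<Rightarrow> unbl (\<lambda>m. B (Y m) (\<tau> t m))) = X"
        unfolding block_sum_def prod.case
      proof (rule unbl_bl)
        fix m assume m: "m < l"
        show "B ((\<lambda>m\<in>{..<l}. traceless_part p (bl m X)) m) (\<tau> (\<lambda>m\<in>{..<l - 1}. mtrace (bl m X)) m) = bl m X"
          unfolding B_def \<tau>[OF m] traceless_part_def using m carrier_matD[OF bl_carrier[of m X]]
          by (intro eq_matI) auto
      qed (use X in blast)
    qed
    show "\<forall>Z\<in>carrier target. block_sum (case Z of (Y, t) \<Rightarrow> unbl (\<lambda>m. B (Y m) (\<tau> t m))) = Z"
    proof
      fix Z assume "Z \<in> carrier target"
      then obtain Y t where Z: "Z = (Y, t)" "Y \<in> {..<l} \<rightarrow>\<^sub>E carrier (sl_lie p)" "t \<in> {..<l - 1} \<rightarrow>\<^sub>E UNIV"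
        unfolding car by auto
      have Ym: "Y m \<in> carrier (sl_lie p)" if "m < l" for m using Z(2) that by (auto simp: PiE_iff)
      have b: "bl m (unbl (\<lambda>m. B (Y m) (\<tau> t m))) = B (Y m) (\<tau> t m)" if "m < l" for m
        by (rule bl_unbl[OF that]) (rule B(1)[OF Ym[OF that]])
      have "(\<lambda>m\<in>{..<l}. traceless_part p (bl m (unbl (\<lambda>m. B (Y m) (\<tau> t m))))) = Y"
        using Z(2) b B(3)[OF Ym] by (intro extensionalityI[of _ "{..<l}"]) (auto simp: PiE_iff)
      moreover have "(\<lambda>m\<in>{..<l - 1}. mtrace (bl m (unbl (\<lambda>m. B (Y m) (\<tau> t m))))) = t"
        using Z(3) b B(2)[OF Ym] by (intro extensionalityI[of _ "{..<l - 1}"]) (auto simp: PiE_iff \<tau>_def)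
      ultimately show "block_sum (case Z of (Y, t) \<Rightarrow> unbl (\<lambda>m. B (Y m) (\<tau> t m))) = Z" by (simp add: Z(1) block_sum_def)
    qed
  qed
qed

text \<open>On the trace components the bracket of the target is 0, in accordance with the trace of
  a commutator of blocks.\<close>

lemma block_sum_iso: "block_sum \<in> lie_iso ((sl_lie N)\<lparr>carrier := blk N p \<inter> carrier (sl_lie N)\<rparr>) target"
proof -
  let ?W = "blk N p \<inter> carrier (sl_lie N)"
  note simps = lie_sum_def lie_power_def abelian_line_def
  have add: "block_sum (X + Y) = add target (block_sum X) (block_sum Y)"
    "block_sum (c \<cdot>\<^sub>m X) = module.smult target c (block_sum X)"
    "block_sum (X * Y - Y * X) = monoid.mult target (block_sum X) (block_sum Y)"
    if XY: "X \<in> ?W" "Y \<in> ?W" for X Y c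
  proof -
    have c: "X \<in> carrier_mat N N" "Y \<in> carrier_mat N N" "X \<in> blk N p" "Y \<in> blk N p" using XY by auto
    note tl = traceless_part_linear[OF bl_carrier bl_carrier]
    show "block_sum (X + Y) = add target (block_sum X) (block_sum Y)"
      using mtrace_simps(1)[OF bl_carrier bl_carrier]
      by (auto simp: simps block_sum_def bl_linear(1)[OF _ c(1,2)] tl(1) intro!: restrict_ext)
    show "block_sum (c \<cdot>\<^sub>m X) = module.smult target c (block_sum X)"
      using mtrace_smult[OF bl_carrier]
      by (auto simp: simps block_sum_def bl_linear(3)[OF _ c(1,2)] tl(2) intro!: restrict_ext)
    show "block_sum (X * Y - Y * X) = monoid.mult target (block_sum X) (block_sum Y)"
      using mtrace_commutator[OF bl_carrier bl_carrier]
      by (auto simp: simps block_sum_def bl_commutator[OF _ c(3,4)] tl(3) intro!: restrict_ext)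
  qed
  have "block_sum X \<in> carrier target" if "X \<in> ?W" for X
    using block_sum_bij that by (auto simp: bij_betw_def)
  moreover have "carrier ((sl_lie N)\<lparr>carrier := ?W\<rparr>) = ?W" "add ((sl_lie N)\<lparr>carrier := ?W\<rparr>) = (+)"
    "module.smult ((sl_lie N)\<lparr>carrier := ?W\<rparr>) = (\<cdot>\<^sub>m)"
    "monoid.mult ((sl_lie N)\<lparr>carrier := ?W\<rparr>) = (\<lambda>A B. A * B - B * A)"
    by simp_all
  ultimately show ?thesis
    unfolding lie_iso_def LinearCombinations.module_hom_def using block_sum_bij add
    by (simp del: sl_lie_simps)
qed

lemma g0_isomorphic: "lie_isomorphic ((sl_lie N)\<lparr>carrier := g0 N p\<rparr>) target"
proof -
  have "g0 N p \<subseteq> carrier (sl_lie N)" by (auto simp: g0_def)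
  from lie_iso_comp[OF lie_iso_restrict[OF fmap_iso this, unfolded fmap_g0] block_sum_iso]
  show ?thesis by (auto simp: lie_isomorphic_def)
qed

text \<open>\<open>twist\<close> permutes the root vectors and does not scale them, so it can match
  Kac's automorphism only up to conjugation; the conjugating map is \<open>fmap\<close>.\<close>

lemma kac_structure:
  "\<exists>\<sigma>. kac_automorphism N (drop_labels p l) \<sigma> \<and>
    (\<forall>\<sigma>'. kac_automorphism N (drop_labels p l) \<sigma>' \<longrightarrow> \<sigma>' = \<sigma>) \<and>
    has_order (carrier (sl_lie N)) \<sigma> l \<and>
    {X \<in> carrier (sl_lie N). \<sigma> X = X} = kept_algebra N p l \<and>
    cartan_subalgebra (diag_cartan N) ((sl_lie N)\<lparr>carrier := kept_algebra N p l\<rparr>) \<and>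
    root_base ((sl_lie N)\<lparr>carrier := kept_algebra N p l\<rparr>) (diag_cartan N) (kept N p l)
      (\<lambda>k. functional (diag_cartan N) (ext_root N k)) \<and>
    (\<exists>\<phi>\<in>lie_iso (sl_lie N) (sl_lie N).
       (\<forall>X\<in>carrier (sl_lie N). \<phi> (twist N p X) = \<sigma> (\<phi> X)) \<and>
       \<phi> ` g0 N p = kept_algebra N p l)"
  unfolding kept_algebra_eq
proof (intro exI[of _ sg] conjI allI impI)
  show "\<exists>\<phi>\<in>lie_iso (sl_lie N) (sl_lie N). (\<forall>X\<in>carrier (sl_lie N). \<phi> (twist N p X) = sg (\<phi> X)) \<and>
      \<phi> ` g0 N p = blk N p \<inter> carrier (sl_lie N)"
    by (intro bexI[OF _ fmap_iso] conjI ballI fmap_twist fmap_g0)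
qed (rule kac_sg kac_unique sg_order sg_fixed kept.cartan_subalgebra_H root_base_kept; assumption?)+

end

theorem mainTheorem2:
  fixes N p l :: nat
  assumes "0 < N" and "N = p * l" and "l \<noteq> 1" and "l \<noteq> N"
  shows
    "(\<forall>j\<in>{1..int p - 1}. \<forall>k\<in>{1..int p - 1}.
        pairing (coroot_t N p l j) (root_t N p l k) = cartan_A j k) \<and>
     lie_subalgebra (g0_t N p l) (sl_lie N) \<and>
     g0_t N p l \<subseteq> g0 N p \<and>
     lie_isomorphic ((sl_lie N)\<lparr>carrier := g0_t N p l\<rparr>) (sl_lie p) \<and>
     bij_betw (\<lambda>ia. functional (H_t N p l) (root_of N p l ia)) (A_ind p)
       (roots ((sl_lie N)\<lparr>carrier := g0_t N p l\<rparr>) (H_t N p l)) \<and>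
     (\<exists>x. (\<forall>ia\<in>A_ind p. x (functional (H_t N p l) (root_of N p l ia)) = E_t N p l ia) \<and>
        chevalley_basis ((sl_lie N)\<lparr>carrier := g0_t N p l\<rparr>) (H_t N p l) {1..int p - 1}
          (\<lambda>k. functional (H_t N p l) (root_t N p l k)) (coroot_t N p l) x) \<and>

     inj_on (t0 N p l) (V_ind N p) \<and> \<not> lindep (gl_lie N) (t0 N p l ` V_ind N p) \<and>
     lie_subalgebra (g0 N p) (sl_lie N) \<and>
     lie_hull (sl_lie N) (g0_t N p l \<union> (V_space N p l \<inter> carrier (sl_lie N))) = g0 N p \<and>
     lspan (gl_lie N) (coroot_t N p l ` {1..int p - 1} \<union> E_t N p l ` E_ind p
       \<union> t0 N p l ` V_ind N p) \<inter> carrier (sl_lie N) = g0 N p \<and>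
     inj_on (t0 N p l) (W_ind N p) \<and> \<not> lindep (sl_lie N) (t0 N p l ` W_ind N p) \<and>
     LinearCombinations.module.submodule_sum (sl_lie N)
       (g0_t N p l) (lspan (sl_lie N) (t0 N p l ` W_ind N p)) = g0 N p \<and>
     g0_t N p l \<inter> lspan (sl_lie N) (t0 N p l ` W_ind N p) = {\<zero>\<^bsub>sl_lie N\<^esub>} \<and>
     lie_isomorphic ((sl_lie N)\<lparr>carrier := g0 N p\<rparr>)
       (lie_sum (lie_power (sl_lie p) l) (lie_power abelian_line (l - 1))) \<and>

     (\<exists>f. bij_betw f (kept N p l) ({..<l} \<times> {1..int p - 1}) \<and>
        (\<forall>j\<in>kept N p l. \<forall>k\<in>kept N p l. ext_cartan N j k =
           (if fst (f j) = fst (f k) then cartan_A (snd (f j)) (snd (f k)) else 0))) \<and>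
     (\<exists>\<sigma>. kac_automorphism N (drop_labels p l) \<sigma> \<and>
        (\<forall>\<sigma>'. kac_automorphism N (drop_labels p l) \<sigma>' \<longrightarrow> \<sigma>' = \<sigma>) \<and>
        has_order (carrier (sl_lie N)) \<sigma> l \<and>
        {X \<in> carrier (sl_lie N). \<sigma> X = X} = kept_algebra N p l \<and>
        cartan_subalgebra (diag_cartan N) ((sl_lie N)\<lparr>carrier := kept_algebra N p l\<rparr>) \<and>
        root_base ((sl_lie N)\<lparr>carrier := kept_algebra N p l\<rparr>) (diag_cartan N) (kept N p l)
          (\<lambda>k. functional (diag_cartan N) (ext_root N k)) \<and>
        (\<exists>\<phi>\<in>lie_iso (sl_lie N) (sl_lie N).
           (\<forall>X\<in>carrier (sl_lie N). \<phi> (twist N p X) = \<sigma> (\<phi> X)) \<and>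
           \<phi> ` g0 N p = kept_algebra N p l))"
proof -
  \<comment> \<open>\<open>l \<noteq> N\<close> excludes \<open>p = 1\<close>, and
    \<open>0 < N\<close> excludes vanishing factors; together with \<open>l \<noteq> 1\<close> both
    factors are at least 2.\<close>
  have "p \<noteq> 0" "p \<noteq> 1" "l \<noteq> 0" using assms by auto
  then interpret blocks N p l using assms by unfold_locales auto
  show ?thesis
    unfolding H_t_eq g0_t_eq
  proof (intro conjI)
    show "\<forall>j\<in>{1..int p - 1}. \<forall>k\<in>{1..int p - 1}. pairing (coroot_t N p l j) (root_t N p l k) = cartan_A j k"
      using pairing_coroot_root by blast
    show "g0b \<subseteq> g0 N p" unfolding g0_eq by blast
  qed (rule lie_subalgebra_circ_blk slp_isomorphic bij_betw_roots chevalley_basis_exists V_W_independent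
      g0_subalgebra g0b_V_hull[unfolded g0_t_eq] span_all_eq_g0 g0_decomposition[unfolded g0_t_eq]
      g0_isomorphic kept_diagram kac_structure)+
qed

end
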